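(* Consider finite subsets $\alpha\subseteq S$ with $\mathcal A_\alpha\simeq A_4$ and with prescribed tetrahedral component index. (a) For component index $(1,0,0)$ such $\alpha$ exists, and $|\alpha|=4$; for $(1,1,0)$ such $\alpha$ exists, and $|\alpha|=10$; for each $(\nu,\epsilon,k)\in\{0,1,2\}\times\{0,1\}\times\mathbb N$ with $k\ge1$ such $\alpha$ exists, and $|\alpha|=4\nu+6\epsilon+12k$. (b) For each of the component indices $(2,0,0)$, $(0,1,0)$, $(2,1,0)$ no such $\alpha$ exists. Moreover, $$\{|\alpha| : \alpha\subseteq S\text{ finite},\ \mathcal A_\alpha\simeq A_4\}=\{x+12k\mid x\in\{0,4,6,8,10,14\},\ k\in\mathbb N^+\}\cup\{4,10\}.$$
   Context: $\mathbb N=\{0,1,2,\dots\}$, $\mathbb N^+=\{1,2,\dots\}$. $S=\{(x_1,x_2,x_3)\in\mathbb R^3: x_1^2+x_2^2+x_3^2=1\}$ is the Riemann sphere, identified with $\widehat{\mathbb C}=\mathbb C\cup\{\infty\}$ by stereographic projection, so that Möbius transformations ($\mathrm{PSL}(2,\mathbb C)$) act on $S$ and rotations about the origin are Möbius transformations. For $\alpha\subseteq S$, $\mathcal A_\alpha$ is the group of all Möbius transformations $f$ with $f(\alpha)=\alpha$. Let $G\simeq A_4$ be the tetrahedral group of rotations preserving a regular tetrahedron centred at the origin and inscribed in $S$. $V\subseteq S$ is its set of vertices, $F\subseteq S$ the set of projections from the origin onto $S$ of the centres of its faces, $E\subseteq S$ the set of projections from the origin onto $S$ of the midpoints of its edges.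 For $X\in S\setminus(V\cup F\cup E)$, $B(X)$ is the orbit of $X$ under $G$. ($V$ and $F$ have the same cardinality and are considered of the same type.) For a subset $\alpha\subseteq S$ that is a finite union of $G$-orbits, its tetrahedral component index is $(\nu,\epsilon,k)\in\{0,1,2\}\times\{0,1\}\times\mathbb N$, where $\nu$ is the number of orbits among $V,F$ contained in $\alpha$, $\epsilon$ is the number of orbits of type $E$, and $k$ the number of orbits of type $B$. *)

theory Defs
  imports "HOL-Analysis.Analysis" "HOL-Algebra.Bij" "HOL-Algebra.Sym_Groups"
begin

section \<open>The Riemann sphere and its Moebius transformations\<close>

abbreviation riemann_sphere :: "(real ^ 3) set" where
  "riemann_sphere \<equiv> sphere 0 1"

text \<open>The extended complex plane is \<^typ>\<open>complex option\<close>, with \<^term>\<open>None\<close> as the point at infinity.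
  The projection is from the north pole \<open>(0, 0, 1)\<close>, the only point of the sphere with third
  coordinate \<open>1\<close>.\<close>

definition stereographic :: "real ^ 3 \<Rightarrow> complex option" where
  "stereographic x =
     (if x $ 3 = 1 then None else Some (Complex (x $ 1 / (1 - x $ 3)) (x $ 2 / (1 - x $ 3))))"

text \<open>The library function \<^term>\<open>moebius\<close>, extended to the point at infinity.\<close>

definition moebius_ext ::
    "complex \<Rightarrow> complex \<Rightarrow> complex \<Rightarrow> complex \<Rightarrow> complex option \<Rightarrow> complex option" where
  "moebius_ext a b c d w =
     (case w of
        None \<Rightarrow> (if c = 0 then None else Some (a / c))
      | Some z \<Rightarrow> (if c * z + d = 0 then None else Some (moebius a b c d z)))"

text \<open>Functions in \<^term>\<open>Bij riemann_sphere\<close> are extensional (\<^term>\<open>undefined\<close> off the sphere), so a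
  transformation of the sphere corresponds to exactly one function, and hence to exactly one
  element of \<open>PSL(2,C)\<close>.\<close>

definition moebius_transformations :: "(real ^ 3 \<Rightarrow> real ^ 3) set" where
  "moebius_transformations =
     {f \<in> Bij riemann_sphere. \<exists>a b c d. a * d - b * c \<noteq> 0 \<and>
        (\<forall>x\<in>riemann_sphere. stereographic (f x) = moebius_ext a b c d (stereographic x))}"

definition moebius_group_of :: "(real ^ 3) set \<Rightarrow> (real ^ 3 \<Rightarrow> real ^ 3) monoid" where
  "moebius_group_of \<alpha> =
     (BijGroup riemann_sphere) \<lparr>carrier := {f \<in> moebius_transformations. f ` \<alpha> = \<alpha>}\<rparr>"


section \<open>The tetrahedral group and its orbits\<close>

text \<open>\<open>V\<close> is the vertex set of a regular tetrahedron centred at the origin and inscribed in the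
  sphere; the tetrahedron itself is \<^term>\<open>convex hull V\<close>.\<close>

definition inscribed_regular_tetrahedron :: "(real ^ 3) set \<Rightarrow> bool" where
  "inscribed_regular_tetrahedron V \<longleftrightarrow>
     V \<subseteq> riemann_sphere \<and> card V = 4 \<and> (\<Sum>v\<in>V. v) = 0 \<and>
     (\<exists>l. \<forall>u\<in>V. \<forall>v\<in>V. u \<noteq> v \<longrightarrow> dist u v = l)"

definition tetrahedral_group :: "(real ^ 3) set \<Rightarrow> (real ^ 3 ^ 3) set" where
  "tetrahedral_group V =
     {Q. rotation_matrix Q \<and> (\<lambda>x. Q *v x) ` (convex hull V) = convex hull V}"

definition tetrahedral_orbit :: "(real ^ 3) set \<Rightarrow> real ^ 3 \<Rightarrow> (real ^ 3) set" where
  "tetrahedral_orbit V x = (\<lambda>Q. Q *v x) ` tetrahedral_group V"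

text \<open>The faces are the triangles spanned by three of the four vertices, the edges the segments
  spanned by two of them.  The projection from the origin onto the sphere is
  \<^term>\<open>sgn :: real ^ 3 \<Rightarrow> real ^ 3\<close>, which maps \<open>x \<noteq> 0\<close> to \<open>x / norm x\<close>.\<close>

definition face_points :: "(real ^ 3) set \<Rightarrow> (real ^ 3) set" where
  "face_points V = {sgn ((1 / 3) *\<^sub>R (\<Sum>v\<in>W. v)) | W. W \<subseteq> V \<and> card W = 3}"

definition edge_points :: "(real ^ 3) set \<Rightarrow> (real ^ 3) set" where
  "edge_points V = {sgn (midpoint u v) | u v. u \<in> V \<and> v \<in> V \<and> u \<noteq> v}"

definition generic_orbits :: "(real ^ 3) set \<Rightarrow> (real ^ 3) set set" where
  "generic_orbits V =
     tetrahedral_orbit V ` (riemann_sphere - (V \<union> face_points V \<union> edge_points V))"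

definition finite_union_of_orbits :: "(real ^ 3) set \<Rightarrow> (real ^ 3) set \<Rightarrow> bool" where
  "finite_union_of_orbits V \<alpha> \<longleftrightarrow>
     (\<exists>\<O>. finite \<O> \<and> \<O> \<subseteq> tetrahedral_orbit V ` riemann_sphere \<and> \<alpha> = \<Union>\<O>)"

definition component_index :: "(real ^ 3) set \<Rightarrow> (real ^ 3) set \<Rightarrow> nat \<times> nat \<times> nat" where
  "component_index V \<alpha> =
     (card {\<omega> \<in> {V, face_points V}. \<omega> \<subseteq> \<alpha>},
      card {\<omega> \<in> {edge_points V}. \<omega> \<subseteq> \<alpha>},
      card {\<omega> \<in> generic_orbits V. \<omega> \<subseteq> \<alpha>})"

definition A4_set :: "(real ^ 3) set \<Rightarrow> bool" where
  "A4_set \<alpha> \<longleftrightarrow>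
     finite \<alpha> \<and> \<alpha> \<subseteq> riemann_sphere \<and> moebius_group_of \<alpha> \<cong> alt_group 4"

definition A4_set_of_index ::
    "(real ^ 3) set \<Rightarrow> nat \<times> nat \<times> nat \<Rightarrow> (real ^ 3) set \<Rightarrow> bool" where
  "A4_set_of_index V i \<alpha> \<longleftrightarrow>
     A4_set \<alpha> \<and> finite_union_of_orbits V \<alpha> \<and> component_index V \<alpha> = i"

end

theory Submission
  imports Defs
begin

text \<open>
  Write \<open>G\<close> for the tetrahedral group and \<open>Stab \<alpha>\<close> for the group of all Moebius transformations that map
  \<open>\<alpha>\<close> onto itself.  Three facts carry the proof.

  \<^item> Rigidity (\<open>balanced_moebius_isometry\<close>).  A Moebius transformation \<open>f\<close> that permutes a finite set
    \<open>\<alpha>\<close> of at least three points whose sum is \<open>0\<close> is an isometry of the sphere.  Indeed \<open>f\<close> scales squared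
    chords by \<open>1 / (\<rho> x * \<rho> y)\<close> with \<open>\<rho> x = cosh t + (n \<bullet> x) sinh t\<close> for a unit vector \<open>n\<close>; since
    \<open>f\<close> permutes the chords of \<open>\<alpha>\<close>, the product of \<open>\<rho>\<close> over \<open>\<alpha>\<close> is \<open>1\<close>, whereas convexity of \<open>exp\<close> makes
    it larger than \<open>exp (t * (n \<bullet> \<Sum>\<alpha>)) = 1\<close> unless \<open>t = 0\<close>.  A \<open>G\<close>-invariant set has sum \<open>0\<close>, so for
    such sets the question about Moebius transformations becomes one about orthogonal maps.

  \<^item> Permutations of the vertices.  Every permutation \<open>p\<close> of the four vertices extends to exactly one
    orthogonal map \<open>act p\<close>; transpositions give reflections, that is, negatives of half-turns.  Hence
    \<open>sign p\<close> times \<open>act p\<close> is a product of half-turns, so it is a rotation and a Moebius transformation;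
    all \<open>p\<close> together give the octahedral group, the even ones give \<open>G\<close>.  As the antipodal map is not a
    Moebius transformation, \<open>Stab V = G\<close> (\<open>moebius_stabilizer_V\<close>).  Nontrivial elements of \<open>G\<close> fix only
    points of \<open>V\<close>, \<open>F\<close> and \<open>E\<close>, which gives the orbit lengths 4, 4, 6, 12 and the formula for the
    cardinality.

  \<^item> Conjugacy (\<open>A4_set_conjugate_to_standard\<close>).  Two commuting involutions in the alternating group
    can be conjugated to the half-turns about two coordinate axes, and an element of order 3 that
    permutes the Klein four-group cyclically is then one of four explicit rotations.  So any \<open>Stab \<alpha>\<close>
    isomorphic to the alternating group is conjugate to the tetrahedral group of one standard
    tetrahedron, and the list of possible cardinalities follows from the case of invariant sets.

  Non-existence: if no generic orbit occurs and \<open>V\<close>, \<open>F\<close> occur together or not at all, then \<open>\<alpha>\<close> is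
  invariant under the 24 octahedral rotations (\<open>octahedral_not_order_12\<close>).  Existence for \<open>k \<ge> 1\<close>: let
  the last generic orbit be that of a point very close to a vertex (\<open>generic_orbit_near_vertex\<close>).  The
  points of \<open>\<alpha>\<close> then form clusters around the vertices and isolated points elsewhere; an isometry
  permutes the clusters, hence the vertices.  For \<open>V \<union> E\<close> the edge points are recognised as the points
  whose antipodes also belong to the set.
\<close>

section \<open>Moebius transformations in homogeneous coordinates\<close>

text \<open>The Hopf map: \<open>hopf u / |u|\<^sup>2\<close> is the point of the sphere whose stereographic image has the
  homogeneous coordinates \<open>u\<close>.\<close>

definition hopf :: "complex ^ 2 \<Rightarrow> real ^ 3" where
  "hopf u = vector [2 * Re (u $ 1 * cnj (u $ 2)), 2 * Im (u $ 1 * cnj (u $ 2)),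
                    (cmod (u $ 1))\<^sup>2 - (cmod (u $ 2))\<^sup>2]"

definition sphere_point :: "complex ^ 2 \<Rightarrow> real ^ 3" where
  "sphere_point u = hopf u /\<^sub>R (norm u)\<^sup>2"

text \<open>The determinant of the columns \<open>u\<close>, \<open>w\<close>.  Up to normalisation its modulus is the chord between the
  corresponding points, and it is multiplied by \<open>det A\<close> under a matrix \<open>A\<close>.\<close>

definition wedge :: "complex ^ 2 \<Rightarrow> complex ^ 2 \<Rightarrow> complex" where
  "wedge u w = u $ 1 * w $ 2 - u $ 2 * w $ 1"

definition homogeneous :: "complex ^ 2 \<Rightarrow> complex option" where
  "homogeneous u = (if u $ 2 = 0 then None else Some (u $ 1 / u $ 2))"

text \<open>Any choice of coordinates \<open>u\<close> gives the same value when \<open>A\<close> is invertible, since two vectors describe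
  the same point exactly when they are proportional.\<close>

definition mob :: "complex ^ 2 ^ 2 \<Rightarrow> real ^ 3 \<Rightarrow> real ^ 3" where
  "mob A = (\<lambda>x\<in>riemann_sphere. sphere_point (A *v (SOME u. u \<noteq> 0 \<and> sphere_point u = x)))"

lemma norm_C2: "(norm (u :: complex ^ 2))\<^sup>2 = (cmod (u $ 1))\<^sup>2 + (cmod (u $ 2))\<^sup>2"
  by (simp add: norm_vec_def L2_set_def sum_2 add_nonneg_nonneg)

text \<open>This is Lagrange's identity \<open>|\<langle>u, w\<rangle>|\<^sup>2 + |wedge u w|\<^sup>2 = |u|\<^sup>2 |w|\<^sup>2\<close> read off the sphere.\<close>

lemma inner_hopf: "hopf u \<bullet> hopf w = (norm u)\<^sup>2 * (norm w)\<^sup>2 - 2 * (cmod (wedge u w))\<^sup>2"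
  unfolding norm_C2 wedge_def hopf_def inner_vec_def sum_3 cmod_power2
  by (simp add: power2_eq_square algebra_simps)

lemma wedge_self [simp]: "wedge u u = 0"
  by (simp add: wedge_def)

lemma wedge_scale: "wedge (k *s u) w = k * wedge u w" "wedge u (k *s w) = k * wedge u w"
  by (simp_all add: wedge_def algebra_simps)

lemma wedge_matrix: "wedge (A *v u) (A *v w) = det A * wedge u w"
  by (simp add: wedge_def det_2 matrix_vector_mult_def sum_2 algebra_simps)

lemma wedge_eq_0_iff:
  assumes "u \<noteq> 0" "w \<noteq> 0"
  shows "wedge u w = 0 \<longleftrightarrow> (\<exists>k. k \<noteq> 0 \<and> w = k *s u)"
proof
  assume eq: "wedge u w = 0"
  show "\<exists>k. k \<noteq> 0 \<and> w = k *s u"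
  proof (cases "u $ 1 = 0")
    case True
    then have "u $ 2 \<noteq> 0" "w $ 1 = 0"
      using assms eq by (auto simp: vec_eq_iff forall_2 wedge_def)
    then show ?thesis
      using assms True by (intro exI[of _ "w $ 2 / u $ 2"]) (auto simp: vec_eq_iff forall_2)
  next
    case False
    then have "w $ 2 = u $ 2 * w $ 1 / u $ 1"
      using eq by (simp add: wedge_def field_simps)
    then show ?thesis
      using assms False by (intro exI[of _ "w $ 1 / u $ 1"]) (auto simp: vec_eq_iff forall_2)
  qed
next
  assume "\<exists>k. k \<noteq> 0 \<and> w = k *s u"
  then show "wedge u w = 0"
    by (auto simp: wedge_scale)
qed

lemma inner_sphere_point:
  assumes "u \<noteq> 0" "w \<noteq> 0"
  shows "sphere_point u \<bullet> sphere_point w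
           = 1 - 2 * (cmod (wedge u w))\<^sup>2 / ((norm u)\<^sup>2 * (norm w)\<^sup>2)"
  using assms by (simp add: sphere_point_def inner_hopf field_simps)

lemma norm_sphere_point [simp]: "u \<noteq> 0 \<Longrightarrow> norm (sphere_point u) = 1"
  by (simp add: inner_sphere_point norm_eq_1)

lemma dist_sphere:
  assumes "x \<in> riemann_sphere" "y \<in> riemann_sphere"
  shows "(dist x y)\<^sup>2 = 2 - 2 * (x \<bullet> y)"
  using assms
  by (simp add: dist_norm power2_norm_eq_inner inner_diff_left inner_diff_right inner_commute norm_eq_1)

lemma dist_sphere_point:
  assumes "u \<noteq> 0" "w \<noteq> 0"
  shows "(dist (sphere_point u) (sphere_point w))\<^sup>2
           = 4 * (cmod (wedge u w))\<^sup>2 / ((norm u)\<^sup>2 * (norm w)\<^sup>2)"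
  using assms by (subst dist_sphere) (simp_all add: inner_sphere_point)

lemma sphere_point_eq_iff:
  assumes "u \<noteq> 0" "w \<noteq> 0"
  shows "sphere_point u = sphere_point w \<longleftrightarrow> (\<exists>k. k \<noteq> 0 \<and> w = k *s u)"
proof -
  have "sphere_point u = sphere_point w \<longleftrightarrow> (dist (sphere_point u) (sphere_point w))\<^sup>2 = 0"
    by simp
  also have "\<dots> \<longleftrightarrow> wedge u w = 0"
    using assms by (subst dist_sphere_point) simp_all
  finally show ?thesis
    by (simp add: wedge_eq_0_iff[OF assms])
qed

lemma sphere_point_scale: "u \<noteq> 0 \<Longrightarrow> k \<noteq> 0 \<Longrightarrow> sphere_point (k *s u) = sphere_point u"
  using sphere_point_eq_iff[of u "k *s u"] by auto

lemma sphere_point_surj: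
  assumes "x \<in> riemann_sphere"
  obtains u where "u \<noteq> 0" "sphere_point u = x"
proof (cases "x $ 3 = 1")
  case True
  have "x \<bullet> x = 1"
    using assms by (simp add: norm_eq_1)
  then have "(x $ 1)\<^sup>2 + (x $ 2)\<^sup>2 = 0"
    using True by (simp add: inner_vec_def sum_3 power2_eq_square)
  then have x: "x $ 1 = 0" "x $ 2 = 0"
    by (auto simp: add_nonneg_eq_0_iff)
  have "sphere_point (vector [1, 0]) = x" "(vector [1, 0] :: complex ^ 2) \<noteq> 0"
    using x True by (auto simp: vec_eq_iff forall_3 forall_2 sphere_point_def hopf_def norm_C2)
  then show ?thesis
    using that by blast
next
  case False
  have "x \<bullet> x = 1"
    using assms by (simp add: norm_eq_1)
  then have x: "(x $ 1)\<^sup>2 + (x $ 2)\<^sup>2 = (1 - x $ 3) * (1 + x $ 3)"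
    by (simp add: inner_vec_def sum_3 power2_eq_square algebra_simps)
  define u :: "complex ^ 2" where "u = vector [Complex (x $ 1) (x $ 2), of_real (1 - x $ 3)]"
  have n: "(norm u)\<^sup>2 = 2 * (1 - x $ 3)"
    using x by (simp add: norm_C2 u_def cmod_power2 del: of_real_diff) (simp add: power2_eq_square algebra_simps)
  have h: "hopf u = (2 * (1 - x $ 3)) *\<^sub>R x"
    using x by (simp add: vec_eq_iff forall_3 hopf_def u_def cmod_power2 del: of_real_diff)
      (simp add: power2_eq_square algebra_simps)
  have "u \<noteq> 0"
    using False by (auto simp: u_def vec_eq_iff forall_2 simp del: of_real_diff)
  moreover have "sphere_point u = x"
    using False by (simp add: sphere_point_def h n)
  ultimately show ?thesis
    using that by blast
qed

lemma stereographic_sphere_point: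
  assumes "u \<noteq> 0"
  shows "stereographic (sphere_point u) = homogeneous u"
proof (cases "u $ 2 = 0")
  case True
  then have "u $ 1 \<noteq> 0"
    using assms by (auto simp: vec_eq_iff forall_2)
  with True show ?thesis
    by (simp add: stereographic_def homogeneous_def sphere_point_def hopf_def norm_C2)
next
  case False
  define N where "N = (norm u)\<^sup>2"
  have N: "N > 0" "N = (cmod (u $ 1))\<^sup>2 + (cmod (u $ 2))\<^sup>2"
    using assms by (simp_all add: N_def) (simp add: norm_C2)
  have third: "1 - sphere_point u $ 3 = 2 * (cmod (u $ 2))\<^sup>2 / N"
  proof -
    have "sphere_point u $ 3 = ((cmod (u $ 1))\<^sup>2 - (cmod (u $ 2))\<^sup>2) / N"
      by (simp add: sphere_point_def hopf_def field_simps flip: N_def)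
    moreover have "((cmod (u $ 1))\<^sup>2 + (cmod (u $ 2))\<^sup>2) / N = 1"
      using N(1) by (simp flip: N(2))
    ultimately show ?thesis
      by (simp add: diff_divide_distrib add_divide_distrib del: zero_less_divide_iff)
  qed
  have third_ne: "sphere_point u $ 3 \<noteq> 1"
    using third False N(1) by auto
  have "sphere_point u $ 1 = 2 * Re (u $ 1 * cnj (u $ 2)) / N"
       "sphere_point u $ 2 = 2 * Im (u $ 1 * cnj (u $ 2)) / N"
    by (simp_all add: sphere_point_def hopf_def field_simps flip: N_def)
  then have "sphere_point u $ 1 / (1 - sphere_point u $ 3) = Re (u $ 1 * cnj (u $ 2)) / (cmod (u $ 2))\<^sup>2"
            "sphere_point u $ 2 / (1 - sphere_point u $ 3) = Im (u $ 1 * cnj (u $ 2)) / (cmod (u $ 2))\<^sup>2"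
    unfolding third using N(1) by (simp_all del: times_complex.simps)
  moreover have "u $ 1 / u $ 2 = (u $ 1 * cnj (u $ 2)) / of_real ((cmod (u $ 2))\<^sup>2)"
    by (simp only: complex_div_cnj[of "u $ 1"] of_real_power)
  ultimately have "Complex (sphere_point u $ 1 / (1 - sphere_point u $ 3))
      (sphere_point u $ 2 / (1 - sphere_point u $ 3)) = u $ 1 / u $ 2"
    by (simp only: Re_divide_of_real Im_divide_of_real complex_eq_iff complex.sel)
  then show ?thesis
    using False third_ne by (simp add: stereographic_def homogeneous_def)
qed

lemma inj_on_stereographic: "inj_on stereographic riemann_sphere"
proof (rule inj_onI)
  fix x y assume "x \<in> riemann_sphere" "y \<in> riemann_sphere" and eq: "stereographic x = stereographic y"
  then obtain u w where u: "u \<noteq> 0" "x = sphere_point u" and w: "w \<noteq> 0" "y = sphere_point w"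
    by (metis sphere_point_surj)
  have "homogeneous u = homogeneous w"
    using eq u w by (simp add: stereographic_sphere_point)
  then have "wedge u w = 0"
    by (auto simp: homogeneous_def wedge_def field_simps split: if_splits)
  then show "x = y"
    using u w by (simp add: sphere_point_eq_iff wedge_eq_0_iff)
qed

lemma matrix_vector_eq_0_iff:
  fixes A :: "complex ^ 2 ^ 2"
  assumes "det A \<noteq> 0"
  shows "A *v u = 0 \<longleftrightarrow> u = 0"
proof -
  obtain B where "B ** A = mat 1"
    using assms invertible_det_nz[of A] by (auto simp: invertible_def)
  then have "B *v (A *v u) = u" for u
    by (simp add: matrix_vector_mul_assoc)
  then show ?thesis
    by (metis matrix_vector_mult_0_right)
qed

lemma mob_sphere_point:
  assumes "det A \<noteq> 0" "u \<noteq> 0"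
  shows "mob A (sphere_point u) = sphere_point (A *v u)"
proof -
  let ?w = "SOME w. w \<noteq> 0 \<and> sphere_point w = sphere_point u"
  have w: "?w \<noteq> 0 \<and> sphere_point ?w = sphere_point u"
    by (rule someI[of _ u]) (simp add: assms)
  then obtain k where k: "k \<noteq> 0" "u = k *s ?w"
    using assms by (auto simp: sphere_point_eq_iff)
  have "sphere_point (A *v u) = sphere_point (A *v ?w)"
    using w k(1) assms
    by (subst k(2)) (simp add: vector_scalar_commute sphere_point_scale matrix_vector_eq_0_iff)
  then show ?thesis
    using assms by (simp add: mob_def)
qed

lemma mob_extensional: "mob A \<in> extensional riemann_sphere"
  by (simp add: mob_def)

lemma mob_eqI:
  assumes "f \<in> extensional riemann_sphere" "det A \<noteq> 0"
    and "\<And>u. u \<noteq> 0 \<Longrightarrow> f (sphere_point u) = sphere_point (A *v u)"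
  shows "f = mob A"
proof (rule extensionalityI[OF assms(1) mob_extensional])
  fix x assume "x \<in> riemann_sphere"
  then obtain u where "u \<noteq> 0" "sphere_point u = x"
    by (rule sphere_point_surj)
  then show "f x = mob A x"
    using assms mob_sphere_point by metis
qed

lemma mob_in_sphere: "det A \<noteq> 0 \<Longrightarrow> x \<in> riemann_sphere \<Longrightarrow> mob A x \<in> riemann_sphere"
  by (metis sphere_point_surj mob_sphere_point norm_sphere_point matrix_vector_eq_0_iff mem_sphere_0)

lemma compose_mob:
  assumes "det A \<noteq> 0" "det B \<noteq> 0"
  shows "compose riemann_sphere (mob A) (mob B) = mob (A ** B)"
proof (rule mob_eqI)
  show "det (A ** B) \<noteq> 0"
    using assms by (simp add: det_mul)
  show "compose riemann_sphere (mob A) (mob B) (sphere_point u) = sphere_point ((A ** B) *v u)"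
    if "u \<noteq> 0" for u
    using assms that
    by (simp add: compose_def mob_sphere_point matrix_vector_eq_0_iff matrix_vector_mul_assoc)
qed simp

lemma mob_mob:
  assumes "det A \<noteq> 0" "det B \<noteq> 0" "x \<in> riemann_sphere"
  shows "mob A (mob B x) = mob (A ** B) x"
  unfolding compose_mob[OF assms(1,2), symmetric] compose_eq[OF assms(3)] ..

lemma mob_id: "mob (mat 1) = (\<lambda>x\<in>riemann_sphere. x)"
  by (rule mob_eqI[symmetric]) simp_all

lemma matrix_inverse:
  assumes "det (A :: complex ^ 2 ^ 2) \<noteq> 0"
  shows "\<exists>B. det B \<noteq> 0 \<and> A ** B = mat 1 \<and> B ** A = mat 1"
proof -
  obtain B where B: "A ** B = mat 1" "B ** A = mat 1"
    using assms invertible_det_nz[of A] by (auto simp: invertible_def)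
  then have "det A * det B = 1"
    by (metis det_I det_mul)
  then show ?thesis
    using B by (intro exI[of _ B]) auto
qed

lemma mob_Bij:
  assumes "det A \<noteq> 0"
  shows "mob A \<in> Bij riemann_sphere"
proof -
  obtain B where B: "det B \<noteq> 0" "A ** B = mat 1" "B ** A = mat 1"
    using matrix_inverse[OF assms] by blast
  have "bij_betw (mob A) riemann_sphere riemann_sphere"
  proof (rule bij_betw_byWitness[where f' = "mob B"])
    show "\<forall>x\<in>riemann_sphere. mob B (mob A x) = x" "\<forall>x\<in>riemann_sphere. mob A (mob B x) = x"
      using assms B by (simp_all add: mob_mob mob_id)
  qed (use mob_in_sphere[OF assms] mob_in_sphere[OF B(1)] in blast)+
  then show ?thesis
    by (simp add: Bij_def mob_extensional)
qed

lemma moebius_ext_homogeneous: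
  assumes "a * d - b * c \<noteq> 0" "u \<noteq> 0"
  shows "moebius_ext a b c d (homogeneous u) = homogeneous (vector [vector [a, b], vector [c, d]] *v u)"
proof -
  have *: "(vector [vector [a, b], vector [c, d]] *v u :: complex ^ 2) $ 1 = a * u $ 1 + b * u $ 2"
    "(vector [vector [a, b], vector [c, d]] *v u :: complex ^ 2) $ 2 = c * u $ 1 + d * u $ 2"
    by (simp_all add: matrix_vector_mult_def sum_2)
  show ?thesis
  proof (cases "u $ 2 = 0")
    case True
    then have "u $ 1 \<noteq> 0"
      using assms by (auto simp: vec_eq_iff forall_2)
    then show ?thesis
      using True unfolding homogeneous_def * by (simp add: moebius_ext_def)
  next
    case False
    then have "c * (u $ 1 / u $ 2) + d = (c * u $ 1 + d * u $ 2) / u $ 2"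
              "a * (u $ 1 / u $ 2) + b = (a * u $ 1 + b * u $ 2) / u $ 2"
      by (simp_all add: field_simps)
    then show ?thesis
      using False unfolding homogeneous_def * by (simp add: moebius_ext_def moebius_def)
  qed
qed

text \<open>In homogeneous coordinates the point at infinity needs no special treatment; from here on Moebius
  transformations are handled as invertible matrices acting on \<open>\<complex>\<^sup>2\<close>.\<close>

lemma moebius_transformations_eq: "moebius_transformations = mob ` {A. det A \<noteq> 0}"
proof (intro Set.set_eqI iffI)
  fix f assume "f \<in> moebius_transformations"
  then obtain a b c d where f: "f \<in> Bij riemann_sphere" and d: "a * d - b * c \<noteq> 0"
    and eq: "\<And>x. x \<in> riemann_sphere \<Longrightarrow> stereographic (f x) = moebius_ext a b c d (stereographic x)"
    by (auto simp: moebius_transformations_def simp del: mem_sphere_0)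
  define A :: "complex ^ 2 ^ 2" where "A = vector [vector [a, b], vector [c, d]]"
  have dA: "det A \<noteq> 0"
    using d by (simp add: A_def det_2)
  have "f = mob A"
  proof (rule mob_eqI)
    fix u :: "complex ^ 2" assume u: "u \<noteq> 0"
    then have "stereographic (f (sphere_point u)) = stereographic (sphere_point (A *v u))"
      using eq d dA by (simp add: stereographic_sphere_point moebius_ext_homogeneous
          matrix_vector_eq_0_iff A_def del: mem_sphere_0)
    moreover have "f (sphere_point u) \<in> riemann_sphere"
      using Bij_imp_funcset[OF f] u by (auto simp: Pi_def simp del: mem_sphere_0)
    ultimately show "f (sphere_point u) = sphere_point (A *v u)"
      using u dA by (auto dest: inj_onD[OF inj_on_stereographic] simp: matrix_vector_eq_0_iff simp del: mem_sphere_0)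
  qed (use f dA in \<open>auto simp: Bij_def\<close>)
  then show "f \<in> mob ` {A. det A \<noteq> 0}"
    using dA by blast
next
  fix f assume "f \<in> mob ` {A. det A \<noteq> 0}"
  then obtain A where A: "det A \<noteq> 0" "f = mob A"
    by blast
  have A_eq: "vector [vector [A $ 1 $ 1, A $ 1 $ 2], vector [A $ 2 $ 1, A $ 2 $ 2]] = A"
    by (simp add: vec_eq_iff forall_2)
  have dA: "A $ 1 $ 1 * A $ 2 $ 2 - A $ 1 $ 2 * A $ 2 $ 1 \<noteq> 0"
    using A by (simp add: det_2)
  have "stereographic (mob A x) = moebius_ext (A $ 1 $ 1) (A $ 1 $ 2) (A $ 2 $ 1) (A $ 2 $ 2) (stereographic x)"
    if x: "x \<in> riemann_sphere" for x
  proof -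
    obtain u where u: "u \<noteq> 0" "sphere_point u = x"
      using x by (rule sphere_point_surj)
    have "stereographic (mob A x) = homogeneous (A *v u)"
      using u(1) A by (simp add: mob_sphere_point stereographic_sphere_point matrix_vector_eq_0_iff flip: u(2))
    also have "\<dots> = moebius_ext (A $ 1 $ 1) (A $ 1 $ 2) (A $ 2 $ 1) (A $ 2 $ 2) (homogeneous u)"
      using u dA by (simp add: moebius_ext_homogeneous A_eq)
    finally show ?thesis
      using u(1) by (simp add: stereographic_sphere_point flip: u(2))
  qed
  then have "\<exists>a b c d. a * d - b * c \<noteq> 0 \<and>
      (\<forall>x\<in>riemann_sphere. stereographic (f x) = moebius_ext a b c d (stereographic x))"
    using dA A(2) by (intro exI[of _ "A $ 1 $ 1"] exI[of _ "A $ 1 $ 2"] exI[of _ "A $ 2 $ 1"] exI[of _ "A $ 2 $ 2"]) simp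
  then show "f \<in> moebius_transformations"
    unfolding moebius_transformations_def A(2) by (intro CollectI conjI mob_Bij A(1))
qed

lemma moebius_compose:
  assumes "f \<in> moebius_transformations" "g \<in> moebius_transformations"
  shows "compose riemann_sphere f g \<in> moebius_transformations"
proof -
  obtain A B where "det A \<noteq> 0" "f = mob A" "det B \<noteq> 0" "g = mob B"
    using assms unfolding moebius_transformations_eq by blast
  then show ?thesis
    unfolding moebius_transformations_eq by (simp add: compose_mob det_mul)
qed

lemma moebius_inverse:
  assumes "f \<in> moebius_transformations"
  obtains g where "g \<in> moebius_transformations"
    "\<forall>x\<in>riemann_sphere. g (f x) = x" "\<forall>x\<in>riemann_sphere. f (g x) = x"
proof -
  obtain A where A: "det A \<noteq> 0" "f = mob A"
    using assms by (auto simp: moebius_transformations_eq)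
  obtain B where B: "det B \<noteq> 0" "A ** B = mat 1" "B ** A = mat 1"
    using matrix_inverse[OF A(1)] by blast
  show ?thesis
  proof (rule that[of "mob B"])
    show "mob B \<in> moebius_transformations"
      using B(1) by (simp add: moebius_transformations_eq)
    show "\<forall>x\<in>riemann_sphere. mob B (f x) = x" "\<forall>x\<in>riemann_sphere. f (mob B x) = x"
      using A B by (simp_all add: mob_mob mob_id)
  qed
qed

lemma moebius_in_sphere:
  "f \<in> moebius_transformations \<Longrightarrow> x \<in> riemann_sphere \<Longrightarrow> f x \<in> riemann_sphere"
  using mob_in_sphere by (auto simp: moebius_transformations_eq simp del: mem_sphere_0)

lemma moebius_bij_betw: "f \<in> moebius_transformations \<Longrightarrow> bij_betw f riemann_sphere riemann_sphere"
  by (simp add: moebius_transformations_def Bij_def)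

lemma moebius_extensional: "f \<in> moebius_transformations \<Longrightarrow> f \<in> extensional riemann_sphere"
  by (simp add: moebius_transformations_def Bij_def)

lemma moebius_mult:
  assumes "f \<in> moebius_transformations" "g \<in> moebius_transformations"
  shows "f \<otimes>\<^bsub>BijGroup riemann_sphere\<^esub> g = compose riemann_sphere f g"
  using assms by (simp add: BijGroup_def moebius_transformations_def)

lemma moebius_stabilizer_subgroup:
  assumes "\<alpha> \<subseteq> riemann_sphere"
  shows "subgroup {f \<in> moebius_transformations. f ` \<alpha> = \<alpha>} (BijGroup riemann_sphere)"
proof -
  interpret group "BijGroup riemann_sphere"
    by (rule group_BijGroup)
  have id: "(\<lambda>x\<in>riemann_sphere. x) \<in> moebius_transformations"
    unfolding moebius_transformations_eq mob_id[symmetric] by (rule imageI) simp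
  have id_image: "(\<lambda>x\<in>riemann_sphere. x) ` \<alpha> = \<alpha>"
    using assms by (auto simp: image_iff)
  show ?thesis
  proof (rule subgroupI)
    show "{f \<in> moebius_transformations. f ` \<alpha> = \<alpha>} \<noteq> {}"
      using id id_image by blast
  next
    fix f assume "f \<in> {f \<in> moebius_transformations. f ` \<alpha> = \<alpha>}"
    then have f: "f \<in> moebius_transformations" "f ` \<alpha> = \<alpha>"
      by auto
    obtain g where g: "g \<in> moebius_transformations"
      "\<forall>x\<in>riemann_sphere. g (f x) = x" "\<forall>x\<in>riemann_sphere. f (g x) = x"
      by (rule moebius_inverse[OF f(1)])
    have "compose riemann_sphere g f = (\<lambda>x\<in>riemann_sphere. x)"
      using g by (auto simp: compose_def fun_eq_iff)
    then have "inv\<^bsub>BijGroup riemann_sphere\<^esub> f = g"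
      using f g by (intro inv_equality)
        (auto simp: moebius_mult, auto simp: BijGroup_def moebius_transformations_def)
    moreover have "g ` \<alpha> = \<alpha>"
    proof -
      have "g ` \<alpha> = g ` f ` \<alpha>"
        by (simp add: f)
      also have "\<dots> = (\<lambda>x. x) ` \<alpha>"
        unfolding image_image using g assms by (intro image_cong) auto
      finally show ?thesis
        by simp
    qed
    ultimately show "inv\<^bsub>BijGroup riemann_sphere\<^esub> f \<in> {f \<in> moebius_transformations. f ` \<alpha> = \<alpha>}"
      using g by simp
  next
    fix f g assume "f \<in> {f \<in> moebius_transformations. f ` \<alpha> = \<alpha>}" "g \<in> {f \<in> moebius_transformations. f ` \<alpha> = \<alpha>}"
    moreover have "compose riemann_sphere f g ` \<alpha> = f ` g ` \<alpha>"
      unfolding image_image using assms by (intro image_cong) (auto simp: compose_def)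
    ultimately show "f \<otimes>\<^bsub>BijGroup riemann_sphere\<^esub> g \<in> {f \<in> moebius_transformations. f ` \<alpha> = \<alpha>}"
      by (simp add: moebius_mult moebius_compose)
  qed (auto simp: BijGroup_def moebius_transformations_def)
qed

text \<open>Both matrices have the same projective action, so \<open>A\<close> maps \<open>e\<^sub>1\<close>, \<open>e\<^sub>2\<close> and \<open>e\<^sub>1 + e\<^sub>2\<close> to multiples of
  their images under \<open>B\<close>; the third vector forces the factors of the first two to agree.\<close>

lemma mob_eq_imp_proportional:
  assumes "det A \<noteq> 0" "det B \<noteq> 0" "mob A = mob B"
  obtains k where "k \<noteq> 0" "\<And>u. A *v u = k *s (B *v u)"
proof -
  have ex: "\<exists>k. k \<noteq> 0 \<and> A *v u = k *s (B *v u)" if "u \<noteq> 0" for u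
  proof -
    have "sphere_point (B *v u) = sphere_point (A *v u)"
      using assms that by (metis mob_sphere_point)
    then show ?thesis
      using assms that sphere_point_eq_iff[of "B *v u" "A *v u"] by (simp add: matrix_vector_eq_0_iff)
  qed
  let ?e = "axis 1 1 :: complex ^ 2" and ?f = "axis 2 1 :: complex ^ 2"
  obtain k l m where k: "k \<noteq> 0" "A *v ?e = k *s (B *v ?e)" and l: "A *v ?f = l *s (B *v ?f)"
    and m: "A *v (?e + ?f) = m *s (B *v (?e + ?f))"
    using ex[of ?e] ex[of ?f] ex[of "?e + ?f"]
    by (auto simp: vec_eq_iff forall_2 axis_def)
  have "(k - m) *s (B *v ?e) + (l - m) *s (B *v ?f) = 0"
    using k(2) l m by (simp add: matrix_vector_right_distrib vec_eq_iff algebra_simps)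
  then have "B *v ((k - m) *s ?e + (l - m) *s ?f) = 0"
    by (simp add: matrix_vector_right_distrib matrix_vector_mult_diff_distrib vector_scalar_commute)
  then have "(k - m) *s ?e + (l - m) *s ?f = 0"
    by (simp only: matrix_vector_eq_0_iff[OF assms(2)])
  then have "k = m" "l = m"
    by (auto simp: vec_eq_iff forall_2 axis_def)
  have "A *v u = k *s (B *v u)" for u
  proof -
    have u: "u = u $ 1 *s ?e + u $ 2 *s ?f"
      by (simp add: vec_eq_iff forall_2 axis_def)
    show ?thesis
      using k l \<open>k = m\<close> \<open>l = m\<close>
      by (subst (1 2) u) (simp add: matrix_vector_right_distrib vector_scalar_commute vec_eq_iff algebra_simps)
  qed
  with k(1) show ?thesis
    using that by blast
qed

section \<open>Half-turns and the antipodal map\<close>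

definition halfturn :: "real ^ 3 \<Rightarrow> real ^ 3 \<Rightarrow> real ^ 3" where
  "halfturn n x = (2 * (x \<bullet> n) / (n \<bullet> n)) *\<^sub>R n - x"

text \<open>The combination \<open>n\<^sub>1 \<sigma>\<^sub>1 - n\<^sub>2 \<sigma>\<^sub>2 + n\<^sub>3 \<sigma>\<^sub>3\<close> of the Pauli matrices.  The sign of \<open>n\<^sub>2\<close> comes from the second
  coordinate of \<open>hopf\<close>, which is \<open>2 Im (u\<^sub>1 cnj u\<^sub>2)\<close>.\<close>

definition pauli :: "real ^ 3 \<Rightarrow> complex ^ 2 ^ 2" where
  "pauli n = vector [vector [of_real (n $ 3), Complex (n $ 1) (n $ 2)],
                     vector [Complex (n $ 1) (- n $ 2), of_real (- n $ 3)]]"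

lemma pauli_mult:
  "(pauli n *v u) $ 1 = of_real (n $ 3) * u $ 1 + Complex (n $ 1) (n $ 2) * u $ 2"
  "(pauli n *v u) $ 2 = Complex (n $ 1) (- n $ 2) * u $ 1 - of_real (n $ 3) * u $ 2"
  by (simp_all add: pauli_def matrix_vector_mult_def sum_2)

lemma det_pauli: "det (pauli n) = - of_real (n \<bullet> n)"
  by (simp add: pauli_def det_2 inner_vec_def sum_3 complex_eq_iff algebra_simps)

lemma norm_pauli: "(norm (pauli n *v u))\<^sup>2 = (n \<bullet> n) * (norm u)\<^sup>2"
  unfolding norm_C2 pauli_mult cmod_power2 inner_vec_def sum_3
  by (simp add: power2_eq_square algebra_simps)

lemma hopf_pauli: "hopf (pauli n *v u) = (2 * (hopf u \<bullet> n)) *\<^sub>R n - (n \<bullet> n) *\<^sub>R hopf u"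
  unfolding vec_eq_iff forall_3 hopf_def pauli_mult cmod_power2 inner_vec_def sum_3
  by (intro conjI) (simp_all add: power2_eq_square algebra_simps)

text \<open>Half-turns are the rotations whose matrices can be written down from the axis without square roots.
  Every rotation is a product of half-turns, so their matrices give Moebius transformations for all of them.\<close>

lemma mob_pauli:
  assumes "n \<noteq> 0"
  shows "mob (pauli n) = restrict (halfturn n) riemann_sphere"
proof (rule mob_eqI[symmetric])
  show "det (pauli n) \<noteq> 0"
    using assms by (simp add: det_pauli)
  fix u :: "complex ^ 2" assume u: "u \<noteq> 0"
  have "sphere_point (pauli n *v u) = halfturn n (sphere_point u)"
    using u assms unfolding sphere_point_def hopf_pauli norm_pauli halfturn_def
    by (simp add: scaleR_diff_right field_simps)
  then show "restrict (halfturn n) riemann_sphere (sphere_point u) = sphere_point (pauli n *v u)"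
    using u by simp
qed simp

lemma halfturn_moebius:
  assumes "n \<noteq> 0"
  shows "restrict (halfturn n) riemann_sphere \<in> moebius_transformations"
  using assms unfolding moebius_transformations_eq mob_pauli[OF assms, symmetric] by (simp add: det_pauli)

lemma linear_halfturn: "linear (halfturn n)"
  unfolding halfturn_def
  by (rule linearI) (simp_all add: inner_add_left algebra_simps add_divide_distrib scaleR_left_distrib)

lemma det_halfturn:
  assumes "n \<noteq> 0"
  shows "det (matrix (halfturn n)) = 1"
proof -
  define m where "m = n /\<^sub>R norm n"
  have m: "m \<bullet> m = 1"
    using assms by (simp add: m_def flip: power2_norm_eq_inner)
  have "halfturn n x = (2 * (x \<bullet> m)) *\<^sub>R m - x" for x
    by (simp add: halfturn_def m_def power2_norm_eq_inner[symmetric] power2_eq_square divide_inverse ac_simps)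
  then have "halfturn n = (\<lambda>x. (2 * (x \<bullet> m)) *\<^sub>R m - x)"
    by blast
  then have entry: "matrix (halfturn n) $ i $ j = 2 * m $ j * m $ i - (if i = j then 1 else 0)" for i j
    by (simp add: matrix_def inner_axis inner_commute) (simp add: axis_def)
  \<comment> \<open>the eigenvalues of \<open>2 m m\<^sup>T - 1\<close> are \<open>2 |m|\<^sup>2 - 1, -1, -1\<close>\<close>
  have "det (matrix (halfturn n)) = 2 * (m \<bullet> m) - 1"
    unfolding det_3 entry by (simp add: inner_vec_def sum_3 algebra_simps)
  then show ?thesis
    by (simp add: m)
qed

text \<open>The antipode of the point with coordinates \<open>u\<close> is the line orthogonal to \<open>u\<close>.  A matrix \<open>A\<close> that induces
  the antipodal map would satisfy \<open>\<langle>A u, u\<rangle> = 0\<close> for all \<open>u\<close>, and then \<open>A = 0\<close>.\<close>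

lemma antipodal_not_moebius:
  "(\<lambda>x\<in>riemann_sphere. - x) \<notin> moebius_transformations"
proof
  assume "(\<lambda>x\<in>riemann_sphere. - x) \<in> moebius_transformations"
  then obtain A where A: "det A \<noteq> 0" "(\<lambda>x\<in>riemann_sphere. - x) = mob A"
    by (auto simp: moebius_transformations_eq)
  have form: "(A *v u) $ 1 * cnj (u $ 1) + (A *v u) $ 2 * cnj (u $ 2) = 0" if u: "u \<noteq> 0" for u
  proof -
    define w :: "complex ^ 2" where "w = vector [- cnj (u $ 2), cnj (u $ 1)]"
    have w: "w \<noteq> 0"
      using u by (auto simp: w_def vec_eq_iff forall_2)
    have "hopf w = - hopf u" "norm w = norm u"
      by (simp_all add: w_def hopf_def vec_eq_iff forall_3 norm_vec_def L2_set_def sum_2 add.commute)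
    then have "sphere_point w = - sphere_point u"
      by (simp add: sphere_point_def)
    also have "\<dots> = mob A (sphere_point u)"
      using u by (simp flip: A(2))
    also have "\<dots> = sphere_point (A *v u)"
      using A u by (simp add: mob_sphere_point)
    finally have "sphere_point (A *v u) = sphere_point w" ..
    moreover have "A *v u \<noteq> 0"
      using u A(1) by (simp add: matrix_vector_eq_0_iff)
    ultimately have "wedge (A *v u) w = 0"
      using w sphere_point_eq_iff wedge_eq_0_iff by blast
    then show ?thesis
      by (simp add: wedge_def w_def)
  qed
  have mult: "(A *v u) $ i = A $ i $ 1 * u $ 1 + A $ i $ 2 * u $ 2" for u i
    by (simp add: matrix_vector_mult_def sum_2)
  have "A $ 1 $ 1 = 0"
    using form[of "vector [1, 0]"] by (simp add: mult vec_eq_iff forall_2)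
  moreover have "A $ 2 $ 2 = 0"
    using form[of "vector [0, 1]"] by (simp add: mult vec_eq_iff forall_2)
  moreover have "A $ 1 $ 2 + A $ 2 $ 1 = 0"
    using form[of "vector [1, 1]"] calculation by (simp add: mult vec_eq_iff forall_2)
  moreover have "\<i> * (A $ 1 $ 2 - A $ 2 $ 1) = 0"
    using form[of "vector [1, \<i>]"] calculation by (simp add: mult vec_eq_iff forall_2 algebra_simps)
  ultimately show False
    using A(1) by (simp add: det_2)
qed


section \<open>Moebius transformations that preserve a balanced finite set\<close>

text \<open>The function \<open>\<rho> x = p0 + p \<bullet> x\<close> is \<open>|A u|\<^sup>2 / |u|\<^sup>2\<close> for a matrix with \<open>|det A| = 1\<close>, which is affine in
  \<open>x\<close> because \<open>|A u|\<^sup>2\<close> is a Hermitian form.  The relation between \<open>p0\<close> and \<open>p\<close> says that the form has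
  determinant \<open>1\<close>; \<open>p = 0\<close> holds exactly for rotations.\<close>

lemma moebius_conformal_factor:
  assumes "f \<in> moebius_transformations"
  obtains p0 :: real and p :: "real ^ 3" where "p0 > 0" "p0\<^sup>2 = 1 + p \<bullet> p"
    "\<forall>x\<in>riemann_sphere. \<forall>y\<in>riemann_sphere.
       (dist (f x) (f y))\<^sup>2 * ((p0 + p \<bullet> x) * (p0 + p \<bullet> y)) = (dist x y)\<^sup>2"
proof -
  obtain A where A: "det A \<noteq> 0" "f = mob A"
    using assms by (auto simp: moebius_transformations_eq)
  define D where "D = cmod (det A)"
  define q where "q = A $ 1 $ 1 * cnj (A $ 1 $ 2) + A $ 2 $ 1 * cnj (A $ 2 $ 2)"
  define r where "r = (cmod (A $ 1 $ 1))\<^sup>2 + (cmod (A $ 2 $ 1))\<^sup>2"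
  define s where "s = (cmod (A $ 1 $ 2))\<^sup>2 + (cmod (A $ 2 $ 2))\<^sup>2"
  define p0 where "p0 = (r + s) / (2 * D)"
  define v :: "real ^ 3" where "v = vector [Re q, - Im q, (r - s) / 2]"
  define p where "p = v /\<^sub>R D"
  have D: "D > 0"
    using A by (simp add: D_def)
  \<comment> \<open>determinant of the Hermitian matrix \<open>A\<^sup>* A\<close>, whose entries are \<open>r\<close>, \<open>s\<close> and \<open>q\<close>\<close>
  have lagrange: "r * s = D\<^sup>2 + (Re q)\<^sup>2 + (Im q)\<^sup>2"
    unfolding D_def r_def s_def q_def det_2 cmod_power2 by (simp add: power2_eq_square) algebra
  have "r \<ge> 0" "s \<ge> 0" "r * s > 0"
    unfolding lagrange using D by (auto simp: r_def s_def intro!: add_pos_nonneg)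
  then have "r + s > 0"
    by (cases "r = 0") auto
  then have "p0 > 0"
    using D by (simp add: p0_def)
  have pp: "p \<bullet> p = ((Re q)\<^sup>2 + (Im q)\<^sup>2 + ((r - s) / 2)\<^sup>2) / D\<^sup>2"
  proof -
    have "v \<bullet> v = (Re q)\<^sup>2 + (Im q)\<^sup>2 + ((r - s) / 2)\<^sup>2"
      by (simp add: v_def inner_vec_def sum_3 power2_eq_square)
    moreover have "p \<bullet> p = (v \<bullet> v) / D\<^sup>2"
      using D by (simp add: p_def power2_eq_square field_simps)
    ultimately show ?thesis
      by simp
  qed
  have "((r + s) / 2)\<^sup>2 = D\<^sup>2 + (Re q)\<^sup>2 + (Im q)\<^sup>2 + ((r - s) / 2)\<^sup>2"
    using lagrange by (simp add: power2_eq_square field_simps)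
  then have p0: "p0\<^sup>2 = 1 + p \<bullet> p"
    using D unfolding pp p0_def by (simp add: power_divide power_mult_distrib field_simps)
  have norm_A: "(norm (A *v u))\<^sup>2 = D * ((p0 + p \<bullet> sphere_point u) * (norm u)\<^sup>2)" if u: "u \<noteq> 0" for u
  proof -
    have "(norm (A *v u))\<^sup>2 = (r + s) / 2 * (norm u)\<^sup>2 + (Re q * hopf u $ 1 - Im q * hopf u $ 2 + (r - s) / 2 * hopf u $ 3)"
      unfolding r_def s_def q_def norm_C2 hopf_def cmod_power2 matrix_vector_mult_def sum_2
      by (simp add: power2_eq_square field_simps)
    also have "\<dots> = D * (p0 * (norm u)\<^sup>2 + p \<bullet> hopf u)"
      using D by (simp add: p0_def p_def v_def inner_vec_def sum_3 field_simps)
    also have "p \<bullet> hopf u = (p \<bullet> sphere_point u) * (norm u)\<^sup>2"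
      using u by (simp add: sphere_point_def)
    finally show ?thesis
      by (simp add: algebra_simps)
  qed
  have "(dist (f x) (f y))\<^sup>2 * ((p0 + p \<bullet> x) * (p0 + p \<bullet> y)) = (dist x y)\<^sup>2"
    if xy: "x \<in> riemann_sphere" "y \<in> riemann_sphere" for x y
  proof -
    obtain u w where u: "u \<noteq> 0" "sphere_point u = x" and w: "w \<noteq> 0" "sphere_point w = y"
      by (meson xy sphere_point_surj)
    define a b where "a = p0 + p \<bullet> x" and "b = p0 + p \<bullet> y"
    have "a \<noteq> 0" "b \<noteq> 0"
      using norm_A[OF u(1)] norm_A[OF w(1)] u w A(1) by (auto simp: matrix_vector_eq_0_iff a_def b_def)
    moreover have "(dist (f x) (f y))\<^sup>2 =
        4 * (D * cmod (wedge u w))\<^sup>2 / ((D * (a * (norm u)\<^sup>2)) * (D * (b * (norm w)\<^sup>2)))"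
      using A u(1) w(1) norm_A[OF u(1)] norm_A[OF w(1)] unfolding a_def b_def u(2)[symmetric] w(2)[symmetric]
      by (simp add: mob_sphere_point dist_sphere_point matrix_vector_eq_0_iff wedge_matrix norm_mult D_def)
    moreover have "(dist x y)\<^sup>2 = 4 * (cmod (wedge u w))\<^sup>2 / ((norm u)\<^sup>2 * (norm w)\<^sup>2)"
      using dist_sphere_point[OF u(1) w(1)] u w by simp
    ultimately show ?thesis
      using D u(1) w(1) unfolding a_def[symmetric] b_def[symmetric]
      by (simp add: power_mult_distrib) (simp add: field_simps power2_eq_square)
  qed
  then show ?thesis
    using that \<open>p0 > 0\<close> p0 by blast
qed

text \<open>The number \<open>cosh t + c sinh t\<close> is the mean of \<open>exp t\<close> and \<open>exp (- t)\<close> with weights \<open>(1 + c) / 2\<close> and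
  \<open>(1 - c) / 2\<close>, and \<open>t c\<close> is the same mean of \<open>t\<close> and \<open>- t\<close>; so this is convexity of \<open>exp\<close>.\<close>

lemma log_convexity:
  fixes t c :: real
  assumes "\<bar>c\<bar> \<le> 1"
  shows "t * c \<le> ln (cosh t + c * sinh t)"
    and "t \<noteq> 0 \<Longrightarrow> \<bar>c\<bar> < 1 \<Longrightarrow> t * c < ln (cosh t + c * sinh t)"
proof -
  let ?a = "(1 + c) / 2" and ?b = "(1 - c) / 2"
  have eq: "cosh t + c * sinh t = exp (t * c) * (?a * exp (t * (1 - c)) + ?b * exp (- (t * (1 + c))))"
    by (simp add: cosh_def sinh_def field_simps exp_diff exp_add exp_minus)
  have ab: "?a \<ge> 0" "?b \<ge> 0"
    using assms by auto
  have one: "?a * (1 + t * (1 - c)) + ?b * (1 - t * (1 + c)) = 1"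
    by (simp add: field_simps)
  have ge: "?a * (1 + t * (1 - c)) \<le> ?a * exp (t * (1 - c))"
           "?b * (1 - t * (1 + c)) \<le> ?b * exp (- (t * (1 + c)))"
    using ab exp_ge_add_one_self[of "t * (1 - c)"] exp_ge_add_one_self[of "- (t * (1 + c))"]
    by (intro mult_left_mono; simp)+
  have "exp (t * c) * 1 \<le> cosh t + c * sinh t"
    unfolding eq using ge one by (intro mult_left_mono) auto
  then show "t * c \<le> ln (cosh t + c * sinh t)"
    by (simp add: ln_ge_iff less_le_trans[OF exp_gt_zero])
  assume "t \<noteq> 0" "\<bar>c\<bar> < 1"
  then have "?b * (1 - t * (1 + c)) < ?b * exp (- (t * (1 + c)))"
    using exp_minus_greater[of "t * (1 + c)"] by (intro mult_strict_left_mono) auto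
  then have "exp (t * c) * 1 < cosh t + c * sinh t"
    unfolding eq using ge one by (intro mult_strict_left_mono) auto
  then show "t * c < ln (cosh t + c * sinh t)"
    by (metis exp_gt_zero less_trans ln_exp ln_less_cancel_iff mult.right_neutral)
qed

text \<open>Taking the product of the chord relation over all pairs of distinct points of \<open>\<alpha>\<close> cancels the chords,
  as \<open>f\<close> permutes them, and leaves \<open>\<Prod>\<rho> = 1\<close>.  On the other hand \<open>ln \<rho>\<close> dominates a linear function whose
  sum over the balanced set is \<open>0\<close>, strictly at points other than the two poles \<open>\<plusminus>n\<close>.\<close>

theorem balanced_moebius_isometry:
  assumes f: "f \<in> moebius_transformations" "f ` \<alpha> = \<alpha>"
    and \<alpha>: "finite \<alpha>" "\<alpha> \<subseteq> riemann_sphere" "(\<Sum>x\<in>\<alpha>. x) = 0" "card \<alpha> \<ge> 3"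
    and xy: "x \<in> riemann_sphere" "y \<in> riemann_sphere"
  shows "dist (f x) (f y) = dist x y"
proof -
  obtain p0 :: real and p :: "real ^ 3" where p0: "p0 > 0" "p0\<^sup>2 = 1 + p \<bullet> p"
    and conf: "\<forall>x\<in>riemann_sphere. \<forall>y\<in>riemann_sphere.
       (dist (f x) (f y))\<^sup>2 * ((p0 + p \<bullet> x) * (p0 + p \<bullet> y)) = (dist x y)\<^sup>2"
    by (rule moebius_conformal_factor[OF f(1)])
  define \<rho> where "\<rho> x = p0 + p \<bullet> x" for x
  define P where "P = (\<Prod>x\<in>\<alpha>. \<rho> x)"
  have "(norm p)\<^sup>2 < p0\<^sup>2"
    unfolding p0(2) power2_norm_eq_inner by simp
  then have "norm p < p0"
    using p0(1) by (auto dest: power2_less_imp_less)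
  then have pos: "\<rho> x > 0" if "x \<in> riemann_sphere" for x
    using Cauchy_Schwarz_ineq2[of p x] that by (auto simp: \<rho>_def)
  have inj: "inj_on f \<alpha>"
    using moebius_bij_betw[OF f(1)] \<alpha>(2) by (auto simp: bij_betw_def intro: inj_on_subset)
  have "P = 1"
  proof -
    \<comment> \<open>comparing \<open>d (f x)\<close> with \<open>d x\<close> for each \<open>x\<close> avoids products over pairs; the exponent is \<open>card \<alpha> - 2\<close> because one factor \<open>\<rho> x\<close> is absorbed in \<open>P\<close>\<close>
    define d where "d x = (\<Prod>y\<in>\<alpha> - {x}. (dist x y)\<^sup>2)" for x
    define N where "N = card \<alpha> - 2"
    have d_pos: "d x > 0" for x
      unfolding d_def by (rule prod_pos) auto
    have d_f: "d (f x) * (\<rho> x ^ N * P) = d x" if x: "x \<in> \<alpha>" for x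
    proof -
      have "f ` (\<alpha> - {x}) = \<alpha> - {f x}"
        using inj f(2) x by (simp add: inj_on_image_set_diff[where C = \<alpha>])
      then have "d (f x) = (\<Prod>y\<in>\<alpha> - {x}. (dist (f x) (f y))\<^sup>2)"
        unfolding d_def using inj by (subst prod.reindex[symmetric, unfolded o_def]) (auto intro: inj_on_subset)
      moreover have "\<rho> x ^ N * P = (\<Prod>y\<in>\<alpha> - {x}. \<rho> x * \<rho> y)"
      proof -
        have "P = \<rho> x * (\<Prod>y\<in>\<alpha> - {x}. \<rho> y)"
          unfolding P_def using x \<alpha>(1) by (rule prod.remove[rotated])
        moreover have "card (\<alpha> - {x}) = Suc N"
          using x \<alpha>(4) by (simp add: N_def card_Diff_singleton)
        ultimately show ?thesis
          by (simp add: prod.distrib)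
      qed
      ultimately have "d (f x) * (\<rho> x ^ N * P)
          = (\<Prod>y\<in>\<alpha> - {x}. (dist (f x) (f y))\<^sup>2 * (\<rho> x * \<rho> y))"
        by (simp add: prod.distrib)
      also have "\<dots> = d x"
        unfolding d_def \<rho>_def using x \<alpha>(2) conf by (intro prod.cong refl) (auto simp: subset_iff)
      finally show ?thesis .
    qed
    have "(\<Prod>x\<in>\<alpha>. d (f x)) * (\<Prod>x\<in>\<alpha>. \<rho> x ^ N * P) = (\<Prod>x\<in>\<alpha>. d x)"
      by (simp add: d_f flip: prod.distrib)
    moreover have "(\<Prod>x\<in>\<alpha>. d (f x)) = (\<Prod>x\<in>\<alpha>. d x)"
      using prod.reindex[OF inj, of d] f(2) by simp
    moreover have "(\<Prod>x\<in>\<alpha>. d x) > 0"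
      using d_pos by (simp add: prod_pos)
    moreover have "(\<Prod>x\<in>\<alpha>. \<rho> x ^ N * P) = P ^ (N + card \<alpha>)"
      by (simp add: prod.distrib power_add prod_power_distrib P_def)
    ultimately have "P ^ (N + card \<alpha>) = 1"
      by simp
    moreover have "P > 0"
      unfolding P_def using \<alpha>(2) by (intro prod_pos pos) auto
    ultimately show ?thesis
      using \<alpha>(4) by (auto dest: power_eq_1_iff)
  qed
  have "p = 0"
  proof (rule ccontr)
    assume "p \<noteq> 0"
    define t where "t = arsinh (norm p)"
    define n where "n = p /\<^sub>R norm p"
    have t: "sinh t = norm p" "cosh t = p0" "t \<noteq> 0"
      using p0 \<open>p \<noteq> 0\<close> by (simp_all add: t_def cosh_arsinh_real real_sqrt_unique add.commute dot_square_norm)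
    have n: "norm n = 1"
      using \<open>p \<noteq> 0\<close> by (simp add: n_def)
    have \<rho>: "\<rho> x = cosh t + (n \<bullet> x) * sinh t" for x
      using \<open>p \<noteq> 0\<close> by (simp add: \<rho>_def t n_def)
    have c: "\<bar>n \<bullet> x\<bar> \<le> 1" if "x \<in> \<alpha>" for x
      using Cauchy_Schwarz_ineq2[of n x] that \<alpha>(2) n by auto
    have "\<exists>x\<in>\<alpha>. \<bar>n \<bullet> x\<bar> < 1"
    proof (rule ccontr)
      assume "\<not> (\<exists>x\<in>\<alpha>. \<bar>n \<bullet> x\<bar> < 1)"
      then have "\<bar>n \<bullet> x\<bar> = 1" if "x \<in> \<alpha>" for x
        using c[OF that] that by force
      then have "(dist n x)\<^sup>2 = 0 \<or> (dist (- n) x)\<^sup>2 = 0" if "x \<in> \<alpha>" for x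
        using that n \<alpha>(2) dist_sphere[of n x] dist_sphere[of "- n" x] by (force simp: abs_if split: if_splits)
      then have "\<alpha> \<subseteq> {n, - n}"
        by force
      then have "card \<alpha> \<le> card {n, - n}"
        by (rule card_mono[rotated]) simp
      also have "\<dots> \<le> 2"
        by (simp add: card_insert_if)
      finally show False
        using \<alpha>(4) by simp
    qed
    then have "(\<Sum>x\<in>\<alpha>. t * (n \<bullet> x)) < (\<Sum>x\<in>\<alpha>. ln (\<rho> x))"
      unfolding \<rho> using \<alpha>(1) log_convexity[OF c] t(3) by (intro sum_strict_mono_ex1) (auto intro!: bexI)
    also have "\<dots> = ln P"
      unfolding P_def using \<alpha>(1,2) pos by (subst ln_prod) force+
    finally show False
      using \<open>P = 1\<close> \<alpha>(3) by (simp flip: sum_distrib_left inner_sum_right)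
  qed
  then have "p0 = 1"
    using p0 by (simp add: power2_eq_1_iff)
  then have "(dist (f x) (f y))\<^sup>2 = (dist x y)\<^sup>2"
    using conf xy \<open>p = 0\<close> by simp
  then show ?thesis
    by simp
qed

corollary balanced_moebius_orthogonal:
  assumes "f \<in> moebius_transformations" "f ` \<alpha> = \<alpha>"
    and "finite \<alpha>" "\<alpha> \<subseteq> riemann_sphere" "(\<Sum>x\<in>\<alpha>. x) = 0" "card \<alpha> \<ge> 3"
  obtains g where "orthogonal_transformation g" "f = restrict g riemann_sphere"
proof -
  have "\<exists>g. orthogonal_transformation g \<and> (\<forall>x. norm x = 1 \<longrightarrow> g x = f x)"
    using balanced_moebius_isometry[OF assms] moebius_in_sphere[OF assms(1)]
    by (intro isometry_sphere_extend) auto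
  then obtain g where g: "orthogonal_transformation g" "\<And>x. norm x = 1 \<Longrightarrow> g x = f x"
    by blast
  have "f = restrict g riemann_sphere"
    using g(2) moebius_extensional[OF assms(1)] by (auto simp: fun_eq_iff extensional_def)
  with g(1) show ?thesis
    using that by blast
qed

section \<open>The regular tetrahedron and the permutations of its vertices\<close>

text \<open>The interval is kept opaque, so that membership of an index is not rewritten into inequalities.\<close>

definition I4 :: "nat set" where "I4 = {1..4}"

definition A4 :: "(nat \<Rightarrow> nat) set" where "A4 = {p. p permutes I4 \<and> evenperm p}"

lemma finite_I4 [simp]: "finite I4" and card_I4 [simp]: "card I4 = 4"
  by (auto simp: I4_def)

lemma A4_permutes: "p \<in> A4 \<Longrightarrow> p permutes I4"
  by (simp add: A4_def)

lemma permutes_permutation: "p permutes I4 \<Longrightarrow> permutation p"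
  using permutation_permutes finite_I4 by blast

lemma A4_comp: "p \<in> A4 \<Longrightarrow> q \<in> A4 \<Longrightarrow> p \<circ> q \<in> A4"
  by (simp add: A4_def permutes_compose evenperm_comp permutes_permutation)

lemma id_A4 [simp]: "id \<in> A4"
  by (simp add: A4_def permutes_id evenperm_id)

lemma A4_inverse: "p \<in> A4 \<Longrightarrow> inv' p \<in> A4"
  by (simp add: A4_def permutes_inv evenperm_inv permutes_permutation)

lemma carrier_alt_group_4: "carrier (alt_group 4) = A4"
  by (auto simp: alt_group_carrier A4_def I4_def)

lemma card_A4: "card A4 = 12"
  using alt_group_card_carrier[of 4] by (simp add: carrier_alt_group_4 fact_numeral)

lemma finite_A4 [simp]: "finite A4"
  using card_A4 card.infinite by fastforce

lemma I4_other_two: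
  assumes "i \<in> I4" "j \<in> I4" "i \<noteq> j"
  obtains k l where "k \<noteq> l" "k \<notin> {i, j}" "l \<notin> {i, j}" "I4 = {i, j, k, l}"
proof -
  have "card (I4 - {i, j}) = 2"
    using assms by (simp add: card_Diff_subset)
  then obtain k l where "I4 - {i, j} = {k, l}" "k \<noteq> l"
    by (auto simp: card_2_iff)
  then show ?thesis
    using that[of k l] assms by blast
qed

text \<open>The alternating group on four letters is doubly transitive: a permutation with the prescribed values is
  corrected, if it is odd, by exchanging the two remaining values.\<close>

lemma A4_two_transitive:
  assumes "i \<in> I4" "j \<in> I4" "i \<noteq> j" "k \<in> I4" "l \<in> I4" "k \<noteq> l"
  obtains p where "p \<in> A4" "p i = k" "p j = l"
proof -
  define q where "q = Transposition.transpose (Transposition.transpose i k j) l \<circ> Transposition.transpose i k"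
  have "Transposition.transpose i k j \<in> I4"
    using assms by (auto simp: Transposition.transpose_def)
  then have q: "q permutes I4"
    unfolding q_def using assms by (intro permutes_compose permutes_swap_id)
  have "Transposition.transpose i k j \<noteq> k"
    using assms by (auto simp: Transposition.transpose_def)
  then have ij: "q i = k" "q j = l"
    using assms by (auto simp: q_def)
  obtain m n where mn: "m \<noteq> n" "m \<notin> {k, l}" "n \<notin> {k, l}" "I4 = {k, l, m, n}"
    using I4_other_two[of k l] assms by blast
  show ?thesis
  proof (cases "evenperm q")
    case True
    then show ?thesis
      using that[of q] q ij by (simp add: A4_def)
  next
    case False
    have "Transposition.transpose m n \<circ> q permutes I4"
      using q mn by (intro permutes_compose permutes_swap_id) auto
    moreover have "evenperm (Transposition.transpose m n \<circ> q)"
      using False mn(1) by (simp add: evenperm_comp evenperm_swap permutation_swap_id permutes_permutation[OF q])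
    ultimately show ?thesis
      using that[of "Transposition.transpose m n \<circ> q"] ij mn by (simp add: A4_def)
  qed
qed

lemma linear_combine: "linear f \<Longrightarrow> f (\<Sum>i\<in>A. c i *\<^sub>R w i) = (\<Sum>i\<in>A. c i *\<^sub>R f (w i))"
  by (simp add: linear_sum linear_scale)

locale tetrahedron =
  fixes v :: "nat \<Rightarrow> real ^ 3"
  assumes inner_vertices: "i \<in> I4 \<Longrightarrow> j \<in> I4 \<Longrightarrow> v i \<bullet> v j = (if i = j then 1 else - 1 / 3)"
begin

definition "V = v ` I4"

text \<open>The Gram matrix of the vertices is \<open>4/3\<close> times the identity minus \<open>1/3\<close> times the all-ones matrix.\<close>

lemma sum_if_vertices:
  assumes "j \<in> I4"
  shows "(\<Sum>i\<in>I4. a i * (v i \<bullet> v j)) = 4 / 3 * a j - (\<Sum>i\<in>I4. a i) / 3"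
proof -
  have "(\<Sum>i\<in>I4. a i * (v i \<bullet> v j)) = (\<Sum>i\<in>I4. (if i = j then 4 / 3 * a i else 0) - a i / 3)"
    using assms by (intro sum.cong) (auto simp: inner_vertices)
  also have "\<dots> = 4 / 3 * a j - (\<Sum>i\<in>I4. a i) / 3"
    using assms by (simp add: sum_subtractf sum_divide_distrib)
  finally show ?thesis .
qed

lemma sum_vertices: "(\<Sum>i\<in>I4. v i) = 0"
proof -
  have "(\<Sum>i\<in>I4. v i) \<bullet> v j = 0" if "j \<in> I4" for j
    using sum_if_vertices[OF that, of "\<lambda>_. 1"] by (simp add: inner_sum_left)
  then have "(\<Sum>j\<in>I4. (\<Sum>i\<in>I4. v i) \<bullet> v j) = 0"
    by simp
  then show ?thesis
    by (simp flip: inner_sum_right)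
qed

lemma sum_inner_vertices: "(\<Sum>i\<in>I4. x \<bullet> v i) = 0"
  by (simp add: sum_vertices flip: inner_sum_right)

text \<open>The sums \<open>v\<^sub>1 + v\<^sub>2\<close>, \<open>v\<^sub>1 + v\<^sub>3\<close>, \<open>v\<^sub>1 + v\<^sub>4\<close> are pairwise orthogonal, and \<open>\<real>\<^sup>3\<close> has no room for a fourth
  nonzero vector orthogonal to them.\<close>

lemma orthogonal_vertices_imp_0:
  assumes "\<And>i. i \<in> I4 \<Longrightarrow> y \<bullet> v i = 0"
  shows "y = 0"
proof (rule ccontr)
  assume "y \<noteq> 0"
  have I: "1 \<in> I4" "2 \<in> I4" "3 \<in> I4" "4 \<in> I4"
    by (simp_all add: I4_def)
  define a b c where "a = v 1 + v 2" and "b = v 1 + v 3" and "c = v 1 + v 4"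
  have abc: "a \<bullet> a = 4 / 3" "b \<bullet> b = 4 / 3" "c \<bullet> c = 4 / 3"
    "a \<bullet> b = 0" "a \<bullet> c = 0" "b \<bullet> c = 0" "b \<bullet> a = 0" "c \<bullet> a = 0" "c \<bullet> b = 0"
    using I by (simp_all add: a_def b_def c_def inner_add_left inner_add_right inner_vertices)
  have y: "y \<bullet> a = 0" "y \<bullet> b = 0" "y \<bullet> c = 0" "a \<bullet> y = 0" "b \<bullet> y = 0" "c \<bullet> y = 0"
    using assms I by (simp_all add: a_def b_def c_def inner_add_right inner_commute[of _ y])
  have "pairwise orthogonal {y, a, b, c}"
    using abc y by (auto simp: pairwise_def orthogonal_def)
  moreover have ne: "a \<noteq> 0" "b \<noteq> 0" "c \<noteq> 0"
    using abc by auto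
  ultimately have "independent {y, a, b, c}"
    using \<open>y \<noteq> 0\<close> by (intro pairwise_orthogonal_independent) auto
  then have "card {y, a, b, c} \<le> 3"
    using independent_card_le[of "{y, a, b, c}"] by simp
  moreover have "card {y, a, b, c} = 4"
    using abc y ne \<open>y \<noteq> 0\<close> by (auto simp: card_insert_if)
  ultimately show False
    by simp
qed

lemma inner_vertices_eqI:
  assumes "\<And>i. i \<in> I4 \<Longrightarrow> x \<bullet> v i = y \<bullet> v i"
  shows "x = y"
  using orthogonal_vertices_imp_0[of "x - y"] assms by (simp add: inner_diff_left)

text \<open>The vertices form a tight frame.  A point is thus determined by its four inner products with the
  vertices, which sum to \<open>0\<close>; a permutation of the vertices acts by permuting these coordinates.\<close>

lemma frame: "x = (\<Sum>i\<in>I4. (3 / 4 * (x \<bullet> v i)) *\<^sub>R v i)"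
proof (rule inner_vertices_eqI)
  fix j assume j: "j \<in> I4"
  show "x \<bullet> v j = (\<Sum>i\<in>I4. (3 / 4 * (x \<bullet> v i)) *\<^sub>R v i) \<bullet> v j"
    using sum_if_vertices[OF j, of "\<lambda>i. 3 / 4 * (x \<bullet> v i)"]
    by (simp add: inner_sum_left sum_inner_vertices flip: sum_distrib_left sum_divide_distrib)
qed

lemma inner_frame: "x \<bullet> y = (\<Sum>i\<in>I4. 3 / 4 * (x \<bullet> v i) * (y \<bullet> v i))"
proof -
  have "x \<bullet> y = (\<Sum>i\<in>I4. (3 / 4 * (x \<bullet> v i)) *\<^sub>R v i) \<bullet> y"
    using frame[of x] by simp
  then show ?thesis
    by (simp add: inner_sum_left inner_commute[of y])
qed

lemma linear_eqI:
  assumes "linear f" "linear g" "\<And>i. i \<in> I4 \<Longrightarrow> f (v i) = g (v i)"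
  shows "f = g"
proof
  fix x
  have "f x = (\<Sum>i\<in>I4. (3 / 4 * (x \<bullet> v i)) *\<^sub>R f (v i))"
    by (subst frame[of x]) (rule linear_combine[OF assms(1)])
  also have "\<dots> = (\<Sum>i\<in>I4. (3 / 4 * (x \<bullet> v i)) *\<^sub>R g (v i))"
    using assms(3) by (intro sum.cong) auto
  also have "\<dots> = g x"
    by (subst (2) frame[of x]) (rule linear_combine[OF assms(2), symmetric])
  finally show "f x = g x" .
qed

lemma inj_on_vertices: "inj_on v I4"
proof (rule inj_onI, rule ccontr)
  fix i j assume "i \<in> I4" "j \<in> I4" "v i = v j" "i \<noteq> j"
  then show False
    using inner_vertices[of i i] inner_vertices[of i j] by simp
qed

lemma norm_vertex: "i \<in> I4 \<Longrightarrow> norm (v i) = 1"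
  by (simp add: norm_eq_1 inner_vertices)

definition act :: "(nat \<Rightarrow> nat) \<Rightarrow> real ^ 3 \<Rightarrow> real ^ 3" where
  "act p x = (\<Sum>i\<in>I4. (3 / 4 * (x \<bullet> v i)) *\<^sub>R v (p i))"

lemma linear_act: "linear (act p)"
  unfolding act_def
  by (rule linearI) (simp_all add: inner_add_left algebra_simps sum.distrib scaleR_sum_right)

lemma inner_act_vertex:
  assumes p: "p permutes I4" and j: "j \<in> I4"
  shows "act p x \<bullet> v (p j) = x \<bullet> v j"
proof -
  have "act p x \<bullet> v (p j) = (\<Sum>i\<in>I4. 3 / 4 * (x \<bullet> v i) * (v (p i) \<bullet> v (p j)))"
    by (simp add: act_def inner_sum_left)
  also have "\<dots> = (\<Sum>i\<in>I4. 3 / 4 * (x \<bullet> v i) * (v i \<bullet> v j))"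
    using p j permutes_inj[OF p]
    by (intro sum.cong) (auto simp: inner_vertices permutes_in_image inj_eq)
  also have "\<dots> = x \<bullet> v j"
    by (subst inner_frame[of x "v j"]) (simp add: inner_commute)
  finally show ?thesis .
qed

lemma inner_permuted_vertices_eqI:
  assumes "p permutes I4" "\<And>i. i \<in> I4 \<Longrightarrow> x \<bullet> v (p i) = y \<bullet> v (p i)"
  shows "x = y"
proof (rule inner_vertices_eqI)
  fix j assume "j \<in> I4"
  then obtain i where "i \<in> I4" "j = p i"
    using permutes_image[OF assms(1)] by blast
  then show "x \<bullet> v j = y \<bullet> v j"
    using assms(2) by simp
qed

lemma act_vertex:
  assumes p: "p permutes I4" and j: "j \<in> I4"
  shows "act p (v j) = v (p j)"
  using p j permutes_inj[OF p]
  by (intro inner_permuted_vertices_eqI[OF p])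
     (auto simp: inner_act_vertex inner_vertices permutes_in_image inj_eq)

lemma act_comp:
  assumes p: "p permutes I4" and q: "q permutes I4"
  shows "act (p \<circ> q) x = act p (act q x)"
  using inner_act_vertex[OF permutes_compose[OF q p]] inner_act_vertex[OF p] inner_act_vertex[OF q] q
  by (intro inner_permuted_vertices_eqI[OF permutes_compose[OF q p]]) (simp add: permutes_in_image)

lemma act_id: "act id x = x"
  using frame[of x] by (simp add: act_def)

lemma inner_act_act:
  assumes p: "p permutes I4"
  shows "act p x \<bullet> act p y = x \<bullet> y"
proof -
  have "act p x \<bullet> act p y = (\<Sum>i\<in>I4. 3 / 4 * (act p x \<bullet> v (p i)) * (act p y \<bullet> v (p i)))"
    by (subst inner_frame, subst sum.permute[OF p]) (simp add: o_def)
  also have "\<dots> = x \<bullet> y"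
    by (subst inner_frame[of x y]) (simp add: inner_act_vertex[OF p])
  finally show ?thesis .
qed

lemma orthogonal_transformation_act: "p permutes I4 \<Longrightarrow> orthogonal_transformation (act p)"
  by (simp add: orthogonal_transformation_def linear_act inner_act_act)

lemma norm_act: "p permutes I4 \<Longrightarrow> norm (act p x) = norm x"
  by (simp add: orthogonal_transformation_norm orthogonal_transformation_act)

lemma act_V: "p permutes I4 \<Longrightarrow> act p ` V = V"
  unfolding V_def image_image by (simp add: act_vertex) (metis image_image permutes_image)

text \<open>An orthogonal map is determined by the images of the vertices, since they span the space.\<close>

lemma orthogonal_vertex_permutation:
  assumes g: "orthogonal_transformation g" and V: "g ` V \<subseteq> V"
  obtains p where "p permutes I4" "g = act p"
proof -
  define p where "p i = (if i \<in> I4 then inv_into I4 v (g (v i)) else i)" for i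
  have vp: "v (p i) = g (v i)" "p i \<in> I4" if "i \<in> I4" for i
  proof -
    have "g (v i) \<in> v ` I4"
      using V that by (auto simp: V_def)
    then show "v (p i) = g (v i)" "p i \<in> I4"
      using that by (simp_all add: p_def f_inv_into_f inv_into_into)
  qed
  have "inj_on p I4"
  proof (rule inj_onI)
    fix i j assume ij: "i \<in> I4" "j \<in> I4" "p i = p j"
    then have "g (v i) = g (v j)"
      using vp by metis
    then have "v i = v j"
      using orthogonal_transformation_inj[OF g] by (simp add: inj_eq)
    then show "i = j"
      using ij inj_on_vertices by (simp add: inj_on_eq_iff)
  qed
  moreover have "p ` I4 \<subseteq> I4"
    using vp(2) by blast
  ultimately have "bij_betw p I4 I4"
    using endo_inj_surj[OF finite_I4] by (simp add: bij_betw_def)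
  then have p: "p permutes I4"
    by (rule bij_imp_permutes) (simp add: p_def)
  have "g = act p"
    using g vp(1) act_vertex[OF p] by (intro linear_eqI) (auto simp: orthogonal_transformation_def linear_act)
  with p show ?thesis
    using that by blast
qed

text \<open>The sign of \<open>p\<close> times \<open>act p\<close>.  For all 24 permutations these are the rotations of the cube with vertices
  \<open>V \<union> - V\<close>; for even ones they are the tetrahedral rotations.\<close>

definition rot :: "(nat \<Rightarrow> nat) \<Rightarrow> real ^ 3 \<Rightarrow> real ^ 3" where
  "rot p x = (if evenperm p then act p x else - act p x)"

lemma linear_rot: "linear (rot p)"
  by (cases "evenperm p") (simp_all add: rot_def[abs_def] linear_act linear_compose_neg)

text \<open>The orthogonal map that exchanges two vertices is the reflection in their bisecting plane.\<close>

lemma act_transpose: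
  assumes "i \<in> I4" "j \<in> I4" "i \<noteq> j"
  shows "act (Transposition.transpose i j) x = - halfturn (v i - v j) x"
proof -
  have "act (Transposition.transpose i j) = (\<lambda>x. - halfturn (v i - v j) x)"
  proof (rule linear_eqI)
    fix k assume k: "k \<in> I4"
    have p: "Transposition.transpose i j permutes I4"
      using assms by (simp add: permutes_swap_id)
    have dd: "(v i - v j) \<bullet> (v i - v j) = 8 / 3"
      using assms by (simp add: inner_diff_left inner_diff_right inner_vertices)
    have vk: "v k \<bullet> (v i - v j) = (if k = i then 4 / 3 else if k = j then - 4 / 3 else 0)"
      using assms k by (simp add: inner_diff_right inner_vertices)
    have "halfturn (v i - v j) (v k) = - v (Transposition.transpose i j k)"
      unfolding halfturn_def dd vk by (simp add: Transposition.transpose_def)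
    then show "act (Transposition.transpose i j) (v k) = - halfturn (v i - v j) (v k)"
      using act_vertex[OF p k] by simp
  qed (simp_all add: linear_act linear_halfturn linear_compose_neg)
  then show ?thesis
    by simp
qed

lemma rot_transpose_comp:
  assumes "i \<in> I4" "j \<in> I4" "i \<noteq> j" and q: "q permutes I4"
  shows "rot (Transposition.transpose i j \<circ> q) x = halfturn (v i - v j) (rot q x)"
proof -
  have p: "Transposition.transpose i j permutes I4"
    using assms by (simp add: permutes_swap_id)
  have "evenperm (Transposition.transpose i j \<circ> q) \<longleftrightarrow> \<not> evenperm q"
    using assms by (simp add: evenperm_comp evenperm_swap permutation_swap_id permutes_permutation)
  then show ?thesis
    using assms linear_neg[OF linear_halfturn] by (simp add: rot_def act_comp[OF p q] act_transpose)
qed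

lemma norm_rot: "p permutes I4 \<Longrightarrow> norm (rot p x) = norm x"
  by (simp add: rot_def norm_act)

text \<open>By \<open>rot_transpose_comp\<close> each \<open>rot p\<close> is a product of half-turns, one for every transposition in a
  factorisation of \<open>p\<close>.  In particular \<open>det (act p)\<close> is the sign of \<open>p\<close>.\<close>

lemma rot_moebius_and_det:
  assumes "p permutes I4"
  shows "restrict (rot p) riemann_sphere \<in> moebius_transformations \<and> det (matrix (rot p)) = 1"
  using assms finite_I4
proof (induction rule: permutes_induct)
  case id
  have "rot id = (\<lambda>x. x)" "det (matrix (\<lambda>x :: real ^ 3. x)) = 1"
    by (simp_all add: fun_eq_iff rot_def act_id evenperm_id matrix_id[unfolded id_def])
  moreover have "(\<lambda>x\<in>riemann_sphere. x) \<in> moebius_transformations"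
    unfolding moebius_transformations_eq mob_id[symmetric] by (rule imageI) simp
  ultimately show ?case
    by (simp only: simp_thms)
next
  case (swap a b q)
  let ?h = "halfturn (v a - v b)"
  have "v a - v b \<noteq> 0"
    using swap inj_on_vertices by (auto simp: inj_on_eq_iff)
  then have h: "restrict ?h riemann_sphere \<in> moebius_transformations" "det (matrix ?h) = 1"
    by (simp_all add: halfturn_moebius det_halfturn)
  have rot: "rot (Transposition.transpose a b \<circ> q) = ?h \<circ> rot q"
    using swap by (simp add: fun_eq_iff rot_transpose_comp)
  have "restrict (?h \<circ> rot q) riemann_sphere
      = compose riemann_sphere (restrict ?h riemann_sphere) (restrict (rot q) riemann_sphere)"
    using swap by (auto simp: fun_eq_iff compose_def norm_rot)
  moreover have "\<dots> \<in> moebius_transformations"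
    by (intro moebius_compose h(1) conjunct1[OF swap.IH])
  moreover have "det (matrix (?h \<circ> rot q)) = 1"
    using h(2) swap.IH by (simp only: matrix_compose linear_rot linear_halfturn det_mul)
  ultimately show ?case
    by (simp only: rot simp_thms)
qed

text \<open>A unit vector \<open>y\<close> that is not a vertex has inner product less than \<open>1\<close> with all vertices, so an open half-space that
  misses \<open>y\<close> contains the tetrahedron.  Hence a rotation preserves the tetrahedron only if it preserves
  its vertex set.\<close>

lemma hull_sphere_vertex:
  assumes "y \<in> convex hull V" "norm y = 1"
  shows "y \<in> V"
proof (rule ccontr)
  assume "y \<notin> V"
  have "V \<subseteq> {z. y \<bullet> z < 1}"
  proof
    fix z assume z: "z \<in> V"
    then have "norm z = 1" "z \<noteq> y"
      using \<open>y \<notin> V\<close> by (auto simp: V_def norm_vertex)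
    then have "0 < (dist y z)\<^sup>2"
      by simp
    moreover have "(dist y z)\<^sup>2 = 2 - 2 * (y \<bullet> z)"
      using \<open>norm z = 1\<close> assms(2) by (simp add: dist_sphere)
    ultimately have "y \<bullet> z < 1"
      by linarith
    then show "z \<in> {z. y \<bullet> z < 1}" ..
  qed
  then have "convex hull V \<subseteq> {z. y \<bullet> z < 1}"
    by (rule hull_minimal) (rule convex_halfspace_lt)
  then show False
    using assms by (auto simp: norm_eq_1)
qed

theorem tetrahedral_group_eq: "tetrahedral_group V = (\<lambda>p. matrix (act p)) ` A4"
proof (intro Set.set_eqI iffI)
  fix Q assume "Q \<in> tetrahedral_group V"
  then have Q: "orthogonal_matrix Q" "det Q = 1" and hull: "(\<lambda>x. Q *v x) ` (convex hull V) = convex hull V"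
    by (auto simp: tetrahedral_group_def rotation_matrix_def)
  have ortho: "orthogonal_transformation (\<lambda>x. Q *v x)"
    using Q by (simp add: orthogonal_transformation_matrix matrix_vector_mul_linear)
  have "(\<lambda>x. Q *v x) ` V \<subseteq> V"
  proof
    fix y assume "y \<in> (\<lambda>x. Q *v x) ` V"
    then obtain i where i: "i \<in> I4" "y = Q *v v i"
      by (auto simp: V_def)
    have "y \<in> convex hull V"
      using hull i by (auto simp: V_def intro: hull_inc)
    moreover have "norm y = 1"
      using i orthogonal_transformation_norm[OF ortho] norm_vertex by simp
    ultimately show "y \<in> V"
      by (rule hull_sphere_vertex)
  qed
  then obtain p where p: "p permutes I4" "(\<lambda>x. Q *v x) = act p"
    using orthogonal_vertex_permutation[OF ortho] by blast
  then have Qp: "Q = matrix (act p)"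
    by (metis matrix_of_matrix_vector_mul)
  have "evenperm p"
  proof (rule ccontr)
    assume "\<not> evenperm p"
    then have "matrix (rot p) = - Q"
      by (simp add: Qp rot_def[abs_def] matrix_def vec_eq_iff)
    then have "det (- Q) = 1"
      using rot_moebius_and_det[OF p(1)] by simp
    then show False
      using Q(2) by (simp add: det_3)
  qed
  then show "Q \<in> (\<lambda>p. matrix (act p)) ` A4"
    using p Qp by (simp add: A4_def)
next
  fix Q assume "Q \<in> (\<lambda>p. matrix (act p)) ` A4"
  then obtain p where p: "p \<in> A4" "Q = matrix (act p)"
    by blast
  then have perm: "p permutes I4" and "rot p = act p"
    by (simp_all add: A4_def rot_def[abs_def])
  then have "det Q = 1"
    using rot_moebius_and_det[OF perm] p(2) by simp
  moreover have "orthogonal_matrix Q"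
    using orthogonal_transformation_act[OF perm] p(2) by (simp add: orthogonal_transformation_matrix)
  moreover have "(\<lambda>x. Q *v x) = act p"
    using p(2) by (simp add: matrix_works linear_act fun_eq_iff)
  moreover have "act p ` (convex hull V) = convex hull V"
    by (simp add: convex_hull_linear_image linear_act act_V[OF perm])
  ultimately show "Q \<in> tetrahedral_group V"
    by (simp add: tetrahedral_group_def rotation_matrix_def)
qed

lemma tetrahedral_orbit_eq: "tetrahedral_orbit V x = (\<lambda>p. act p x) ` A4"
  by (simp add: tetrahedral_orbit_def tetrahedral_group_eq image_image matrix_works linear_act)

end

text \<open>Equal distances give a common inner product \<open>c\<close> of distinct vertices; pairing a vertex with the vanishing
  sum yields \<open>1 + 3 c = 0\<close>.\<close>

lemma inscribed_regular_tetrahedron_vertices: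
  assumes "inscribed_regular_tetrahedron W"
  obtains v where "tetrahedron v" "W = tetrahedron.V v"
proof -
  obtain l where W: "W \<subseteq> riemann_sphere" "card W = 4" "(\<Sum>u\<in>W. u) = 0"
    and l: "\<And>u w. u \<in> W \<Longrightarrow> w \<in> W \<Longrightarrow> u \<noteq> w \<Longrightarrow> dist u w = l"
    using assms by (auto simp: inscribed_regular_tetrahedron_def)
  have "finite W"
    using W(2) by (intro card_ge_0_finite) simp
  define c where "c = 1 - l\<^sup>2 / 2"
  have inner: "u \<bullet> w = (if u = w then 1 else c)" if "u \<in> W" "w \<in> W" for u w
    using dist_sphere[of u w] l[of u w] that W(1) by (auto simp: c_def norm_eq_1 subset_iff field_simps)
  obtain u where u: "u \<in> W"
    using W(2) by fastforce
  have "0 = u \<bullet> (\<Sum>w\<in>W. w)"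
    by (simp add: W)
  also have "\<dots> = u \<bullet> u + (\<Sum>w\<in>W - {u}. u \<bullet> w)"
    by (simp add: sum.remove[OF \<open>finite W\<close> u] inner_add_right inner_sum_right)
  also have "(\<Sum>w\<in>W - {u}. u \<bullet> w) = (\<Sum>w\<in>W - {u}. c)"
    using u by (intro sum.cong) (auto simp: inner)
  also have "u \<bullet> u + \<dots> = 1 + 3 * c"
    using u W(2) \<open>finite W\<close> by (simp add: inner card_Diff_singleton)
  finally have c: "c = - 1 / 3"
    by simp
  obtain v where v: "bij_betw v I4 W"
    using finite_same_card_bij[OF finite_I4 \<open>finite W\<close>] W(2) by auto
  have tet: "tetrahedron v"
  proof
    show "v i \<bullet> v j = (if i = j then 1 else - 1 / 3)" if "i \<in> I4" "j \<in> I4" for i j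
      using that inner[of "v i" "v j"] c bij_betw_apply[OF v] bij_betw_imp_inj_on[OF v]
      by (simp add: inj_on_eq_iff)
  qed
  moreover have "W = tetrahedron.V v"
    using v by (simp add: tetrahedron.V_def[OF tet] bij_betw_imp_surj_on)
  ultimately show ?thesis
    using that by blast
qed

abbreviation moebius_stabilizer :: "(real ^ 3) set \<Rightarrow> (real ^ 3 \<Rightarrow> real ^ 3) set" where
  "moebius_stabilizer \<alpha> \<equiv> {f \<in> moebius_transformations. f ` \<alpha> = \<alpha>}"

lemma I4_other_one: "\<exists>j. j \<in> I4 \<and> j \<noteq> i"
proof (rule ccontr)
  assume "\<not> ?thesis"
  then have "card I4 \<le> card {i}"
    by (intro card_mono) auto
  then show False
    by simp
qed

context tetrahedron
begin

section \<open>Vertices, face points, edge points and generic orbits\<close>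

abbreviation "F \<equiv> face_points V"
abbreviation "E \<equiv> edge_points V"

lemma V_sphere: "V \<subseteq> riemann_sphere"
  by (auto simp: V_def norm_vertex)

lemma vertex_in_V: "i \<in> I4 \<Longrightarrow> v i \<in> V"
  by (simp add: V_def)

lemma card_V: "card V = 4" and finite_V [simp]: "finite V"
  by (simp_all add: V_def card_image inj_on_vertices)

text \<open>The sum of three vertices is the negative of the fourth.\<close>

lemma face_points_eq: "F = uminus ` V"
proof -
  have face: "sgn ((1 / 3) *\<^sub>R (\<Sum>u\<in>V - {v i}. u)) = - v i" if "i \<in> I4" for i
  proof -
    have "(\<Sum>u\<in>V. u) = 0"
      using sum_vertices by (simp add: V_def sum.reindex inj_on_vertices)
    then have "(\<Sum>u\<in>V - {v i}. u) = - v i"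
      using that by (simp add: sum_diff1 V_def)
    then show ?thesis
      using that norm_vertex[OF that] by (simp add: sgn_scaleR sgn_minus) (simp add: sgn_div_norm)
  qed
  have "W \<subseteq> V \<and> card W = 3 \<longleftrightarrow> (\<exists>i\<in>I4. W = V - {v i})" for W
  proof
    assume W: "W \<subseteq> V \<and> card W = 3"
    then have "finite W"
      using finite_subset[OF _ finite_V] by blast
    then have "card (V - W) = 1"
      using W card_V by (simp add: card_Diff_subset)
    then obtain u where u: "V - W = {u}"
      by (auto simp: card_1_singleton_iff)
    then have "u \<in> V" "W = V - {u}"
      using W by blast+
    then show "\<exists>i\<in>I4. W = V - {v i}"
      by (auto simp: V_def)
  next
    assume "\<exists>i\<in>I4. W = V - {v i}"
    then show "W \<subseteq> V \<and> card W = 3"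
      using card_V by (auto simp: V_def card_Diff_singleton)
  qed
  then have "F = (\<lambda>i. sgn ((1 / 3) *\<^sub>R (\<Sum>u\<in>V - {v i}. u))) ` I4"
    unfolding face_points_def by auto
  also have "\<dots> = (\<lambda>i. - v i) ` I4"
    using face by (intro image_cong) auto
  finally show ?thesis
    by (simp add: V_def image_image)
qed

text \<open>The factor normalises the sum of two vertices, whose squared norm is \<open>4/3\<close>.\<close>

definition edge :: "nat \<Rightarrow> nat \<Rightarrow> real ^ 3" where
  "edge i j = (sqrt 3 / 2) *\<^sub>R (v i + v j)"

lemma inner_edge_edge:
  assumes "i \<in> I4" "j \<in> I4" "i \<noteq> j"
  shows "edge i j \<bullet> edge i j = 1"
  using assms by (simp add: edge_def inner_add_left inner_add_right inner_vertices)

lemma norm_edge: "i \<in> I4 \<Longrightarrow> j \<in> I4 \<Longrightarrow> i \<noteq> j \<Longrightarrow> norm (edge i j) = 1"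
  by (simp add: norm_eq_1 inner_edge_edge)

lemma inner_edge_vertex:
  assumes "i \<in> I4" "j \<in> I4" "i \<noteq> j" "k \<in> I4"
  shows "edge i j \<bullet> v k = (if k \<in> {i, j} then sqrt 3 / 3 else - sqrt 3 / 3)"
  using assms by (auto simp: edge_def inner_add_left inner_vertices)

lemma edge_points_eq: "E = {edge i j | i j. i \<in> I4 \<and> j \<in> I4 \<and> i \<noteq> j}"
proof -
  have edge: "sgn (midpoint (v i) (v j)) = edge i j" if "i \<in> I4" "j \<in> I4" "i \<noteq> j" for i j
  proof -
    have "midpoint (v i) (v j) = (1 / sqrt 3) *\<^sub>R edge i j"
      by (simp add: midpoint_def edge_def)
    then show ?thesis
      using norm_edge[OF that] by (simp add: sgn_scaleR) (simp add: sgn_div_norm)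
  qed
  show ?thesis
  proof (intro Set.set_eqI iffI)
    fix x assume "x \<in> E"
    then obtain i j where "i \<in> I4" "j \<in> I4" "v i \<noteq> v j" "x = sgn (midpoint (v i) (v j))"
      by (auto simp: edge_points_def V_def)
    then show "x \<in> {edge i j | i j. i \<in> I4 \<and> j \<in> I4 \<and> i \<noteq> j}"
      using edge by auto
  next
    fix x assume "x \<in> {edge i j | i j. i \<in> I4 \<and> j \<in> I4 \<and> i \<noteq> j}"
    then obtain i j where ij: "i \<in> I4" "j \<in> I4" "i \<noteq> j" "x = edge i j"
      by auto
    then have "v i \<noteq> v j"
      using inj_on_vertices by (auto simp: inj_on_eq_iff)
    then show "x \<in> E"
      using ij edge[OF ij(1-3)] unfolding edge_points_def V_def by force
  qed
qed

lemma edge_in_edge_points: "i \<in> I4 \<Longrightarrow> j \<in> I4 \<Longrightarrow> i \<noteq> j \<Longrightarrow> edge i j \<in> E"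
  by (auto simp: edge_points_eq)

lemma edge_opposite:
  assumes "I4 = {i, j, k, l}" "distinct [i, j, k, l]"
  shows "edge k l = - edge i j"
proof -
  have "sum v {i, j, k, l} = 0"
    using sum_vertices by (simp only: assms(1))
  then have "v i + v j + (v k + v l) = 0"
    using assms(2) by (simp add: add.assoc)
  then show ?thesis
    by (simp add: edge_def eq_neg_iff_add_eq_0 add.commute flip: scaleR_right_distrib)
qed

lemma uminus_edge_points: "x \<in> E \<Longrightarrow> - x \<in> E"
proof -
  assume "x \<in> E"
  then obtain i j where ij: "i \<in> I4" "j \<in> I4" "i \<noteq> j" "x = edge i j"
    by (auto simp: edge_points_eq)
  obtain k l where kl: "k \<noteq> l" "k \<notin> {i, j}" "l \<notin> {i, j}" "I4 = {i, j, k, l}"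
    using I4_other_two[OF ij(1-3)] .
  have "edge k l = - edge i j"
    by (rule edge_opposite[OF kl(4)]) (use kl(1-3) ij(3) in auto)
  moreover have "edge k l \<in> E"
    by (rule edge_in_edge_points[OF _ _ kl(1)]) (simp_all add: kl(4))
  ultimately show ?thesis
    using ij(4) by simp
qed

lemma face_points_sphere: "F \<subseteq> riemann_sphere"
  using V_sphere by (auto simp: face_points_eq)

lemma edge_points_sphere: "E \<subseteq> riemann_sphere"
  by (auto simp: edge_points_eq norm_edge)

lemma special_points_disjoint:
  "V \<inter> F = {}" "V \<inter> E = {}" "F \<inter> E = {}"
proof -
  have "v i \<noteq> - v j" if "i \<in> I4" "j \<in> I4" for i j
  proof
    assume "v i = - v j"
    then have "v i \<bullet> v i = - (v j \<bullet> v i)"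
      by simp
    then show False
      using that by (auto simp: inner_vertices split: if_splits)
  qed
  then show "V \<inter> F = {}"
    unfolding face_points_eq unfolding V_def by auto
  have sq: "(x \<bullet> v k)\<^sup>2 = 1 / 3" if "x \<in> E" "k \<in> I4" for x k
  proof -
    obtain i j where "i \<in> I4" "j \<in> I4" "i \<noteq> j" "x = edge i j"
      using \<open>x \<in> E\<close> by (auto simp: edge_points_eq)
    then show ?thesis
      using that(2) by (cases "k \<in> {i, j}") (simp_all add: inner_edge_vertex power_divide)
  qed
  show "V \<inter> E = {}"
  proof (rule ccontr)
    assume "V \<inter> E \<noteq> {}"
    then obtain i where "i \<in> I4" "v i \<in> E"
      unfolding V_def by auto
    then show False
      using sq[of "v i" i] by (simp add: inner_vertices)
  qed
  show "F \<inter> E = {}"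
  proof (rule ccontr)
    assume "F \<inter> E \<noteq> {}"
    then obtain i where "i \<in> I4" "- v i \<in> E"
      unfolding face_points_eq unfolding V_def by auto
    then show False
      using sq[of "- v i" i] by (simp add: inner_vertices)
  qed
qed

lemma card_face_points: "card F = 4" and finite_face_points [simp]: "finite F"
  by (simp_all add: face_points_eq card_image card_V)

text \<open>An edge point remembers its pair of vertices: they are the two with which it has positive inner product.\<close>

lemma card_edge_points: "card E = 6"
proof -
  let ?P = "{B. B \<subseteq> I4 \<and> card B = 2}"
  define g where "g B = (sqrt 3 / 2) *\<^sub>R (\<Sum>i\<in>B. v i)" for B
  have g_pair: "g {i, j} = edge i j" if "i \<noteq> j" for i j
    using that by (simp add: g_def edge_def)
  have "E = g ` ?P"
  proof (intro Set.set_eqI iffI)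
    fix x assume "x \<in> E"
    then obtain i j where "i \<in> I4" "j \<in> I4" "i \<noteq> j" "x = edge i j"
      by (auto simp: edge_points_eq)
    then have "x = g {i, j}" "{i, j} \<in> ?P"
      by (simp_all add: g_pair)
    then show "x \<in> g ` ?P"
      by blast
  next
    fix x assume "x \<in> g ` ?P"
    then show "x \<in> E"
      by (auto simp: card_2_iff g_pair edge_in_edge_points)
  qed
  moreover have "inj_on g ?P"
  proof (rule inj_on_inverseI)
    fix B assume "B \<in> ?P"
    then obtain i j where "B = {i, j}" "i \<noteq> j" "i \<in> I4" "j \<in> I4"
      by (auto simp: card_2_iff)
    then show "{k \<in> I4. g B \<bullet> v k > 0} = B"
      by (auto simp: g_pair inner_edge_vertex split: if_splits)
  qed
  moreover have "card ?P = 6"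
    using n_subsets[OF finite_I4, of 2] by (simp add: choose_two)
  ultimately show ?thesis
    by (simp add: card_image)
qed

lemma finite_edge_points [simp]: "finite E"
  using card_edge_points card.infinite by fastforce

lemma three_equal_coordinates:
  assumes "i \<in> I4" "\<And>k. k \<in> I4 \<Longrightarrow> k \<noteq> i \<Longrightarrow> x \<bullet> v k = s"
  shows "x = (- 3 * s) *\<^sub>R v i"
proof (rule inner_vertices_eqI)
  fix k assume k: "k \<in> I4"
  have "0 = x \<bullet> v i + (\<Sum>k\<in>I4 - {i}. x \<bullet> v k)"
    using sum_inner_vertices[of x] assms(1) by (simp add: sum.remove)
  also have "(\<Sum>k\<in>I4 - {i}. x \<bullet> v k) = (\<Sum>k\<in>I4 - {i}. s)"
    using assms(2) by (intro sum.cong) auto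
  also have "\<dots> = 3 * s"
    using assms(1) by simp
  finally have "x \<bullet> v i = - 3 * s"
    by simp
  then show "x \<bullet> v k = (- 3 * s) *\<^sub>R v i \<bullet> v k"
    using assms k by (cases "k = i") (simp_all add: inner_vertices)
qed

lemma two_equal_pairs_of_coordinates:
  assumes I: "I4 = {i, j, k, l}" "distinct [i, j, k, l]"
    and x: "x \<bullet> v i = x \<bullet> v j" "x \<bullet> v k = x \<bullet> v l"
  shows "x = (sqrt 3 * (x \<bullet> v i)) *\<^sub>R edge i j"
proof (rule inner_vertices_eqI)
  have mem: "i \<in> I4" "j \<in> I4" "k \<in> I4" "l \<in> I4"
    by (auto simp: I(1))
  have "(\<Sum>m\<in>{i, j, k, l}. x \<bullet> v m) = 0"
    using sum_inner_vertices[of x] by (simp only: I(1))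
  then have "x \<bullet> v i + (x \<bullet> v j + (x \<bullet> v k + x \<bullet> v l)) = 0"
    using I(2) by simp
  then have kl: "x \<bullet> v k = - (x \<bullet> v i)" "x \<bullet> v l = - (x \<bullet> v i)"
    using x by simp_all
  fix m assume "m \<in> I4"
  then have "m = i \<or> m = j \<or> m = k \<or> m = l"
    by (simp add: I(1))
  then show "x \<bullet> v m = (sqrt 3 * (x \<bullet> v i)) *\<^sub>R edge i j \<bullet> v m"
    using kl x I(2) mem by (auto simp: inner_edge_vertex)
qed

text \<open>The coordinates \<open>x \<bullet> v i\<close> of a fixed point are constant on the cycles of \<open>p\<close>.  A nontrivial even
  permutation of four letters is a 3-cycle or a product of two disjoint transpositions; in the first case
  three coordinates agree and \<open>x\<close> is proportional to a vertex, in the second they agree in pairs and \<open>x\<close>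
  is proportional to an edge point.\<close>

lemma act_fixed_point:
  assumes p: "p \<in> A4" "p \<noteq> id" and x: "x \<in> riemann_sphere" "act p x = x"
  shows "x \<in> V \<union> F \<union> E"
proof -
  have perm: "p permutes I4" and inj: "inj p" and even: "evenperm p"
    using p by (auto simp: A4_def permutes_inj)
  have coord: "x \<bullet> v (p i) = x \<bullet> v i" if "i \<in> I4" for i
    using inner_act_vertex[OF perm that, of x] x(2) by simp
  obtain i where i: "p i \<noteq> i" "i \<in> I4"
    using p(2) perm by (metis eq_id_iff permutes_not_in)
  define j where "j = p i"
  have j: "j \<in> I4" "j \<noteq> i"
    using i perm by (auto simp: j_def permutes_in_image)
  obtain k l where kl: "k \<noteq> l" "k \<notin> {i, j}" "l \<notin> {i, j}" "I4 = {i, j, k, l}"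
    using I4_other_two[OF i(2) j(1) j(2)[symmetric]] .
  have mem: "k \<in> I4" "l \<in> I4"
    using kl by auto
  show ?thesis
  proof (cases "p j = i")
    case True
    have "p m \<noteq> i" "p m \<noteq> j" if "m \<notin> {i, j}" for m
      using that True injD[OF inj, of m i] injD[OF inj, of m j] by (auto simp: j_def)
    moreover have "p m \<in> {i, j, k, l}" if "m \<in> I4" for m
      using permutes_in_image[OF perm, of m] that kl(4) by blast
    ultimately have pk: "p k \<in> {k, l}" "p l \<in> {k, l}"
      using mem kl(2,3) by blast+
    \<comment> \<open>if \<open>p\<close> fixed \<open>k\<close>, it would be a single transposition\<close>
    have "p k \<noteq> k"
    proof
      assume "p k = k"
      then have "p l = l"
        using pk inj kl(1) by (metis insertE inj_eq singletonD)
      have "p = Transposition.transpose i j"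
      proof
        fix m show "p m = Transposition.transpose i j m"
        proof (cases "m \<in> I4")
          case True
          then show ?thesis
            using kl \<open>p j = i\<close> \<open>p k = k\<close> \<open>p l = l\<close> by (auto simp: j_def[symmetric] Transposition.transpose_def)
        next
          case False
          then show ?thesis
            using i j permutes_not_in[OF perm] by (auto simp: Transposition.transpose_def)
        qed
      qed
      then show False
        using even j by (simp add: evenperm_swap)
    qed
    then have "p k = l"
      using pk by simp
    then have "x \<bullet> v i = x \<bullet> v j" "x \<bullet> v k = x \<bullet> v l"
      using coord i mem by (auto simp: j_def)
    then have eq: "x = (sqrt 3 * (x \<bullet> v i)) *\<^sub>R edge i j"
      using kl j by (intro two_equal_pairs_of_coordinates[OF kl(4)]) auto
    have "norm x = \<bar>sqrt 3 * (x \<bullet> v i)\<bar>"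
      using norm_edge[OF i(2) j(1) j(2)[symmetric]] by (subst eq) simp
    then have "x = edge i j \<or> x = - edge i j"
      using eq x(1) by (auto simp: abs_if split: if_splits)
    then show ?thesis
      using uminus_edge_points[of "edge i j"] i j by (auto simp: edge_points_eq)
  next
    case False
    define m where "m = p j"
    have m: "m \<in> I4" "m \<noteq> i" "m \<noteq> j"
      using False perm j inj by (auto simp: m_def permutes_in_image j_def inj_eq)
    then obtain n where n: "I4 = {i, j, m, n}" "n \<notin> {i, j, m}" "n \<in> I4"
      using kl by auto
    have "x \<bullet> v k = x \<bullet> v i" if "k \<in> I4" "k \<noteq> n" for k
    proof -
      have "x \<bullet> v j = x \<bullet> v i" "x \<bullet> v m = x \<bullet> v j"
        using coord i(2) j(1) by (simp_all add: j_def m_def)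
      moreover have "k = i \<or> k = j \<or> k = m"
        using that n(1) by blast
      ultimately show ?thesis
        by auto
    qed
    then have eq: "x = (- 3 * (x \<bullet> v i)) *\<^sub>R v n"
      by (intro three_equal_coordinates n)
    have "norm x = \<bar>3 * (x \<bullet> v i)\<bar>"
      using norm_vertex[OF n(3)] by (subst eq) simp
    then have "x = v n \<or> x = - v n"
      using eq x(1) by (auto simp: abs_if split: if_splits)
    then show ?thesis
      using vertex_in_V[OF n(3)] by (auto simp: face_points_eq)
  qed
qed

abbreviation orbit :: "real ^ 3 \<Rightarrow> (real ^ 3) set" where
  "orbit \<equiv> tetrahedral_orbit V"

definition orbits :: "(real ^ 3) set set" where
  "orbits = orbit ` riemann_sphere"

definition invariant :: "(real ^ 3) set \<Rightarrow> bool" where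
  "invariant \<alpha> \<longleftrightarrow> (\<forall>p\<in>A4. \<forall>x\<in>\<alpha>. act p x \<in> \<alpha>)"

lemma act_inverse: "p \<in> A4 \<Longrightarrow> act (inv' p) (act p x) = x"
  using act_comp[of "inv' p" p x] permutes_inv_o(2)[of p I4] act_id[of x]
  by (simp add: A4_permutes permutes_inv)

lemma act_in_sphere: "p \<in> A4 \<Longrightarrow> x \<in> riemann_sphere \<Longrightarrow> act p x \<in> riemann_sphere"
  by (simp add: A4_permutes norm_act)

lemma orbit_sphere: "x \<in> riemann_sphere \<Longrightarrow> orbit x \<subseteq> riemann_sphere"
  using act_in_sphere by (auto simp: tetrahedral_orbit_eq)

lemma self_in_orbit: "x \<in> orbit x"
  unfolding tetrahedral_orbit_eq by (rule image_eqI[of _ _ id]) (simp_all add: act_id)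

lemma orbit_eq:
  assumes "y \<in> orbit x"
  shows "orbit y = orbit x"
proof -
  obtain p where p: "p \<in> A4" "y = act p x"
    using assms by (auto simp: tetrahedral_orbit_eq)
  have x: "x = act (inv' p) y"
    using p by (simp add: act_inverse)
  have *: "orbit (act q z) \<subseteq> orbit z" if q: "q \<in> A4" for q z
  proof
    fix w assume "w \<in> orbit (act q z)"
    then obtain r where r: "r \<in> A4" "w = act r (act q z)"
      by (auto simp: tetrahedral_orbit_eq)
    then have "w = act (r \<circ> q) z"
      using q by (simp add: act_comp A4_permutes)
    then show "w \<in> orbit z"
      using A4_comp[OF r(1) q] by (auto simp: tetrahedral_orbit_eq)
  qed
  have "orbit (act (inv' p) y) \<subseteq> orbit y"
    by (rule *[OF A4_inverse[OF p(1)]])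
  then have "orbit x \<subseteq> orbit y"
    unfolding x[symmetric] .
  moreover have "orbit y \<subseteq> orbit x"
    unfolding p(2) by (rule *[OF p(1)])
  ultimately show ?thesis
    by (rule subset_antisym[rotated])
qed

lemma orbit_of_member: "\<omega> \<in> orbits \<Longrightarrow> x \<in> \<omega> \<Longrightarrow> orbit x = \<omega>"
  unfolding orbits_def by (auto dest: orbit_eq)

lemma orbits_disjoint: "\<omega> \<in> orbits \<Longrightarrow> \<omega>' \<in> orbits \<Longrightarrow> \<omega> \<noteq> \<omega>' \<Longrightarrow> \<omega> \<inter> \<omega>' = {}"
  using orbit_of_member by blast

lemma finite_orbit: "finite (orbit x)"
  by (simp add: tetrahedral_orbit_eq)

lemma invariant_orbit_subset: "invariant \<alpha> \<Longrightarrow> x \<in> \<alpha> \<Longrightarrow> orbit x \<subseteq> \<alpha>"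
  by (auto simp: invariant_def tetrahedral_orbit_eq)

lemma act_in_orbit: "p \<in> A4 \<Longrightarrow> act p x \<in> orbit x"
  by (simp add: tetrahedral_orbit_eq)

lemma invariant_Union_orbits:
  assumes "\<O> \<subseteq> orbits"
  shows "invariant (\<Union>\<O>)"
  unfolding invariant_def
proof (intro ballI)
  fix p x assume p: "p \<in> A4" and "x \<in> \<Union>\<O>"
  then obtain \<omega> where \<omega>: "\<omega> \<in> \<O>" "x \<in> \<omega>"
    by blast
  then have "\<omega> = orbit x"
    using assms orbit_of_member by blast
  then show "act p x \<in> \<Union>\<O>"
    using act_in_orbit[OF p] \<omega> by blast
qed

lemma orbit_vertex: "x \<in> V \<Longrightarrow> orbit x = V"
proof -
  assume "x \<in> V"
  then obtain i where i: "i \<in> I4" "x = v i"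
    by (auto simp: V_def)
  show ?thesis
  proof
    show "orbit x \<subseteq> V"
      using i by (auto simp: tetrahedral_orbit_eq A4_permutes act_vertex permutes_in_image vertex_in_V)
    show "V \<subseteq> orbit x"
    proof
      fix y assume "y \<in> V"
      then obtain k where k: "k \<in> I4" "y = v k"
        by (auto simp: V_def)
      obtain j l where "j \<in> I4" "j \<noteq> i" "l \<in> I4" "l \<noteq> k"
        using I4_other_one by meson
      then obtain p where "p \<in> A4" "p i = k"
        using A4_two_transitive[of i j k l] i k by auto
      then show "y \<in> orbit x"
        using i k act_in_orbit[of p x] by (simp add: A4_permutes act_vertex)
    qed
  qed
qed

lemma act_uminus: "act p (- x) = - act p x"
  by (rule linear_neg[OF linear_act])

lemma orbit_uminus: "orbit (- x) = uminus ` orbit x"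
  by (simp add: tetrahedral_orbit_eq act_uminus image_image)

lemma orbit_face_point: "x \<in> F \<Longrightarrow> orbit x = F"
  using orbit_vertex by (auto simp: face_points_eq orbit_uminus)

lemma act_edge: "p permutes I4 \<Longrightarrow> i \<in> I4 \<Longrightarrow> j \<in> I4 \<Longrightarrow> act p (edge i j) = edge (p i) (p j)"
  by (simp add: edge_def linear_scale[OF linear_act] linear_add[OF linear_act] act_vertex)

lemma act_edge_points: "p permutes I4 \<Longrightarrow> x \<in> E \<Longrightarrow> act p x \<in> E"
proof -
  assume p: "p permutes I4" and "x \<in> E"
  then obtain i j where "i \<in> I4" "j \<in> I4" "i \<noteq> j" "x = edge i j"
    by (auto simp: edge_points_eq)
  then show ?thesis
    using p permutes_in_image[OF p] inj_eq[OF permutes_inj[OF p]] by (simp add: act_edge edge_in_edge_points)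
qed

lemma orbit_edge_point: "x \<in> E \<Longrightarrow> orbit x = E"
proof -
  assume x: "x \<in> E"
  then obtain i j where i: "i \<in> I4" "j \<in> I4" "i \<noteq> j" "x = edge i j"
    by (auto simp: edge_points_eq)
  show ?thesis
  proof
    show "orbit x \<subseteq> E"
      using x by (auto simp: tetrahedral_orbit_eq A4_permutes act_edge_points)
    show "E \<subseteq> orbit x"
    proof
      fix y assume "y \<in> E"
      then obtain k l where k: "k \<in> I4" "l \<in> I4" "k \<noteq> l" "y = edge k l"
        by (auto simp: edge_points_eq)
      then obtain p where "p \<in> A4" "p i = k" "p j = l"
        using A4_two_transitive[of i j k l] i by auto
      then show "y \<in> orbit x"
        using i k act_in_orbit[of p x] by (simp add: A4_permutes act_edge)
    qed
  qed
qed

lemma inj_on_act_generic: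
  assumes "x \<in> riemann_sphere" "x \<notin> V \<union> F \<union> E"
  shows "inj_on (\<lambda>p. act p x) A4"
proof (rule inj_onI)
  fix p q assume p: "p \<in> A4" and q: "q \<in> A4" and eq: "act p x = act q x"
  have "act (inv' q \<circ> p) x = x"
    using act_inverse[OF q, of x] eq p q by (simp add: act_comp A4_permutes permutes_inv)
  then have "inv' q \<circ> p = id"
    using act_fixed_point[of "inv' q \<circ> p" x] assms A4_comp[OF A4_inverse[OF q] p] by blast
  then have "q \<circ> (inv' q \<circ> p) = q"
    by simp
  then show "p = q"
    using permutes_inv_o(1)[OF A4_permutes[OF q]] by (simp add: o_assoc)
qed

lemma card_generic_orbit:
  assumes "\<omega> \<in> generic_orbits V"
  shows "card \<omega> = 12"
proof -
  obtain x where x: "x \<in> riemann_sphere" "x \<notin> V \<union> F \<union> E" "\<omega> = orbit x"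
    using assms unfolding generic_orbits_def by blast
  show ?thesis
    using inj_on_act_generic[OF x(1,2)] by (simp add: x(3) tetrahedral_orbit_eq card_image card_A4)
qed

lemma V_orbit: "V \<in> orbits" and face_points_orbit: "F \<in> orbits"
  and edge_points_orbit: "E \<in> orbits"
proof -
  have *: "A \<in> orbits" if "card A \<noteq> 0" "A \<subseteq> riemann_sphere" "\<And>x. x \<in> A \<Longrightarrow> orbit x = A" for A
  proof -
    obtain x where "x \<in> A"
      using \<open>card A \<noteq> 0\<close> by fastforce
    then show ?thesis
      using that(2,3) unfolding orbits_def by (metis image_eqI subsetD)
  qed
  show "V \<in> orbits"
    using card_V V_sphere orbit_vertex by (intro *) auto
  show "F \<in> orbits"
    using card_face_points face_points_sphere orbit_face_point by (intro *) auto
  show "E \<in> orbits"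
    using card_edge_points edge_points_sphere orbit_edge_point by (intro *) auto
qed

lemma generic_orbits_subset: "generic_orbits V \<subseteq> orbits"
  by (auto simp: generic_orbits_def orbits_def)

lemma orbits_eq: "orbits = {V, F} \<union> {E} \<union> generic_orbits V"
proof
  show "orbits \<subseteq> {V, F} \<union> {E} \<union> generic_orbits V"
  proof
    fix \<omega> assume "\<omega> \<in> orbits"
    then obtain x where x: "x \<in> riemann_sphere" "\<omega> = orbit x"
      by (auto simp: orbits_def)
    show "\<omega> \<in> {V, F} \<union> {E} \<union> generic_orbits V"
    proof (cases "x \<in> V \<union> F \<union> E")
      case True
      then show ?thesis
        using x orbit_vertex orbit_face_point orbit_edge_point by auto
    next
      case False
      then show ?thesis
        using x by (auto simp: generic_orbits_def)
    qed
  qed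
  show "{V, F} \<union> {E} \<union> generic_orbits V \<subseteq> orbits"
    using V_orbit face_points_orbit edge_points_orbit generic_orbits_subset by auto
qed

lemma orbit_types_distinct: "V \<noteq> F" "V \<noteq> E" "F \<noteq> E"
    "V \<notin> generic_orbits V" "F \<notin> generic_orbits V" "E \<notin> generic_orbits V"
  using special_points_disjoint card_V card_face_points card_edge_points card_generic_orbit by fastforce+

text \<open>Orbits partition the sphere, so the orbits contained in a union of orbits are its members.  This turns
  component indices into cardinalities of finite families.\<close>

lemma orbit_subset_Union_iff:
  assumes "\<omega> \<in> orbits" "\<O> \<subseteq> orbits"
  shows "\<omega> \<subseteq> \<Union>\<O> \<longleftrightarrow> \<omega> \<in> \<O>"
proof
  assume "\<omega> \<subseteq> \<Union>\<O>"
  moreover obtain x where "x \<in> \<omega>"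
    using assms(1) self_in_orbit by (auto simp: orbits_def)
  ultimately obtain \<omega>' where "\<omega>' \<in> \<O>" "x \<in> \<omega>'"
    by blast
  then show "\<omega> \<in> \<O>"
    using orbits_disjoint[of \<omega> \<omega>'] assms \<open>x \<in> \<omega>\<close> by blast
qed auto

lemma component_index_Union:
  assumes "\<O> \<subseteq> orbits"
  shows "component_index V (\<Union>\<O>)
    = (card (\<O> \<inter> {V, F}), card (\<O> \<inter> {E}), card (\<O> \<inter> generic_orbits V))"
proof -
  have *: "{\<omega> \<in> \<T>. \<omega> \<subseteq> \<Union>\<O>} = \<O> \<inter> \<T>" if "\<T> \<subseteq> orbits" for \<T>
    using orbit_subset_Union_iff assms that by blast
  show ?thesis
    using *[of "{V, F}"] *[of "{E}"] *[OF generic_orbits_subset]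
      V_orbit face_points_orbit edge_points_orbit
    unfolding component_index_def by (simp only: insert_subset empty_subsetI simp_thms)
qed

lemma card_Union_orbits:
  assumes "\<O> \<subseteq> orbits" "finite \<O>"
  shows "card (\<Union>\<O>)
    = 4 * card (\<O> \<inter> {V, F}) + 6 * card (\<O> \<inter> {E}) + 12 * card (\<O> \<inter> generic_orbits V)"
proof -
  have "card (\<Union>\<O>) = (\<Sum>\<omega>\<in>\<O>. card \<omega>)"
    using assms orbits_disjoint finite_orbit
    by (intro card_Union_disjoint) (auto simp: pairwise_def disjnt_def orbits_def subset_iff image_iff)
  also have "\<dots> = (\<Sum>\<omega>\<in>\<O> \<inter> {V, F} \<union> \<O> \<inter> {E} \<union> \<O> \<inter> generic_orbits V. card \<omega>)"
    using assms(1) orbits_eq by (intro sum.cong) blast+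
  also have "\<dots> = (\<Sum>\<omega>\<in>\<O> \<inter> {V, F}. card \<omega>)
      + (\<Sum>\<omega>\<in>\<O> \<inter> {E}. card \<omega>) + (\<Sum>\<omega>\<in>\<O> \<inter> generic_orbits V. card \<omega>)"
  proof -
    have "\<O> \<inter> {V, F} \<inter> (\<O> \<inter> {E}) = {}"
      "(\<O> \<inter> {V, F} \<union> \<O> \<inter> {E}) \<inter> (\<O> \<inter> generic_orbits V) = {}"
      using orbit_types_distinct by blast+
    then show ?thesis
      using assms(2) by (simp only: sum.union_disjoint finite_Un finite_Int simp_thms)
  qed
  also have "(\<Sum>\<omega>\<in>\<O> \<inter> {V, F}. card \<omega>) = (\<Sum>\<omega>\<in>\<O> \<inter> {V, F}. 4)"
    using card_V card_face_points by (intro sum.cong) auto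
  also have "(\<Sum>\<omega>\<in>\<O> \<inter> {E}. card \<omega>) = (\<Sum>\<omega>\<in>\<O> \<inter> {E}. 6)"
    using card_edge_points by (intro sum.cong) auto
  also have "(\<Sum>\<omega>\<in>\<O> \<inter> generic_orbits V. card \<omega>) = (\<Sum>\<omega>\<in>\<O> \<inter> generic_orbits V. 12)"
    using card_generic_orbit by (intro sum.cong) auto
  finally show ?thesis
    by simp
qed

lemma finite_union_of_orbits_iff:
  "finite_union_of_orbits V \<alpha> \<longleftrightarrow> (\<exists>\<O>. finite \<O> \<and> \<O> \<subseteq> orbits \<and> \<alpha> = \<Union>\<O>)"
  by (simp add: finite_union_of_orbits_def orbits_def)

lemma invariant_imp_finite_union_of_orbits:
  assumes "finite \<alpha>" "\<alpha> \<subseteq> riemann_sphere" "invariant \<alpha>"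
  shows "finite_union_of_orbits V \<alpha>"
  unfolding finite_union_of_orbits_iff
proof (intro exI conjI)
  show "\<alpha> = \<Union>(orbit ` \<alpha>)"
    using assms invariant_orbit_subset self_in_orbit by blast
qed (use assms in \<open>auto simp: orbits_def\<close>)

lemma Union_orbits_finite_sphere:
  assumes "finite \<O>" "\<O> \<subseteq> orbits"
  shows "finite (\<Union>\<O>)" "\<Union>\<O> \<subseteq> riemann_sphere"
proof -
  have "finite \<omega> \<and> \<omega> \<subseteq> riemann_sphere" if "\<omega> \<in> \<O>" for \<omega>
    using that assms(2) finite_orbit orbit_sphere unfolding orbits_def by blast
  then show "finite (\<Union>\<O>)" "\<Union>\<O> \<subseteq> riemann_sphere"
    using assms(1) by blast+
qed

section \<open>Stabilizers of invariant sets\<close>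

abbreviation mrot :: "(nat \<Rightarrow> nat) \<Rightarrow> real ^ 3 \<Rightarrow> real ^ 3" where
  "mrot p \<equiv> restrict (rot p) riemann_sphere"

lemma mrot_moebius: "p permutes I4 \<Longrightarrow> mrot p \<in> moebius_transformations"
  using rot_moebius_and_det by blast

lemma rot_A4: "p \<in> A4 \<Longrightarrow> rot p = act p"
  by (simp add: A4_def rot_def[abs_def])

lemma act_inverse': "p \<in> A4 \<Longrightarrow> act p (act (inv' p) x) = x"
  using act_comp[of p "inv' p" x] permutes_inv_o(1)[of p I4] act_id[of x]
  by (simp add: A4_permutes permutes_inv)

lemma inj_act: "p permutes I4 \<Longrightarrow> inj (act p)"
  by (simp add: orthogonal_transformation_inj orthogonal_transformation_act)

lemma act_image:
  assumes "invariant \<alpha>" "p \<in> A4"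
  shows "act p ` \<alpha> = \<alpha>"
proof
  show "act p ` \<alpha> \<subseteq> \<alpha>"
    using assms by (auto simp: invariant_def)
  show "\<alpha> \<subseteq> act p ` \<alpha>"
  proof
    fix x assume "x \<in> \<alpha>"
    then have "act (inv' p) x \<in> \<alpha>"
      using assms A4_inverse by (simp add: invariant_def)
    then show "x \<in> act p ` \<alpha>"
      using act_inverse'[OF assms(2), of x] by (metis imageI)
  qed
qed

lemma invariant_V: "invariant V"
  using invariant_Union_orbits[of "{V}"] V_orbit by simp

lemma act_sum:
  assumes "p permutes I4" "act p ` \<alpha> = \<alpha>"
  shows "act p (\<Sum>x\<in>\<alpha>. x) = (\<Sum>x\<in>\<alpha>. x)"
proof -
  have "act p (\<Sum>x\<in>\<alpha>. x) = (\<Sum>x\<in>\<alpha>. act p x)"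
    by (rule linear_sum[OF linear_act])
  also have "\<dots> = (\<Sum>x\<in>act p ` \<alpha>. x)"
    using inj_act[OF assms(1)] by (subst sum.reindex) (auto intro: inj_on_subset)
  finally show ?thesis
    using assms(2) by simp
qed

text \<open>The sum is a fixed vector of the group, hence has equal coordinates; these add up to \<open>0\<close>.\<close>

lemma sum_invariant:
  assumes "invariant \<alpha>"
  shows "(\<Sum>x\<in>\<alpha>. x) = 0"
proof (rule orthogonal_vertices_imp_0)
  let ?w = "\<Sum>x\<in>\<alpha>. x"
  have eq: "?w \<bullet> v j = ?w \<bullet> v i" if ij: "i \<in> I4" "j \<in> I4" for i j
  proof -
    obtain k l where "k \<in> I4" "k \<noteq> i" "l \<in> I4" "l \<noteq> j"
      using I4_other_one by meson
    then obtain p where p: "p \<in> A4" "p i = j"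
      using A4_two_transitive[of i k j l] ij by metis
    then show ?thesis
      using inner_act_vertex[OF A4_permutes ij(1), of p ?w]
        act_sum[OF A4_permutes act_image[OF assms], of p] by simp
  qed
  fix i assume i: "i \<in> I4"
  have "(\<Sum>j\<in>I4. ?w \<bullet> v j) = (\<Sum>j\<in>I4. ?w \<bullet> v i)"
    by (rule sum.cong[OF refl]) (rule eq[OF i])
  then show "?w \<bullet> v i = 0"
    by (simp only: sum_inner_vertices sum_constant) simp
qed

lemma image_restrict_sphere:
  "\<alpha> \<subseteq> riemann_sphere \<Longrightarrow> restrict g riemann_sphere ` \<alpha> = g ` \<alpha>"
  by (rule image_cong) auto

lemma mrot_stabilizes_invariant:
  assumes "\<alpha> \<subseteq> riemann_sphere" "invariant \<alpha>" "p \<in> A4"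
  shows "mrot p \<in> moebius_stabilizer \<alpha>"
proof -
  have "mrot p ` \<alpha> = \<alpha>"
    using image_restrict_sphere[OF assms(1), of "rot p"] act_image[OF assms(2,3)]
    by (simp only: rot_A4[OF assms(3)])
  then show ?thesis
    using mrot_moebius[OF A4_permutes[OF assms(3)]] by blast
qed

text \<open>By rigidity an element of the stabilizer is some \<open>act p\<close>.  If \<open>p\<close> were odd, composing with the rotation
  \<open>rot (inv p) = - act (inv p)\<close> would give the antipodal map.\<close>

theorem moebius_stabilizer_V: "moebius_stabilizer V = mrot ` A4"
proof
  show "mrot ` A4 \<subseteq> moebius_stabilizer V"
    using mrot_stabilizes_invariant[OF V_sphere invariant_V] by blast
  show "moebius_stabilizer V \<subseteq> mrot ` A4"
  proof
    fix f assume "f \<in> moebius_stabilizer V"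
    then have f: "f \<in> moebius_transformations" "f ` V = V"
      by auto
    obtain g where g: "orthogonal_transformation g" "f = restrict g riemann_sphere"
      using balanced_moebius_orthogonal[OF f finite_V V_sphere sum_invariant[OF invariant_V]] card_V by auto
    then have "g ` V \<subseteq> V"
      using f(2) image_restrict_sphere[OF V_sphere, of g] by (simp only:)
    then obtain p where p: "p permutes I4" "g = act p"
      using orthogonal_vertex_permutation[OF g(1)] by blast
    have "evenperm p"
    proof (rule ccontr)
      assume odd: "\<not> evenperm p"
      have q: "inv' p permutes I4" "\<not> evenperm (inv' p)"
        using odd p(1) by (simp_all add: permutes_inv evenperm_inv permutes_permutation)
      have "rot (inv' p) (act p x) = - x" for x
        using act_comp[OF q(1) p(1), of x] permutes_inv_o(2)[OF p(1)] q(2) act_id[of x] by (simp add: rot_def)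
      then have "compose riemann_sphere (mrot (inv' p)) f = (\<lambda>x\<in>riemann_sphere. - x)"
        using g p by (auto simp: compose_def fun_eq_iff norm_act)
      then show False
        using moebius_compose[OF mrot_moebius[OF q(1)] f(1)] antipodal_not_moebius by simp
    qed
    then have "p \<in> A4"
      using p(1) by (simp add: A4_def)
    then show "f \<in> mrot ` A4"
      using g p rot_A4 by auto
  qed
qed

lemma vertex_not_opposite: "i \<in> I4 \<Longrightarrow> j \<in> I4 \<Longrightarrow> v i \<noteq> - v j"
  using special_points_disjoint(1) vertex_in_V[of i] vertex_in_V[of j] by (auto simp: face_points_eq)

lemma inj_on_mrot: "inj_on mrot {p. p permutes I4}"
proof (rule inj_onI)
  fix p q assume "p \<in> {p. p permutes I4}" "q \<in> {p. p permutes I4}" and eq: "mrot p = mrot q"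
  then have p: "p permutes I4" and q: "q permutes I4"
    by auto
  have "p i = q i" for i
  proof (cases "i \<in> I4")
    case True
    then have "p i \<in> I4" "q i \<in> I4"
      using p q by (simp_all add: permutes_in_image)
    moreover have "rot p (v i) = rot q (v i)"
      using fun_cong[OF eq, of "v i"] True by (simp add: norm_vertex)
    then have "v (p i) = v (q i) \<or> v (p i) = - v (q i)"
      using True p q by (auto simp: rot_def act_vertex eq_neg_iff_add_eq_0 neg_eq_iff_add_eq_0 add.commute split: if_splits)
    ultimately show ?thesis
      using vertex_not_opposite inj_on_vertices by (auto simp: inj_on_eq_iff)
  next
    case False
    then show ?thesis
      using p q by (simp add: permutes_not_in)
  qed
  then show "p = q" ..
qed

lemma stabilizer_eq_imp_alt_group:
  assumes "moebius_stabilizer \<alpha> = mrot ` A4"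
  shows "moebius_group_of \<alpha> \<cong> alt_group 4"
proof (rule group.iso_sym[OF alt_group_is_group], rule is_isoI, rule isoI)
  have comp: "mrot (p \<circ> q) = mrot p \<otimes>\<^bsub>moebius_group_of \<alpha>\<^esub> mrot q" if pq: "p \<in> A4" "q \<in> A4" for p q
  proof -
    have "mrot (p \<circ> q) = compose riemann_sphere (mrot p) (mrot q)"
      using pq A4_comp[OF pq] by (auto simp: fun_eq_iff compose_def rot_A4 act_comp A4_permutes norm_act)
    also have "\<dots> = mrot p \<otimes>\<^bsub>moebius_group_of \<alpha>\<^esub> mrot q"
      using moebius_mult[OF mrot_moebius mrot_moebius, of p q] pq
      by (simp add: moebius_group_of_def A4_permutes)
    finally show ?thesis .
  qed
  show "mrot \<in> hom (alt_group 4) (moebius_group_of \<alpha>)"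
  proof (rule homI)
    show "mrot p \<in> carrier (moebius_group_of \<alpha>)" if "p \<in> carrier (alt_group 4)" for p
      using that assms by (simp add: moebius_group_of_def carrier_alt_group_4)
    show "mrot (p \<otimes>\<^bsub>alt_group 4\<^esub> q) = mrot p \<otimes>\<^bsub>moebius_group_of \<alpha>\<^esub> mrot q"
      if "p \<in> carrier (alt_group 4)" "q \<in> carrier (alt_group 4)" for p q
      using that comp by (simp add: alt_group_mult carrier_alt_group_4)
  qed
  have "inj_on mrot A4"
    using inj_on_mrot by (rule inj_on_subset) (auto simp: A4_permutes)
  then show "bij_betw mrot (carrier (alt_group 4)) (carrier (moebius_group_of \<alpha>))"
    using assms by (simp add: bij_betw_def moebius_group_of_def carrier_alt_group_4)
qed

text \<open>For invariant sets only orthogonal symmetries matter, and it suffices that they preserve the vertices.\<close>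

theorem A4_set_criterion:
  assumes \<alpha>: "finite \<alpha>" "\<alpha> \<subseteq> riemann_sphere" "invariant \<alpha>" "card \<alpha> \<ge> 3"
    and V: "\<And>g. orthogonal_transformation g \<Longrightarrow> g ` \<alpha> = \<alpha> \<Longrightarrow> g ` V \<subseteq> V"
  shows "A4_set \<alpha>"
proof -
  have "moebius_stabilizer \<alpha> \<subseteq> moebius_stabilizer V"
  proof
    fix f assume "f \<in> moebius_stabilizer \<alpha>"
    then have f: "f \<in> moebius_transformations" "f ` \<alpha> = \<alpha>"
      by auto
    obtain g where g: "orthogonal_transformation g" "f = restrict g riemann_sphere"
      using balanced_moebius_orthogonal[OF f \<alpha>(1,2) sum_invariant[OF \<alpha>(3)] \<alpha>(4)] by auto
    then have "g ` \<alpha> = \<alpha>"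
      using f(2) image_restrict_sphere[OF \<alpha>(2), of g] by (simp only:)
    then have "g ` V \<subseteq> V"
      by (rule V[OF g(1)])
    moreover have "inj_on g V"
      using orthogonal_transformation_inj[OF g(1)] by (rule inj_on_subset) simp
    ultimately have "g ` V = V"
      by (intro endo_inj_surj finite_V)
    then have "f ` V = V"
      by (simp only: g(2) image_restrict_sphere[OF V_sphere])
    then show "f \<in> moebius_stabilizer V"
      using f(1) by blast
  qed
  moreover have "mrot ` A4 \<subseteq> moebius_stabilizer \<alpha>"
    using mrot_stabilizes_invariant[OF \<alpha>(2,3)] by blast
  ultimately have "moebius_stabilizer \<alpha> = mrot ` A4"
    unfolding moebius_stabilizer_V by (rule subset_antisym)
  then show ?thesis
    unfolding A4_set_def by (intro conjI \<alpha>(1,2) stabilizer_eq_imp_alt_group)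
qed

text \<open>Negation exchanges \<open>V\<close> with the face points and preserves the edge points, so all 24 maps \<open>rot p\<close>
  preserve such a union.\<close>

lemma octahedral_not_order_12:
  assumes \<O>: "\<O> \<subseteq> {V, F, E}" "V \<in> \<O> \<longleftrightarrow> F \<in> \<O>"
  shows "card (moebius_stabilizer (\<Union>\<O>)) \<noteq> 12"
proof
  let ?S = "{p. p permutes I4}"
  assume card: "card (moebius_stabilizer (\<Union>\<O>)) = 12"
  have "finite (\<Union>\<O>)"
    using \<O>(1) by (auto intro!: finite_Union finite_subset[OF \<O>(1)])
  have sphere: "\<Union>\<O> \<subseteq> riemann_sphere"
    using \<O>(1) V_sphere face_points_sphere edge_points_sphere by blast
  have "mrot p \<in> moebius_stabilizer (\<Union>\<O>)" if p: "p permutes I4" for p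
  proof -
    have V: "act p x \<in> V" if "x \<in> V" for x
      using act_V[OF p] that by blast
    have "rot p x \<in> \<Union>\<O>" if x: "x \<in> \<Union>\<O>" for x
    proof -
      consider "x \<in> V" "V \<in> \<O>" | "x \<in> F" "F \<in> \<O>"
        | "x \<in> E" "E \<in> \<O>"
        using x \<O>(1) by blast
      then show ?thesis
      proof cases
        case 1
        then have "act p x \<in> V" "- act p x \<in> F"
          using V by (auto simp: face_points_eq)
        then show ?thesis
          using 1 \<O>(2) by (auto simp: rot_def)
      next
        case 2
        then obtain y where "y \<in> V" "x = - y"
          by (auto simp: face_points_eq)
        then have "act p x \<in> F" "- act p x \<in> V"
          using V by (auto simp: face_points_eq act_uminus)
        then show ?thesis
          using 2 \<O>(2) by (auto simp: rot_def)
      next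
        case 3
        then have "act p x \<in> E" "- act p x \<in> E"
          using act_edge_points[OF p] uminus_edge_points by auto
        then show ?thesis
          using 3 by (auto simp: rot_def)
      qed
    qed
    then have "rot p ` \<Union>\<O> \<subseteq> \<Union>\<O>"
      by blast
    moreover have "inj_on (rot p) (\<Union>\<O>)"
      using inj_act[OF p] by (auto simp: rot_def inj_on_def)
    ultimately have "rot p ` \<Union>\<O> = \<Union>\<O>"
      by (rule endo_inj_surj[OF \<open>finite (\<Union>\<O>)\<close>])
    then have "mrot p ` \<Union>\<O> = \<Union>\<O>"
      by (simp only: image_restrict_sphere[OF sphere])
    then show ?thesis
      using mrot_moebius[OF p] by blast
  qed
  then have "mrot ` ?S \<subseteq> moebius_stabilizer (\<Union>\<O>)"
    by blast
  moreover have "finite (moebius_stabilizer (\<Union>\<O>))"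
    by (rule card_ge_0_finite) (simp only: card)
  ultimately have "card (mrot ` ?S) \<le> 12"
    using card_mono card by fastforce
  moreover have "card (mrot ` ?S) = 24"
    using card_permutations[OF card_I4 finite_I4] by (simp add: card_image[OF inj_on_mrot] fact_numeral)
  ultimately show False
    by simp
qed

end

lemma A4_set_card_stabilizer:
  assumes "A4_set \<alpha>"
  shows "card (moebius_stabilizer \<alpha>) = 12"
proof -
  obtain h where "bij_betw h (carrier (moebius_group_of \<alpha>)) (carrier (alt_group 4))"
    using assms by (auto simp: A4_set_def is_iso_def iso_def)
  then show ?thesis
    using bij_betw_same_card card_A4 by (fastforce simp: moebius_group_of_def carrier_alt_group_4)
qed

section \<open>Sets of prescribed component index\<close>

lemma finite_set_separation:
  fixes P :: "'a :: metric_space set"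
  assumes "finite P"
  obtains e where "e > 0" "\<And>x y. x \<in> P \<Longrightarrow> y \<in> P \<Longrightarrow> x \<noteq> y \<Longrightarrow> e \<le> dist x y"
proof -
  define D where "D = insert 1 ((\<lambda>(x, y). dist x y) ` {z \<in> P \<times> P. fst z \<noteq> snd z})"
  have D: "finite D" "D \<noteq> {}"
    using assms by (auto simp: D_def)
  have "\<forall>d\<in>D. d > 0"
    by (auto simp: D_def)
  then have "Min D > 0"
    using Min_in[OF D] by blast
  moreover have "Min D \<le> dist x y" if "x \<in> P" "y \<in> P" "x \<noteq> y" for x y
    using D(1) that by (intro Min_le) (force simp: D_def)+
  ultimately show ?thesis
    using that by blast
qed

lemma sphere_islimpt: "x \<in> riemann_sphere \<Longrightarrow> x islimpt riemann_sphere"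
proof (rule connected_imp_perfect)
  show "connected riemann_sphere"
    by (rule connected_sphere) simp
  fix y :: "real ^ 3"
  assume x: "x \<in> riemann_sphere"
  show "riemann_sphere \<noteq> {y}"
  proof
    assume eq: "riemann_sphere = {y}"
    have "x \<in> {y}" "- x \<in> {y}"
      unfolding eq[symmetric] using x by simp_all
    then have "x = y" "- x = y"
      by blast+
    then have "(- x) \<bullet> x = x \<bullet> x"
      by (simp only:)
    then have "x \<bullet> x = 0"
      unfolding inner_minus_left by linarith
    then show False
      using x by simp
  qed
qed

context tetrahedron
begin

lemma dist_act: "p permutes I4 \<Longrightarrow> dist (act p x) (act p y) = dist x y"
  using norm_act[of p "x - y"] by (simp add: dist_norm linear_diff[OF linear_act])

text \<open>The new orbit consists of three points near each vertex.  Take as cluster of \<open>x\<close> the points of the set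
  within \<open>2 r\<close> of \<open>x\<close>.  When \<open>r\<close> is small compared with the distances between the old points and the
  vertices, the clusters with more than one point are exactly those around the vertices, and by symmetry
  each of them has its centre of gravity in the direction of its vertex.  Isometries permute the clusters
  and therefore the vertices.\<close>

theorem generic_orbit_near_vertex:
  assumes "finite \<O>" "\<O> \<subseteq> orbits"
  obtains \<omega> where "\<omega> \<in> generic_orbits V" "\<omega> \<notin> \<O>" "A4_set (\<Union>(insert \<omega> \<O>))"
proof -
  define P where "P = \<Union>\<O> \<union> V"
  have P: "finite P" "P \<subseteq> riemann_sphere"
    using Union_orbits_finite_sphere[OF assms] V_sphere by (auto simp: P_def)
  obtain e where e: "e > 0" "\<And>x y. x \<in> P \<Longrightarrow> y \<in> P \<Longrightarrow> x \<noteq> y \<Longrightarrow> e \<le> dist x y"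
    using finite_set_separation[OF P(1)] by blast
  \<comment> \<open>the factor 4 allows for the four steps of length \<open>r\<close> in the triangle inequalities below; \<open>r \<le> 1\<close> makes inner products with the near vertex positive\<close>
  define r where "r = min 1 (e / 4)"
  have r: "r > 0" "r \<le> 1" "4 * r \<le> e"
    using e(1) by (auto simp: r_def)
  have one: "1 \<in> I4"
    by (simp add: I4_def)
  have "infinite (riemann_sphere \<inter> ball (v 1) r)"
    using sphere_islimpt[of "v 1"] norm_vertex[OF one] r(1) by (simp add: islimpt_eq_infinite_ball)
  then have "infinite (riemann_sphere \<inter> ball (v 1) r - (\<Union>\<O> \<union> (V \<union> F \<union> E)))"
    using P(1) by (intro Diff_infinite_finite) (auto simp: P_def)
  then obtain X where "X \<in> riemann_sphere \<inter> ball (v 1) r - (\<Union>\<O> \<union> (V \<union> F \<union> E))"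
    using infinite_imp_nonempty by blast
  then have X: "X \<in> riemann_sphere" "dist (v 1) X < r" "X \<notin> \<Union>\<O>" "X \<notin> V \<union> F \<union> E"
    by auto
  define \<omega> where "\<omega> = orbit X"
  define \<alpha> where "\<alpha> = \<Union>(insert \<omega> \<O>)"
  have \<omega>_generic: "\<omega> \<in> generic_orbits V"
    unfolding generic_orbits_def \<omega>_def using X by blast
  have \<omega>_new: "\<omega> \<notin> \<O>"
    using X(3) self_in_orbit[of X] by (auto simp: \<omega>_def)
  have orbits: "insert \<omega> \<O> \<subseteq> orbits" "finite (insert \<omega> \<O>)"
    using \<omega>_generic generic_orbits_subset assms by auto
  have \<alpha>: "finite \<alpha>" "\<alpha> \<subseteq> riemann_sphere" "invariant \<alpha>"
    unfolding \<alpha>_def using Union_orbits_finite_sphere[OF orbits(2,1)] invariant_Union_orbits[OF orbits(1)] by blast+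
  have "\<omega> \<subseteq> \<alpha>"
    by (simp add: \<alpha>_def)
  then have card_\<alpha>: "card \<alpha> \<ge> 3"
    using card_mono[OF \<alpha>(1), of \<omega>] card_generic_orbit[OF \<omega>_generic] by linarith
  have near: "\<exists>i\<in>I4. dist y (v i) < r" if y: "y \<in> \<omega>" for y
  proof -
    obtain p where p: "p \<in> A4" "y = act p X"
      using y by (auto simp: \<omega>_def tetrahedral_orbit_eq)
    then have "dist y (v (p 1)) < r"
      using dist_act[OF A4_permutes, of p X "v 1"] X(2) act_vertex[OF A4_permutes one, of p]
      by (simp add: dist_commute)
    moreover have "p 1 \<in> I4"
      using permutes_in_image[OF A4_permutes[OF p(1)]] one by blast
    ultimately show ?thesis
      by blast
  qed
  have separated: "u = w" if "u \<in> P" "w \<in> P" "dist u w < 4 * r" for u w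
    using e(2)[OF that(1,2)] that(3) r(3) by fastforce
  have vP: "v i \<in> P" if "i \<in> I4" for i
    using vertex_in_V[OF that] by (simp add: P_def)
  \<comment> \<open>\<open>cluster\<close> is defined by distances within \<open>\<alpha>\<close> only, hence respected by isometries; \<open>C i\<close> is the part of \<open>\<alpha>\<close> near the vertex \<open>v i\<close>\<close>
  define cluster where "cluster x = {y \<in> \<alpha>. dist x y < 2 * r}" for x
  define C where "C i = {y \<in> \<alpha>. dist y (v i) < r}" for i
  have cluster_near: "cluster x = C i" if x: "x \<in> C i" and i: "i \<in> I4" for x i
  proof
    show "C i \<subseteq> cluster x"
    proof
      fix y assume y: "y \<in> C i"
      have "dist x y \<le> dist x (v i) + dist y (v i)"
        by (rule dist_triangle2)
      then show "y \<in> cluster x"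
        using x y by (auto simp: C_def cluster_def)
    qed
    show "cluster x \<subseteq> C i"
    proof
      fix y assume y: "y \<in> cluster x"
      have y_i: "dist y (v i) < 3 * r"
        using x y dist_triangle[of y "v i" x] by (auto simp: C_def cluster_def dist_commute)
      show "y \<in> C i"
      proof (cases "y \<in> \<omega>")
        case True
        then obtain j where j: "j \<in> I4" "dist y (v j) < r"
          using near by blast
        then have "dist (v j) (v i) < 4 * r"
          using y_i dist_triangle[of "v j" "v i" y] by (simp add: dist_commute)
        then have "v j = v i"
          using separated vP i j by blast
        then show ?thesis
          using j y by (simp add: C_def cluster_def)
      next
        case False
        then have "y \<in> P"
          using y by (auto simp: cluster_def \<alpha>_def P_def)
        then have "y = v i"
          using separated[of y "v i"] vP[OF i] y_i r(1) by simp
        then show ?thesis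
          using y r(1) by (simp add: C_def cluster_def)
      qed
    qed
  qed
  have cluster_far: "cluster x = {x}" if x: "x \<in> \<alpha>" "\<And>i. i \<in> I4 \<Longrightarrow> x \<notin> C i" for x
  proof
    show "{x} \<subseteq> cluster x"
      using x(1) r(1) by (simp add: cluster_def)
    show "cluster x \<subseteq> {x}"
    proof
      fix y assume y: "y \<in> cluster x"
      have "x \<notin> \<omega>"
        using near x by (auto simp: C_def)
      then have xP: "x \<in> P"
        using x(1) by (auto simp: \<alpha>_def P_def)
      show "y \<in> {x}"
      proof (cases "y \<in> \<omega>")
        case True
        then obtain j where j: "j \<in> I4" "dist y (v j) < r"
          using near by blast
        then have "dist x (v j) < 4 * r"
          using y dist_triangle[of x "v j" y] r(1) by (simp add: cluster_def)
        then have "x = v j"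
          using separated xP vP[OF j(1)] by blast
        then show ?thesis
          using x(1) x(2)[OF j(1)] r(1) by (simp add: C_def)
      next
        case False
        then have "y \<in> P"
          using y by (auto simp: cluster_def \<alpha>_def P_def)
        then show ?thesis
          using separated[OF xP, of y] y r(1) by (simp add: cluster_def)
      qed
    qed
  qed
  have finite_C: "finite (C i)" for i
    using \<alpha>(1) by (simp add: C_def)
  \<comment> \<open>two elements of the group that map the first vertex to \<open>v i\<close> but differ elsewhere give two points\<close>
  have card_C: "card (C i) \<ge> 2" if i: "i \<in> I4" for i
  proof -
    obtain a where a: "a \<in> I4" "a \<noteq> 1"
      using I4_other_one by blast
    obtain j where j: "j \<in> I4" "j \<noteq> i"
      using I4_other_one by blast
    obtain k l where kl: "k \<noteq> l" "k \<notin> {i, j}" "l \<notin> {i, j}" "I4 = {i, j, k, l}"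
      using I4_other_two[OF i j(1) j(2)[symmetric]] .
    have mem: "k \<in> I4" "l \<in> I4"
      by (simp_all add: kl(4))
    obtain p where p: "p \<in> A4" "p 1 = i" "p a = k"
      using A4_two_transitive[OF one a(1) a(2)[symmetric] i mem(1)] kl(2) by blast
    obtain q where q: "q \<in> A4" "q 1 = i" "q a = l"
      using A4_two_transitive[OF one a(1) a(2)[symmetric] i mem(2)] kl(3) by blast
    have "p \<noteq> q"
      using p q kl(1) by blast
    then have "act p X \<noteq> act q X"
      using inj_on_act_generic[OF X(1,4)] p(1) q(1) by (auto dest: inj_onD)
    moreover have "act s X \<in> C i" if s: "s \<in> A4" "s 1 = i" for s
    proof -
      have "act s X \<in> \<alpha>"
        using act_in_orbit[OF s(1), of X] by (simp add: \<alpha>_def \<omega>_def)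
      moreover have "dist (act s X) (v i) < r"
        using dist_act[OF A4_permutes[OF s(1)], of X "v 1"] X(2) act_vertex[OF A4_permutes[OF s(1)] one] s(2)
        by (simp add: dist_commute)
      ultimately show ?thesis
        by (simp add: C_def)
    qed
    then have "{act p X, act q X} \<subseteq> C i"
      using p q by blast
    ultimately show ?thesis
      using card_mono[OF finite_C, of "{act p X, act q X}" i] by simp
  qed
  \<comment> \<open>the sum is fixed by the rotations about \<open>v i\<close> and has positive inner product with \<open>v i\<close>\<close>
  have sgn_C: "sgn (\<Sum>y\<in>C i. y) = v i" if i: "i \<in> I4" for i
  proof -
    let ?w = "\<Sum>y\<in>C i. y"
    have fixed: "act p ?w = ?w" if p: "p \<in> A4" "p i = i" for p
    proof (rule act_sum[OF A4_permutes[OF p(1)]])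
      have "act p y \<in> C i" if y: "y \<in> C i" for y
      proof -
        have "dist (act p y) (v i) = dist y (v i)"
          using dist_act[OF A4_permutes[OF p(1)], of y "v i"] act_vertex[OF A4_permutes[OF p(1)] i] p(2) by simp
        then show ?thesis
          using y \<alpha>(3) p(1) by (simp add: C_def invariant_def)
      qed
      then show "act p ` C i = C i"
        using inj_act[OF A4_permutes[OF p(1)]] by (intro endo_inj_surj finite_C) (auto intro: inj_on_subset)
    qed
    obtain j where j: "j \<in> I4" "j \<noteq> i"
      using I4_other_one by blast
    have "?w \<bullet> v k = ?w \<bullet> v j" if k: "k \<in> I4" "k \<noteq> i" for k
    proof -
      obtain p where p: "p \<in> A4" "p i = i" "p j = k"
        using A4_two_transitive[OF i j(1) j(2)[symmetric] i k(1)] k(2) by blast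
      then show ?thesis
        using inner_act_vertex[OF A4_permutes j(1), of p ?w] fixed[of p] by simp
    qed
    then have w: "?w = (- 3 * (?w \<bullet> v j)) *\<^sub>R v i"
      by (rule three_equal_coordinates[OF i])
    have "y \<bullet> v i > 0" if y: "y \<in> C i" for y
    proof -
      have "(dist y (v i))\<^sup>2 < 1"
        using y r(2) by (simp add: C_def power_less_one_iff abs_square_less_1)
      moreover have "(dist y (v i))\<^sup>2 = 2 - 2 * (y \<bullet> v i)"
        using y \<alpha>(2) norm_vertex[OF i] by (intro dist_sphere) (auto simp: C_def)
      ultimately show ?thesis
        by linarith
    qed
    then have "?w \<bullet> v i > 0"
      unfolding inner_sum_left using card_C[OF i] finite_C by (intro sum_pos) auto
    moreover have "?w \<bullet> v i = - 3 * (?w \<bullet> v j)"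
      using arg_cong[OF w, of "\<lambda>x. x \<bullet> v i"] inner_vertices[OF i i] by simp
    ultimately have "- 3 * (?w \<bullet> v j) > 0"
      by linarith
    then show ?thesis
      by (subst w) (simp only: sgn_scaleR sgn_pos sgn_div_norm[of "v i"] norm_vertex[OF i] scaleR_one inverse_1)
  qed
  have "A4_set \<alpha>"
  proof (rule A4_set_criterion[OF \<alpha> card_\<alpha>])
    fix g assume g: "orthogonal_transformation g" "g ` \<alpha> = \<alpha>"
    have lin: "linear g"
      using g(1) by (rule orthogonal_transformation_linear)
    have isom: "dist (g x) (g y) = dist x y" for x y
      using orthogonal_transformation_norm[OF g(1), of "x - y"] by (simp add: dist_norm linear_diff[OF lin])
    have inj: "inj g"
      by (rule orthogonal_transformation_inj[OF g(1)])
    have g_cluster: "g ` cluster x = cluster (g x)" for x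
    proof
      show "g ` cluster x \<subseteq> cluster (g x)"
        using g(2) isom by (auto simp: cluster_def)
      show "cluster (g x) \<subseteq> g ` cluster x"
      proof
        fix z assume z: "z \<in> cluster (g x)"
        then obtain y where "y \<in> \<alpha>" "z = g y"
          using g(2) by (auto simp: cluster_def)
        then show "z \<in> g ` cluster x"
          using z isom by (auto simp: cluster_def)
      qed
    qed
    have "g (v i) \<in> V" if i: "i \<in> I4" for i
    proof -
      obtain x where x: "x \<in> C i"
        using card_C[OF i] by (cases "C i = {}") auto
      then have gx: "g x \<in> \<alpha>"
        using g(2) by (auto simp: C_def)
      have image: "g ` C i = cluster (g x)"
        using g_cluster[of x] by (simp only: cluster_near[OF x i])
      have "card (cluster (g x)) = card (C i)"
        unfolding image[symmetric] by (rule card_image[OF inj_on_subset[OF inj]]) simp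
      then have "cluster (g x) \<noteq> {g x}"
        using card_C[OF i] by auto
      then obtain j where j: "j \<in> I4" "g x \<in> C j"
        using cluster_far[OF gx] by blast
      then have "g ` C i = C j"
        unfolding image by (intro cluster_near)
      then have "(\<Sum>y\<in>C j. y) = g (\<Sum>y\<in>C i. y)"
        using sum.reindex[of g "C i" "\<lambda>y. y"] inj by (simp add: linear_sum[OF lin] inj_on_subset[OF inj])
      then have "v j = sgn (g (\<Sum>y\<in>C i. y))"
        using sgn_C[OF j(1)] by simp
      also have "\<dots> = g (sgn (\<Sum>y\<in>C i. y))"
        by (simp add: sgn_div_norm linear_scale[OF lin] orthogonal_transformation_norm[OF g(1)])
      also have "\<dots> = g (v i)"
        by (simp add: sgn_C[OF i])
      finally show ?thesis
        using vertex_in_V[OF j(1)] by simp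
    qed
    then show "g ` V \<subseteq> V"
      by (auto simp: V_def)
  qed
  then show ?thesis
    using that \<omega>_generic \<omega>_new unfolding \<alpha>_def by blast
qed

lemma generic_orbits_of_size: "\<exists>\<G>. finite \<G> \<and> \<G> \<subseteq> generic_orbits V \<and> card \<G> = n"
proof (induction n)
  case 0
  then show ?case
    by (intro exI[of _ "{}"]) simp
next
  case (Suc n)
  then obtain \<G> where \<G>: "finite \<G>" "\<G> \<subseteq> generic_orbits V" "card \<G> = n"
    by blast
  obtain \<omega> where "\<omega> \<in> generic_orbits V" "\<omega> \<notin> \<G>"
    using generic_orbit_near_vertex[OF \<G>(1)] \<G>(2) generic_orbits_subset by blast
  then show ?case
    using \<G> by (intro exI[of _ "insert \<omega> \<G>"]) simp
qed

theorem exists_A4_set_with_generic_orbits: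
  assumes \<T>: "\<T> \<subseteq> {V, F, E}" and k: "k \<ge> 1"
  shows "\<exists>\<alpha>. A4_set_of_index V (card (\<T> \<inter> {V, F}), card (\<T> \<inter> {E}), k) \<alpha>"
proof -
  obtain \<G> where \<G>: "finite \<G>" "\<G> \<subseteq> generic_orbits V" "card \<G> = k - 1"
    using generic_orbits_of_size by blast
  have fin: "finite \<T>"
    using \<T> finite_subset by blast
  have orb: "\<T> \<union> \<G> \<subseteq> orbits"
    using \<T> \<G>(2) orbits_eq by blast
  have fin_orb: "finite (\<T> \<union> \<G>)"
    using fin \<G>(1) by simp
  obtain \<omega> where \<omega>: "\<omega> \<in> generic_orbits V" "\<omega> \<notin> \<T> \<union> \<G>" "A4_set (\<Union>(insert \<omega> (\<T> \<union> \<G>)))"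
    by (rule generic_orbit_near_vertex[OF fin_orb orb])
  let ?\<O> = "insert \<omega> (\<T> \<union> \<G>)"
  have \<O>: "?\<O> \<subseteq> orbits" "finite ?\<O>"
    using \<omega>(1) generic_orbits_subset orb fin_orb by auto
  have special: "?\<O> \<inter> {V, F} = \<T> \<inter> {V, F}" "?\<O> \<inter> {E} = \<T> \<inter> {E}"
    using \<omega>(1) \<G>(2) orbit_types_distinct by blast+
  have "?\<O> \<inter> generic_orbits V = insert \<omega> \<G>"
    using \<omega>(1) \<G>(2) \<T> orbit_types_distinct by blast
  then have "card (?\<O> \<inter> generic_orbits V) = k"
    using \<omega>(2) \<G> k by simp
  then have "component_index V (\<Union>?\<O>) = (card (\<T> \<inter> {V, F}), card (\<T> \<inter> {E}), k)"
    unfolding component_index_Union[OF \<O>(1)] special by simp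
  moreover have "finite_union_of_orbits V (\<Union>?\<O>)"
    unfolding finite_union_of_orbits_iff using \<O> by blast
  ultimately show ?thesis
    using \<omega>(3) unfolding A4_set_of_index_def by blast
qed

lemma A4_set_V: "A4_set V"
  by (rule A4_set_criterion[OF finite_V V_sphere invariant_V]) (simp_all add: card_V)

text \<open>Antipodes of edge points are edge points, whereas antipodes of vertices are face points.  A linear
  symmetry of the union therefore cannot map a vertex to an edge point.\<close>

lemma A4_set_V_edge_points: "A4_set (V \<union> E)"
proof (rule A4_set_criterion)
  show "invariant (V \<union> E)"
    using invariant_Union_orbits[of "{V, E}"] V_orbit edge_points_orbit by simp
  show "3 \<le> card (V \<union> E)"
    using card_mono[of "V \<union> E" V] card_V by simp
  fix g assume g: "orthogonal_transformation g" "g ` (V \<union> E) = V \<union> E"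
  show "g ` V \<subseteq> V"
  proof
    fix y assume "y \<in> g ` V"
    then obtain x where x: "x \<in> V" "y = g x"
      by blast
    show "y \<in> V"
    proof (rule ccontr)
      assume "y \<notin> V"
      then have "y \<in> E"
        using x g(2) by blast
      then have "- y \<in> g ` (V \<union> E)"
        using uminus_edge_points g(2) by blast
      moreover have "- y = g (- x)"
        using x linear_neg[OF orthogonal_transformation_linear[OF g(1)]] by simp
      ultimately have "- x \<in> V \<union> E"
        using orthogonal_transformation_inj[OF g(1)] by (simp add: inj_image_mem_iff)
      moreover have "- x \<in> F"
        using x(1) by (simp add: face_points_eq)
      ultimately show False
        using special_points_disjoint by blast
    qed
  qed
qed (use V_sphere edge_points_sphere in auto)

end

section \<open>Conjugation to the standard tetrahedral group\<close>

lemma wedge_basis: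
  assumes "wedge e f \<noteq> 0"
  obtains x y where "u = x *s e + y *s f"
proof -
  have "wedge e f *s u = wedge u f *s e + wedge e u *s f"
    by (simp add: vec_eq_iff forall_2 wedge_def algebra_simps)
  then have "u = (wedge u f / wedge e f) *s e + (wedge e u / wedge e f) *s f"
    using assms by (simp add: vec_eq_iff forall_2 field_simps)
  then show ?thesis
    using that by blast
qed

lemma matrix_eqI_wedge_basis:
  fixes A B :: "complex ^ 2 ^ 2"
  assumes "wedge e f \<noteq> 0" "A *v e = c *s (B *v e)" "A *v f = c *s (B *v f)"
  shows "A *v u = c *s (B *v u)"
proof -
  obtain x y where u: "u = x *s e + y *s f"
    using wedge_basis[OF assms(1)] .
  show ?thesis
    unfolding u matrix_vector_right_distrib vector_scalar_commute assms(2,3)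
    by (simp add: vec_eq_iff algebra_simps)
qed

lemma mob_eqI_scale:
  assumes "det A \<noteq> 0" "det B \<noteq> 0" "c \<noteq> 0" "\<And>u. A *v u = c *s (B *v u)"
  shows "mob A = mob B"
proof (rule mob_eqI[OF mob_extensional assms(2)])
  fix u :: "complex ^ 2" assume "u \<noteq> 0"
  then show "mob A (sphere_point u) = sphere_point (B *v u)"
    using assms by (simp add: mob_sphere_point sphere_point_scale matrix_vector_eq_0_iff)
qed

lemma pauli_axis:
  "pauli (axis 3 1) *v u = vector [u $ 1, - u $ 2]"
  "pauli (axis 1 1) *v u = vector [u $ 2, u $ 1]"
  by (simp_all add: vec_eq_iff forall_2 pauli_mult axis_def Complex_eq)

text \<open>Involutions have lifts with scalar square, so \<open>A\<close> has eigenvalues \<open>\<plusminus>\<alpha>\<close>.  The lifts commute up to a factor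
  \<open>l\<close> with \<open>l\<^sup>2 = 1\<close>.  If \<open>l = 1\<close>, then \<open>A\<close> and \<open>B\<close> are simultaneously diagonal, and two distinct involutions cannot be.
  So \<open>l = - 1\<close>: \<open>B\<close> exchanges the eigenlines of \<open>A\<close>, and in the basis formed by an eigenvector
  \<open>e\<close> and a multiple of \<open>B e\<close> the two become Pauli matrices.\<close>

lemma commuting_involutions_normal_form:
  assumes A: "det A \<noteq> 0" "mob (A ** A) = mob (mat 1)" "mob A \<noteq> mob (mat 1)"
    and B: "det B \<noteq> 0" "mob (B ** B) = mob (mat 1)" "mob B \<noteq> mob (mat 1)"
    and AB: "mob (A ** B) = mob (B ** A)" "mob A \<noteq> mob B"
  obtains P where "det P \<noteq> 0" "mob (A ** P) = mob (P ** pauli (axis 3 1))"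
    "mob (B ** P) = mob (P ** pauli (axis 1 1))"
proof -
  have one: "det (mat 1 :: complex ^ 2 ^ 2) \<noteq> 0"
    by simp
  obtain a where a: "a \<noteq> 0" "\<And>u. A *v (A *v u) = a *s u"
    using mob_eq_imp_proportional[OF _ one A(2)] A(1) by (auto simp: det_mul matrix_vector_mul_assoc)
  obtain b where b: "b \<noteq> 0" "\<And>u. B *v (B *v u) = b *s u"
    using mob_eq_imp_proportional[OF _ one B(2)] B(1) by (auto simp: det_mul matrix_vector_mul_assoc)
  obtain l where l: "l \<noteq> 0" "\<And>u. A *v (B *v u) = l *s (B *v (A *v u))"
    using mob_eq_imp_proportional[OF _ _ AB(1)] A(1) B(1) by (auto simp: det_mul matrix_vector_mul_assoc)
  define \<alpha> where "\<alpha> = csqrt a"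
  define \<beta> where "\<beta> = csqrt b"
  have \<alpha>: "\<alpha> * \<alpha> = a" "\<alpha> \<noteq> 0" and \<beta>: "\<beta> * \<beta> = b" "\<beta> \<noteq> 0"
    using a(1) b(1) by (auto simp: \<alpha>_def \<beta>_def simp flip: power2_eq_square)
  have not_scalar: "\<exists>u. A *v u \<noteq> c *s u" if "c \<noteq> 0" for c
    using mob_eqI_scale[OF A(1) one that] A(3) by auto
  have not_scalar_B: "\<exists>u. B *v u \<noteq> c *s u" if "c \<noteq> 0" for c
    using mob_eqI_scale[OF B(1) one that] B(3) by auto
  have eigenvector: "\<exists>e. e \<noteq> 0 \<and> A *v e = c *s e" if c: "c * c = a" "c \<noteq> 0" for c
  proof -
    obtain w where "A *v w \<noteq> (- c) *s w"
      using not_scalar[of "- c"] c(2) by auto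
    \<comment> \<open>\<open>(A + c)\<close> maps into the eigenspace of \<open>c\<close> because \<open>A\<^sup>2 = c\<^sup>2\<close>\<close>
    then have "A *v w + c *s w \<noteq> 0"
      by (simp add: eq_neg_iff_add_eq_0)
    moreover have "A *v (A *v w + c *s w) = c *s (A *v w + c *s w)"
      using c(1) by (simp add: matrix_vector_right_distrib vector_scalar_commute a(2) vec_eq_iff algebra_simps flip: c(1))
    ultimately show ?thesis
      by blast
  qed
  obtain e where e: "e \<noteq> 0" "A *v e = \<alpha> *s e"
    using eigenvector[OF \<alpha>] by blast
  obtain e' where e': "e' \<noteq> 0" "A *v e' = (- \<alpha>) *s e'"
    using eigenvector[of "- \<alpha>"] \<alpha> by auto
  have wedge_eigen: "wedge x y \<noteq> 0" if xy: "x \<noteq> 0" "y \<noteq> 0" "A *v x = \<alpha> *s x" "A *v y = (- \<alpha>) *s y" for x y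
  proof
    assume "wedge x y = 0"
    then obtain k where k: "k \<noteq> 0" "y = k *s x"
      using wedge_eq_0_iff xy(1,2) by blast
    then have "A *v y = \<alpha> *s y"
      unfolding k(2) vector_scalar_commute xy(3) vector_smult_assoc by (simp only: mult.commute)
    then have "\<alpha> *s y = (- \<alpha>) *s y"
      using xy(4) by simp
    then show False
      using \<alpha>(2) xy(2) by (simp only: vector_mul_rcancel) simp
  qed
  define f where "f = B *v e"
  have f: "f \<noteq> 0" "A *v f = (l * \<alpha>) *s f"
    using e B(1) l(2)[of e] by (simp_all add: f_def matrix_vector_eq_0_iff vector_scalar_commute vector_smult_assoc)
  have "A *v (A *v (B *v e)) = (l * l) *s (B *v (A *v (A *v e)))"
    by (simp only: l(2) vector_scalar_commute vector_smult_assoc)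
  then have "a *s f = (l * l * a) *s f"
    by (simp only: a(2) f_def vector_scalar_commute vector_smult_assoc)
  then have "l * l = 1"
    using f(1) a(1) by (simp add: vector_mul_rcancel)
  moreover have "l \<noteq> 1"
  proof
    assume "l = 1"
    have eig: "\<exists>k. B *v x = k *s x" if x: "x \<noteq> 0" "A *v x = c *s x" "y \<noteq> 0" "A *v y = (- c) *s y" "c \<in> {\<alpha>, - \<alpha>}" for x y c
    proof -
      have Bx: "B *v x \<noteq> 0" "A *v (B *v x) = c *s (B *v x)"
        using x B(1) l(2)[of x] \<open>l = 1\<close> by (simp_all add: matrix_vector_eq_0_iff vector_scalar_commute)
      have "wedge x (B *v x) = 0"
      proof (rule ccontr)
        assume ne: "wedge x (B *v x) \<noteq> 0"
        have "A *v u = c *s (mat 1 *v u)" for u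
          by (rule matrix_eqI_wedge_basis[OF ne]) (simp_all add: x(2) Bx(2))
        moreover have "c \<noteq> 0"
          using x(5) \<alpha>(2) by auto
        ultimately show False
          using not_scalar[of c] by simp
      qed
      then show ?thesis
        using wedge_eq_0_iff[OF x(1) Bx(1)] by blast
    qed
    obtain k where k: "B *v e = k *s e"
      using eig[OF e e'] by blast
    obtain k' where k': "B *v e' = k' *s e'"
      using eig[OF e' e(1)] e(2) by auto
    have "k * k = b" "k' * k' = b"
      using b(2)[of e] b(2)[of e'] e(1) e'(1)
      by (simp_all add: k k' vector_scalar_commute vector_smult_assoc vector_mul_rcancel)
    then have kk: "k' = k \<or> k' = - k" "k \<noteq> 0"
      using b(1) by (auto simp: square_eq_iff)
    have wee: "wedge e e' \<noteq> 0"
      using wedge_eigen e e' by blast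
    show False
      using kk(1)
    proof
      assume eq: "k' = k"
      have "B *v u = k *s (mat 1 *v u)" for u
        by (rule matrix_eqI_wedge_basis[OF wee]) (simp_all add: k k' eq)
      then show False
        using not_scalar_B[OF kk(2)] by simp
    next
      assume eq: "k' = - k"
      have "B *v u = (k / \<alpha>) *s (A *v u)" for u
        by (rule matrix_eqI_wedge_basis[OF wee])
          (simp_all add: k k' eq e(2) e'(2) \<alpha>(2) vector_smult_assoc)
      then show False
        using mob_eqI_scale[OF B(1) A(1), of "k / \<alpha>"] kk(2) \<alpha>(2) AB(2) by auto
    qed
  qed
  ultimately have "l = - 1"
    by (metis mult_cancel_right1 square_eq_1_iff)
  define g where "g = (1 / \<beta>) *s f"
  have g: "g \<noteq> 0" "A *v g = (- \<alpha>) *s g"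
    using f \<beta>(2) \<open>l = - 1\<close> by (simp_all add: g_def vector_scalar_commute vector_smult_assoc)
  have Beg: "B *v e = \<beta> *s g" "B *v g = \<beta> *s e"
    using \<beta> b(2)[of e] by (simp_all add: g_def f_def vector_scalar_commute vector_smult_assoc flip: \<beta>(1))
  define P :: "complex ^ 2 ^ 2" where "P = vector [vector [e $ 1, g $ 1], vector [e $ 2, g $ 2]]"
  have P: "P *v u = u $ 1 *s e + u $ 2 *s g" for u
    by (simp add: P_def vec_eq_iff forall_2 matrix_vector_mult_def sum_2 algebra_simps)
  have detP: "det P \<noteq> 0"
    using wedge_eigen[OF e(1) g(1) e(2) g(2)] by (simp add: P_def det_2 wedge_def algebra_simps)
  have det_pauli_axis: "det (pauli (axis k 1)) \<noteq> 0" for k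
    by (simp add: det_pauli inner_axis_axis)
  have "mob (A ** P) = mob (P ** pauli (axis 3 1))"
  proof (rule mob_eqI_scale[OF _ _ \<alpha>(2)])
    show "A ** P *v u = \<alpha> *s (P ** pauli (axis 3 1) *v u)" for u
      using e(2) g(2)
      by (simp add: P pauli_mult axis_def complex_eq_iff[of _ 0] matrix_vector_right_distrib vector_scalar_commute vec_eq_iff algebra_simps
          flip: matrix_vector_mul_assoc)
  qed (use A(1) detP det_pauli_axis in \<open>simp_all add: det_mul\<close>)
  moreover have "mob (B ** P) = mob (P ** pauli (axis 1 1))"
  proof (rule mob_eqI_scale[OF _ _ \<beta>(2)])
    show "B ** P *v u = \<beta> *s (P ** pauli (axis 1 1) *v u)" for u
      using Beg
      by (simp add: P pauli_mult axis_def Complex_eq matrix_vector_right_distrib vector_scalar_commute vec_eq_iff algebra_simps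
          flip: matrix_vector_mul_assoc)
  qed (use B(1) detP det_pauli_axis in \<open>simp_all add: det_mul\<close>)
  ultimately show ?thesis
    using that detP by blast
qed

text \<open>The hypotheses say that conjugation by \<open>T\<close> permutes the half-turns about the coordinate axes cyclically.
  Comparing entries leaves four matrices up to scalars, and these are rotations that permute the coordinate
  axes cyclically with signs of product \<open>1\<close>.\<close>

lemma cyclic_normalizer:
  assumes T: "det T \<noteq> 0" and T3: "mob (T ** pauli (axis 3 1)) = mob (pauli (axis 1 1) ** T)"
    and T1: "mob (T ** pauli (axis 1 1)) = mob ((pauli (axis 3 1) ** pauli (axis 1 1)) ** T)"
  obtains \<kappa> \<sigma> :: real where "\<kappa> \<in> {1, - 1}" "\<sigma> \<in> {1, - 1}"
    "\<And>x. x \<in> riemann_sphere \<Longrightarrow> mob T x = vector [\<kappa> * x $ 3, \<sigma> * x $ 1, \<kappa> * \<sigma> * x $ 2]"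
proof -
  have det_pauli_axis: "det (pauli (axis k 1)) \<noteq> 0" for k
    by (simp add: det_pauli inner_axis_axis)
  obtain l where l: "l \<noteq> 0" "\<And>u. (T ** pauli (axis 3 1)) *v u = l *s ((pauli (axis 1 1) ** T) *v u)"
    using mob_eq_imp_proportional[OF _ _ T3] T det_pauli_axis by (auto simp: det_mul)
  obtain m where m: "m \<noteq> 0" "\<And>u. (T ** pauli (axis 1 1)) *v u = m *s (((pauli (axis 3 1) ** pauli (axis 1 1)) ** T) *v u)"
    using mob_eq_imp_proportional[OF _ _ T1] T det_pauli_axis by (auto simp: det_mul)
  define p q r s where "p = T $ 1 $ 1" and "q = T $ 1 $ 2" and "r = T $ 2 $ 1" and "s = T $ 2 $ 2"
  have Tu: "(T *v u) $ 1 = p * u $ 1 + q * u $ 2" "(T *v u) $ 2 = r * u $ 1 + s * u $ 2" for u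
    by (simp_all add: p_def q_def r_def s_def matrix_vector_mult_def sum_2)
  have L: "p * x - q * y = l * (r * x + s * y)" "r * x - s * y = l * (p * x + q * y)" for x y
  proof -
    have "T *v vector [x, - y] = l *s vector [r * x + s * y, p * x + q * y]"
      using l(2)[of "vector [x, y]"] by (simp add: pauli_axis Tu flip: matrix_vector_mul_assoc)
    from arg_cong[OF this, of "\<lambda>w. w $ 1"] arg_cong[OF this, of "\<lambda>w. w $ 2"]
    show "p * x - q * y = l * (r * x + s * y)" "r * x - s * y = l * (p * x + q * y)"
      by (simp_all add: Tu)
  qed
  have M: "p * y + q * x = m * (r * x + s * y)" "r * y + s * x = - m * (p * x + q * y)" for x y
  proof -
    have "T *v vector [y, x] = m *s vector [r * x + s * y, - (p * x + q * y)]"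
      using m(2)[of "vector [x, y]"] by (simp add: pauli_axis Tu flip: matrix_vector_mul_assoc)
    from arg_cong[OF this, of "\<lambda>w. w $ 1"] arg_cong[OF this, of "\<lambda>w. w $ 2"]
    show "p * y + q * x = m * (r * x + s * y)" "r * y + s * x = - m * (p * x + q * y)"
      by (simp_all add: Tu algebra_simps)
  qed
  have "- s = l * q"
    using L(2)[of 0 1] by simp
  then have s_eq: "s = - l * q"
    by (metis minus_minus mult_minus_left)
  have eqs: "p = l * r" "r = l * p"
    using L(1)[of 1 0] L(2)[of 1 0] by simp_all
  have eqs': "q = m * r" "r = - m * q"
    using M(1)[where x = 1 and y = 0] M(2)[where x = 0 and y = 1] by simp_all
  have "r \<noteq> 0"
  proof
    assume "r = 0"
    then have "p = 0" "q = 0"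
      using eqs(1) eqs'(1) by simp_all
    then show False
      using T by (simp add: det_2 p_def q_def)
  qed
  have "l * l * r = 1 * r"
    using eqs by simp
  then have "l = 1 \<or> l = - 1"
    using \<open>r \<noteq> 0\<close> by (simp add: square_eq_1_iff)
  then obtain \<kappa> :: real where \<kappa>: "\<kappa> \<in> {1, - 1}" "l = of_real \<kappa>"
    by (metis insertCI of_real_1 of_real_minus)
  have "m * m * r = \<i> * \<i> * r"
  proof -
    have "m * m * r = m * q"
      by (simp only: eqs'(1) mult.assoc)
    also have "\<dots> = - r"
      using eqs'(2) by (metis minus_minus mult_minus_left)
    finally show ?thesis
      by simp
  qed
  then have "m = \<i> \<or> m = - \<i>"
    using \<open>r \<noteq> 0\<close> by (simp only: mult_cancel_right square_eq_iff) simp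
  then obtain \<sigma> :: real where \<sigma>: "\<sigma> \<in> {1, - 1}" "m = of_real \<sigma> * \<i>"
    by (metis insertCI mult_1 mult_minus_left of_real_1 of_real_minus)
  have T_eq: "(T *v u) $ 1 = r * (of_real \<kappa> * u $ 1 + of_real \<sigma> * \<i> * u $ 2)"
    "(T *v u) $ 2 = r * (u $ 1 - of_real (\<kappa> * \<sigma>) * \<i> * u $ 2)" for u
    by (simp_all add: Tu eqs(1) s_eq eqs'(1) \<kappa>(2) \<sigma>(2) algebra_simps)
  have norm_T: "(norm (T *v u))\<^sup>2 = (2 * (cmod r)\<^sup>2) * (norm u)\<^sup>2" for u
    unfolding norm_C2 T_eq norm_mult power_mult_distrib cmod_power2
    using \<kappa>(1) \<sigma>(1) by (auto simp: power2_eq_square algebra_simps)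
  have hopf_T: "hopf (T *v u) = (2 * (cmod r)\<^sup>2) *\<^sub>R vector [\<kappa> * hopf u $ 3, \<sigma> * hopf u $ 1, \<kappa> * \<sigma> * hopf u $ 2]" for u
    unfolding hopf_def T_eq norm_mult power_mult_distrib cmod_power2
    using \<kappa>(1) \<sigma>(1) by (auto simp: vec_eq_iff forall_3 power2_eq_square algebra_simps)
  have "mob T x = vector [\<kappa> * x $ 3, \<sigma> * x $ 1, \<kappa> * \<sigma> * x $ 2]" if x: "x \<in> riemann_sphere" for x
  proof -
    obtain u where u: "u \<noteq> 0" "sphere_point u = x"
      using x by (rule sphere_point_surj)
    have "mob T x = sphere_point (T *v u)"
      unfolding u(2)[symmetric] by (rule mob_sphere_point[OF T u(1)])
    also have "\<dots> = vector [\<kappa> * x $ 3, \<sigma> * x $ 1, \<kappa> * \<sigma> * x $ 2]"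
    proof -
      have "(norm u)\<^sup>2 \<noteq> 0" "2 * (cmod r)\<^sup>2 \<noteq> 0"
        using u(1) \<open>r \<noteq> 0\<close> by simp_all
      then show ?thesis
        unfolding u(2)[symmetric] sphere_point_def hopf_T norm_T vec_eq_iff forall_3
        by (simp add: field_simps)
    qed
    finally show ?thesis .
  qed
  then show ?thesis
    using that \<kappa>(1) \<sigma>(1) by blast
qed

lemma moebius_stabilizer_conjugate:
  assumes k: "k \<in> moebius_transformations" and j: "j \<in> moebius_transformations"
    and jk: "\<forall>x\<in>riemann_sphere. j (k x) = x" and kj: "\<forall>x\<in>riemann_sphere. k (j x) = x"
    and \<gamma>: "\<gamma> \<subseteq> riemann_sphere" and s: "s \<in> moebius_stabilizer \<gamma>"
  shows "compose riemann_sphere k (compose riemann_sphere s j) \<in> moebius_stabilizer (k ` \<gamma>)"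
proof -
  have "compose riemann_sphere k (compose riemann_sphere s j) (k x) = k (s x)" if "x \<in> \<gamma>" for x
    using that \<gamma> jk moebius_in_sphere[OF k, of x] by (auto simp: compose_def subset_iff simp del: mem_sphere_0)
  then have "compose riemann_sphere k (compose riemann_sphere s j) ` k ` \<gamma> = k ` s ` \<gamma>"
    unfolding image_image by (intro image_cong) auto
  then show ?thesis
    using s k j by (simp add: moebius_compose)
qed

lemma bij_betw_moebius_stabilizer_conjugate:
  assumes k: "k \<in> moebius_transformations" and j: "j \<in> moebius_transformations"
    and jk: "\<forall>x\<in>riemann_sphere. j (k x) = x" and kj: "\<forall>x\<in>riemann_sphere. k (j x) = x"
    and \<gamma>: "\<gamma> \<subseteq> riemann_sphere"
  shows "bij_betw (\<lambda>s. compose riemann_sphere k (compose riemann_sphere s j))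
    (moebius_stabilizer \<gamma>) (moebius_stabilizer (k ` \<gamma>))"
proof -
  have k\<gamma>: "k ` \<gamma> \<subseteq> riemann_sphere"
    using \<gamma> moebius_in_sphere[OF k] by blast
  have jk\<gamma>: "j ` k ` \<gamma> = \<gamma>"
  proof -
    have "j ` k ` \<gamma> = (\<lambda>x. x) ` \<gamma>"
      unfolding image_image using jk \<gamma> by (intro image_cong) auto
    then show ?thesis
      by simp
  qed
  let ?c = "\<lambda>k j s. compose riemann_sphere k (compose riemann_sphere s j)"
  have inverse: "?c j k (?c k j s) = s"
    if s: "s \<in> moebius_transformations" and *: "k \<in> moebius_transformations" "j \<in> moebius_transformations" "\<forall>x\<in>riemann_sphere. j (k x) = x" for s j k
    using * moebius_in_sphere[OF s] moebius_in_sphere[OF *(1)] moebius_extensional[OF s]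
    by (auto simp: compose_def fun_eq_iff extensional_def simp del: mem_sphere_0)
  show ?thesis
  proof (rule bij_betw_byWitness[where f' = "?c j k"])
    show "\<forall>s\<in>moebius_stabilizer \<gamma>. ?c j k (?c k j s) = s"
      using inverse k j jk by blast
    show "\<forall>s\<in>moebius_stabilizer (k ` \<gamma>). ?c k j (?c j k s) = s"
      using inverse k j kj by blast
    show "?c k j ` moebius_stabilizer \<gamma> \<subseteq> moebius_stabilizer (k ` \<gamma>)"
      using moebius_stabilizer_conjugate[OF k j jk kj \<gamma>] by blast
    show "?c j k ` moebius_stabilizer (k ` \<gamma>) \<subseteq> moebius_stabilizer \<gamma>"
      using moebius_stabilizer_conjugate[OF j k kj jk k\<gamma>] unfolding jk\<gamma> by blast
  qed
qed

text \<open>By Lagrange's theorem a proper subgroup has at most six elements.\<close>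

lemma subgroup_order_12_eq:
  assumes G: "group G" and A: "subgroup A G" and J: "subgroup J G" "J \<subseteq> A"
    and card: "card A = 12" "card J \<ge> 7"
  shows "J = A"
proof -
  have "subgroup J (G \<lparr>carrier := A\<rparr>)"
    using group.subgroup_incl[OF G J(1) A J(2)] .
  moreover have "group (G \<lparr>carrier := A\<rparr>)"
    using subgroup.subgroup_is_group[OF A G] .
  ultimately have "card (rcosets\<^bsub>G\<lparr>carrier := A\<rparr>\<^esub> J) * card J = 12"
    using group.lagrange[of "G \<lparr>carrier := A\<rparr>" J] card(1) by (simp add: Coset.order_def)
  then obtain d where "card J * d = 12"
    by (metis mult.commute)
  then have "card J = 12"
    using card(2) by (cases "d \<ge> 2") (auto dest: mult_le_mono[of 7 "card J" 2 d] simp: not_le less_Suc_eq numeral_2_eq_2)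
  moreover have "finite A"
    by (rule card_ge_0_finite) (simp add: card(1))
  ultimately show ?thesis
    using card(1) J(2) by (simp add: card_subset_eq)
qed

text \<open>The elements are \<open>a = (1 2)(3 4)\<close>, \<open>b = (1 3)(2 4)\<close> and \<open>t = (2 3 4)\<close>.  The seven products are distinguished
  by their values at 1 and 2; more than six elements suffice to generate the group.\<close>

lemma A4_relations:
  obtains a b t where "a \<in> A4" "b \<in> A4" "t \<in> A4" "a \<circ> a = id" "b \<circ> b = id" "a \<circ> b = b \<circ> a"
    "t \<circ> a = b \<circ> t" "t \<circ> b = a \<circ> b \<circ> t" "card {id, a, b, a \<circ> b, t, t \<circ> a, t \<circ> b} = 7"
proof -
  let ?\<tau> = "Transposition.transpose :: nat \<Rightarrow> nat \<Rightarrow> nat \<Rightarrow> nat"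
  define a b t where "a = ?\<tau> 1 2 \<circ> ?\<tau> 3 4" and "b = ?\<tau> 1 3 \<circ> ?\<tau> 2 4" and "t = ?\<tau> 2 3 \<circ> ?\<tau> 3 4"
  have mem: "?\<tau> i j \<circ> ?\<tau> k l \<in> A4" if "{i, j, k, l} \<subseteq> I4" "i \<noteq> j" "k \<noteq> l" for i j k l
    using that by (simp add: A4_def permutes_compose permutes_swap_id evenperm_comp permutation_swap_id evenperm_swap)
  have A4: "a \<in> A4" "b \<in> A4" "t \<in> A4"
    unfolding a_def b_def t_def by (rule mem; simp add: I4_def)+
  have rel: "a \<circ> a = id" "b \<circ> b = id" "a \<circ> b = b \<circ> a" "t \<circ> a = b \<circ> t" "t \<circ> b = a \<circ> b \<circ> t"
    by (auto simp: a_def b_def t_def fun_eq_iff Transposition.transpose_def)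
  let ?X = "{id, a, b, a \<circ> b, t, t \<circ> a, t \<circ> b}"
  have "(\<lambda>p. (p 1, p 2)) ` ?X = {(1, 2), (2, 1), (3, 4), (4, 3), (1, 3), (3, 1), (4, 2)}"
    by (simp add: a_def b_def t_def Transposition.transpose_def)
  then have "7 \<le> card ?X"
    using card_image_le[of ?X "\<lambda>p. (p 1, p 2)"] by simp
  moreover have "card ?X \<le> 7"
    using card_length[of "[id, a, b, a \<circ> b, t, t \<circ> a, t \<circ> b]"] by simp
  ultimately show ?thesis
    using that[OF A4 rel] by simp
qed

text \<open>Four alternate vertices of the cube \<open>{-1, 1}\<^sup>3\<close>, scaled to the sphere: those with positive product of
  coordinates.  The half-turns about the coordinate axes preserve this tetrahedron.\<close>

definition standard_vertex :: "nat \<Rightarrow> real ^ 3" where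
  "standard_vertex i = (1 / sqrt 3) *\<^sub>R
     (if i = 1 then vector [1, 1, 1] else if i = 2 then vector [1, - 1, - 1]
      else if i = 3 then vector [- 1, 1, - 1] else vector [- 1, - 1, 1])"

lemma I4_eq: "I4 = {1, 2, 3, 4}"
  by (auto simp: I4_def)

interpretation standard: tetrahedron standard_vertex
proof
  fix i j assume "i \<in> I4" "j \<in> I4"
  then show "standard_vertex i \<bullet> standard_vertex j = (if i = j then 1 else - 1 / 3)"
    by (auto simp: I4_eq standard_vertex_def inner_vec_def sum_3)
qed

lemma standard_V: "standard.V = (\<Union>a\<in>{1, - 1}. \<Union>b\<in>{1, - 1}. {(1 / sqrt 3) *\<^sub>R vector [a, b, a * b]})"
  by (simp add: standard.V_def I4_eq standard_vertex_def insert_commute)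

lemma stabilizes_standard_V:
  assumes f: "f \<in> moebius_transformations"
    and V: "\<And>a b. a \<in> {1, - 1} \<Longrightarrow> b \<in> {1, - 1} \<Longrightarrow> f ((1 / sqrt 3) *\<^sub>R vector [a, b, a * b]) \<in> standard.V"
  shows "f \<in> moebius_stabilizer standard.V"
proof -
  have "f ` standard.V \<subseteq> standard.V"
    using V unfolding standard_V by blast
  moreover have "inj_on f standard.V"
    using moebius_bij_betw[OF f] standard.V_sphere by (auto simp: bij_betw_def intro: inj_on_subset)
  ultimately show ?thesis
    using f endo_inj_surj[OF standard.finite_V] by blast
qed

lemma standard_V_member: "a \<in> {1, - 1} \<Longrightarrow> b \<in> {1, - 1} \<Longrightarrow> (1 / sqrt 3) *\<^sub>R vector [a, b, a * b] \<in> standard.V"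
  unfolding standard_V by blast

lemma pauli_stabilizes_standard_V:
  "mob (pauli (axis 3 1)) \<in> moebius_stabilizer standard.V" "mob (pauli (axis 1 1)) \<in> moebius_stabilizer standard.V"
proof -
  have halfturn: "halfturn (axis 3 1) x = vector [- x $ 1, - x $ 2, x $ 3]"
    "halfturn (axis 1 1) x = vector [x $ 1, - x $ 2, - x $ 3]" for x
    by (simp_all add: halfturn_def inner_axis inner_axis_axis) (simp_all add: vec_eq_iff forall_3 axis_def)
  have mob: "mob (pauli (axis i 1)) x = halfturn (axis i 1) x" "mob (pauli (axis i 1)) \<in> moebius_transformations"
    if "x \<in> standard.V" for i x
    using that standard.V_sphere halfturn_moebius[of "axis i 1"] by (auto simp: mob_pauli axis_eq_0_iff)
  show "mob (pauli (axis 3 1)) \<in> moebius_stabilizer standard.V"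
  proof (rule stabilizes_standard_V)
    fix a b :: real assume ab: "a \<in> {1, - 1}" "b \<in> {1, - 1}"
    have "mob (pauli (axis 3 1)) ((1 / sqrt 3) *\<^sub>R vector [a, b, a * b]) = (1 / sqrt 3) *\<^sub>R vector [- a, - b, (- a) * (- b)]"
      unfolding mob(1)[OF standard_V_member[OF ab]] halfturn by (simp add: vec_eq_iff forall_3)
    then show "mob (pauli (axis 3 1)) ((1 / sqrt 3) *\<^sub>R vector [a, b, a * b]) \<in> standard.V"
      using ab by (simp only:) (rule standard_V_member; auto)
  qed (use mob standard_V_member in blast)
  show "mob (pauli (axis 1 1)) \<in> moebius_stabilizer standard.V"
  proof (rule stabilizes_standard_V)
    fix a b :: real assume ab: "a \<in> {1, - 1}" "b \<in> {1, - 1}"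
    have "mob (pauli (axis 1 1)) ((1 / sqrt 3) *\<^sub>R vector [a, b, a * b]) = (1 / sqrt 3) *\<^sub>R vector [a, - b, a * (- b)]"
      unfolding mob(1)[OF standard_V_member[OF ab]] halfturn by (simp add: vec_eq_iff forall_3)
    then show "mob (pauli (axis 1 1)) ((1 / sqrt 3) *\<^sub>R vector [a, b, a * b]) \<in> standard.V"
      using ab by (simp only:) (rule standard_V_member; auto)
  qed (use mob standard_V_member in blast)
qed

lemma cyclic_stabilizes_standard_V:
  assumes "det T \<noteq> 0" "\<kappa> \<in> {1, - 1}" "\<sigma> \<in> {1, - 1}"
    and T: "\<And>x. x \<in> riemann_sphere \<Longrightarrow> mob T x = vector [\<kappa> * x $ 3, \<sigma> * x $ 1, \<kappa> * \<sigma> * x $ 2]"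
  shows "mob T \<in> moebius_stabilizer standard.V"
proof (rule stabilizes_standard_V)
  show "mob T \<in> moebius_transformations"
    using assms(1) by (simp add: moebius_transformations_eq)
  fix a b :: real assume ab: "a \<in> {1, - 1}" "b \<in> {1, - 1}"
  have "(1 / sqrt 3) *\<^sub>R vector [a, b, a * b] \<in> riemann_sphere"
    using standard_V_member[OF ab] standard.V_sphere by blast
  then have "mob T ((1 / sqrt 3) *\<^sub>R vector [a, b, a * b])
      = (1 / sqrt 3) *\<^sub>R vector [\<kappa> * (a * b), \<sigma> * a, (\<kappa> * (a * b)) * (\<sigma> * a)]"
    using ab(1) by (subst T) (auto simp: vec_eq_iff forall_3)
  then show "mob T ((1 / sqrt 3) *\<^sub>R vector [a, b, a * b]) \<in> standard.V"
    using ab assms(2,3) by (simp only:) (rule standard_V_member; auto)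
qed

lemma mob_mult_cong:
  assumes "det X \<noteq> 0" "det X' \<noteq> 0" "det Y \<noteq> 0" "det Y' \<noteq> 0" "mob X = mob X'" "mob Y = mob Y'"
  shows "mob (X ** Y) = mob (X' ** Y')"
  using assms by (simp flip: compose_mob)

lemma mob_mult_image:
  assumes "det X \<noteq> 0" "det Y \<noteq> 0" "\<gamma> \<subseteq> riemann_sphere"
  shows "mob (X ** Y) ` \<gamma> = mob X ` mob Y ` \<gamma>"
  unfolding image_image using assms(3) by (intro image_cong refl) (auto simp: mob_mob[OF assms(1,2)] subset_iff)

text \<open>The images of \<open>a\<close>, \<open>b\<close>, \<open>t\<close> from \<open>A4_relations\<close> have lifts \<open>A\<close>, \<open>B\<close>, \<open>T\<close>.  A change of basis \<open>P\<close> turns \<open>A\<close> and \<open>B\<close>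
  into Pauli matrices and \<open>T\<close> into one of the rotations of \<open>cyclic_normalizer\<close>, all of which preserve the
  standard tetrahedron.  So the stabilizers of \<open>\<alpha>\<close> and of the image \<open>W\<close> of that tetrahedron, both of order 12,
  share at least seven elements and hence coincide.\<close>

theorem A4_set_conjugate_to_standard:
  assumes \<alpha>: "A4_set \<alpha>"
  obtains j where "j \<in> moebius_transformations" "moebius_stabilizer (j ` \<alpha>) = moebius_stabilizer standard.V"
proof -
  have \<alpha>_sphere: "\<alpha> \<subseteq> riemann_sphere"
    using \<alpha> by (simp add: A4_set_def)
  let ?H = "moebius_group_of \<alpha>"
  have H: "group ?H"
    using subgroup.subgroup_is_group[OF moebius_stabilizer_subgroup[OF \<alpha>_sphere] group_BijGroup]
    by (simp only: moebius_group_of_def)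
  have "alt_group 4 \<cong> ?H"
    using \<alpha> by (intro group.iso_sym[OF H]) (simp add: A4_set_def)
  then obtain \<phi> where hom: "\<phi> \<in> hom (alt_group 4) ?H" and bij: "bij_betw \<phi> (carrier (alt_group 4)) (carrier ?H)"
    by (auto simp: is_iso_def iso_def)
  have \<phi>_mem: "\<phi> p \<in> moebius_stabilizer \<alpha>" if "p \<in> A4" for p
    using hom_in_carrier[OF hom] that by (simp add: carrier_alt_group_4 moebius_group_of_def)
  have \<phi>_comp: "\<phi> (p \<circ> q) = compose riemann_sphere (\<phi> p) (\<phi> q)" if "p \<in> A4" "q \<in> A4" for p q
    using hom_mult[OF hom, of p q] that \<phi>_mem moebius_mult[of "\<phi> p" "\<phi> q"]
    by (simp add: carrier_alt_group_4 alt_group_mult moebius_group_of_def)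
  have \<phi>_id: "\<phi> id = mob (mat 1)"
    using hom_one[OF hom alt_group_is_group H] by (simp add: alt_group_one moebius_group_of_def BijGroup_def mob_id)
  have \<phi>_inj: "inj_on \<phi> A4"
    using bij by (simp add: bij_betw_def carrier_alt_group_4)
  obtain a b t where abt: "a \<in> A4" "b \<in> A4" "t \<in> A4" and rel: "a \<circ> a = id" "b \<circ> b = id" "a \<circ> b = b \<circ> a"
      "t \<circ> a = b \<circ> t" "t \<circ> b = a \<circ> b \<circ> t" and card7: "card {id, a, b, a \<circ> b, t, t \<circ> a, t \<circ> b} = 7"
    by (rule A4_relations)
  have "distinct [id, a, b, a \<circ> b, t, t \<circ> a, t \<circ> b]"
    using card7 by (intro card_distinct) simp
  then have ne: "a \<noteq> id" "b \<noteq> id" "a \<noteq> b"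
    by auto
  have ex: "\<exists>A. det A \<noteq> 0 \<and> \<phi> p = mob A" if "p \<in> A4" for p
    using \<phi>_mem[OF that] unfolding moebius_transformations_eq by blast
  obtain A B T where A: "det A \<noteq> 0" "\<phi> a = mob A" and B: "det B \<noteq> 0" "\<phi> b = mob B"
    and T: "det T \<noteq> 0" "\<phi> t = mob T"
    using ex abt by meson
  have ab: "\<phi> (a \<circ> b) = mob (A ** B)"
    using abt A B by (simp add: \<phi>_comp compose_mob)
  have AA: "mob (A ** A) = mob (mat 1)" and BB: "mob (B ** B) = mob (mat 1)"
    using \<phi>_comp[of a a] \<phi>_comp[of b b] abt A B rel \<phi>_id by (simp_all add: compose_mob)
  have A1: "mob A \<noteq> mob (mat 1)" and B1: "mob B \<noteq> mob (mat 1)" and AB_ne: "mob A \<noteq> mob B"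
    using inj_onD[OF \<phi>_inj, of a id] inj_onD[OF \<phi>_inj, of b id] inj_onD[OF \<phi>_inj, of a b] abt ne A B \<phi>_id
    by auto
  have AB: "mob (A ** B) = mob (B ** A)"
    using \<phi>_comp[of b a] abt A B ab rel(3) by (simp add: compose_mob)
  have TA: "mob (T ** A) = mob (B ** T)"
    using \<phi>_comp[of t a] \<phi>_comp[of b t] abt A B T rel(4) by (simp add: compose_mob)
  have TB: "mob (T ** B) = mob (A ** B ** T)"
    using \<phi>_comp[of t b] \<phi>_comp[of "a \<circ> b" t] abt A4_comp[of a b] A B T ab rel(5) by (simp add: compose_mob det_mul)
  let ?s3 = "pauli (axis 3 1)" and ?s1 = "pauli (axis 1 1)"
  have s: "det ?s3 \<noteq> 0" "det ?s1 \<noteq> 0"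
    by (simp_all add: det_pauli inner_axis_axis)
  obtain P where P: "det P \<noteq> 0" and AP: "mob (A ** P) = mob (P ** ?s3)" and BP: "mob (B ** P) = mob (P ** ?s1)"
    by (rule commuting_involutions_normal_form[OF A(1) AA A1 B(1) BB B1 AB AB_ne])
  obtain Q where Q: "det Q \<noteq> 0" "P ** Q = mat 1" "Q ** P = mat 1"
    using matrix_inverse[OF P] by blast
  define T' where "T' = Q ** (T ** P)"
  have T': "det T' \<noteq> 0"
    using P Q(1) T(1) by (simp add: T'_def det_mul)
  have PT': "P ** T' = T ** P"
    by (simp add: T'_def matrix_mul_assoc Q(2))
  have cancel: "mob X = mob Y" if "mob (P ** X) = mob (P ** Y)" "det X \<noteq> 0" "det Y \<noteq> 0" for X Y
  proof -
    have "mob (Q ** (P ** X)) = mob (Q ** (P ** Y))"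
      using that P Q(1) by (intro mob_mult_cong[OF Q(1) Q(1) _ _ refl that(1)]) (simp_all add: det_mul)
    then show ?thesis
      by (simp add: matrix_mul_assoc Q(3))
  qed
  note dets = A(1) B(1) T(1) P T' s det_mul
  have "mob (P ** (T' ** ?s3)) = mob (T ** (P ** ?s3))"
    by (simp add: matrix_mul_assoc PT')
  also have "\<dots> = mob (T ** (A ** P))"
    by (rule mob_mult_cong[OF _ _ _ _ refl AP[symmetric]]) (simp_all add: dets)
  also have "\<dots> = mob ((T ** A) ** P)"
    by (simp add: matrix_mul_assoc)
  also have "\<dots> = mob ((B ** T) ** P)"
    by (rule mob_mult_cong[OF _ _ _ _ TA refl]) (simp_all add: dets)
  also have "\<dots> = mob ((B ** P) ** T')"
    by (simp add: PT' flip: matrix_mul_assoc)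
  also have "\<dots> = mob ((P ** ?s1) ** T')"
    by (rule mob_mult_cong[OF _ _ _ _ BP refl]) (simp_all add: dets)
  also have "\<dots> = mob (P ** (?s1 ** T'))"
    by (simp add: matrix_mul_assoc)
  \<comment> \<open>the relation \<open>t a = b t\<close>, transported by \<open>P\<close>\<close>
  finally have T'3: "mob (T' ** ?s3) = mob (?s1 ** T')"
    by (rule cancel) (simp_all add: dets)
  have "mob (P ** (T' ** ?s1)) = mob (T ** (P ** ?s1))"
    by (simp add: matrix_mul_assoc PT')
  also have "\<dots> = mob (T ** (B ** P))"
    by (rule mob_mult_cong[OF _ _ _ _ refl BP[symmetric]]) (simp_all add: dets)
  also have "\<dots> = mob ((T ** B) ** P)"
    by (simp add: matrix_mul_assoc)
  also have "\<dots> = mob ((A ** B ** T) ** P)"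
    by (rule mob_mult_cong[OF _ _ _ _ TB refl]) (simp_all add: dets)
  also have "\<dots> = mob (A ** ((B ** P) ** T'))"
    by (simp add: PT' flip: matrix_mul_assoc)
  also have "\<dots> = mob (A ** ((P ** ?s1) ** T'))"
    by (rule mob_mult_cong[OF _ _ _ _ refl mob_mult_cong[OF _ _ _ _ BP refl]]) (simp_all add: dets)
  also have "\<dots> = mob ((A ** P) ** (?s1 ** T'))"
    by (simp add: matrix_mul_assoc)
  also have "\<dots> = mob ((P ** ?s3) ** (?s1 ** T'))"
    by (rule mob_mult_cong[OF _ _ _ _ AP refl]) (simp_all add: dets)
  also have "\<dots> = mob (P ** ((?s3 ** ?s1) ** T'))"
    by (simp add: matrix_mul_assoc)
  \<comment> \<open>the relation \<open>t b = a b t\<close>, transported by \<open>P\<close>\<close>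
  finally have T'1: "mob (T' ** ?s1) = mob ((?s3 ** ?s1) ** T')"
    by (rule cancel) (simp_all add: dets)
  obtain \<kappa> \<sigma> :: real where "\<kappa> \<in> {1, - 1}" "\<sigma> \<in> {1, - 1}"
    "\<And>x. x \<in> riemann_sphere \<Longrightarrow> mob T' x = vector [\<kappa> * x $ 3, \<sigma> * x $ 1, \<kappa> * \<sigma> * x $ 2]"
    using cyclic_normalizer[OF T' T'3 T'1] by metis
  then have T'_V: "mob T' \<in> moebius_stabilizer standard.V"
    by (rule cyclic_stabilizes_standard_V[OF T'])
  define k where "k = mob P"
  define W where "W = k ` standard.V"
  have k: "k \<in> moebius_transformations"
    using P by (simp add: k_def moebius_transformations_eq)
  have W_sphere: "W \<subseteq> riemann_sphere"
    using standard.V_sphere moebius_in_sphere[OF k] unfolding W_def by blast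
  have stab_W: "mob F ` W = W"
    if F: "det F \<noteq> 0" "det N \<noteq> 0" "mob (F ** P) = mob (P ** N)" "mob N \<in> moebius_stabilizer standard.V" for F N
  proof -
    have "mob F ` W = mob (F ** P) ` standard.V"
      unfolding W_def k_def by (rule mob_mult_image[OF F(1) P standard.V_sphere, symmetric])
    also have "\<dots> = mob P ` mob N ` standard.V"
      unfolding F(3) by (rule mob_mult_image[OF P F(2) standard.V_sphere])
    also have "mob N ` standard.V = standard.V"
      using F(4) by blast
    finally show ?thesis
      unfolding W_def k_def .
  qed
  define J where "J = moebius_stabilizer \<alpha> \<inter> moebius_stabilizer W"
  have J_comp: "\<phi> (p \<circ> q) ` W = W" if "p \<in> A4" "q \<in> A4" "\<phi> p ` W = W" "\<phi> q ` W = W" for p q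
  proof -
    have "\<phi> (p \<circ> q) ` W = \<phi> p ` \<phi> q ` W"
      unfolding \<phi>_comp[OF that(1,2)] image_image using W_sphere by (intro image_cong refl) (auto simp: compose_def)
    then show ?thesis
      by (simp only: that(3,4))
  qed
  have W_abt: "\<phi> a ` W = W" "\<phi> b ` W = W" "\<phi> t ` W = W"
    unfolding A(2) B(2) T(2)
    using stab_W[OF A(1) s(1) AP pauli_stabilizes_standard_V(1)] stab_W[OF B(1) s(2) BP pauli_stabilizes_standard_V(2)]
      stab_W[OF T(1) T' _ T'_V] PT' by simp_all
  have W_id: "\<phi> id ` W = W"
    unfolding \<phi>_id mob_id using W_sphere by (auto simp: image_iff)
  have "\<phi> p \<in> J" if "p \<in> {id, a, b, a \<circ> b, t, t \<circ> a, t \<circ> b}" for p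
  proof -
    have "p \<in> A4"
      using that abt A4_comp by auto
    moreover have "\<phi> p ` W = W"
      using that W_id W_abt J_comp[OF abt(1,2) W_abt(1,2)] J_comp[OF abt(3,1) W_abt(3,1)] J_comp[OF abt(3,2) W_abt(3,2)]
      by (elim insertE emptyE) (simp_all only:)
    ultimately show ?thesis
      using \<phi>_mem unfolding J_def by blast
  qed
  then have sub: "\<phi> ` {id, a, b, a \<circ> b, t, t \<circ> a, t \<circ> b} \<subseteq> J"
    by blast
  have card_\<alpha>: "card (moebius_stabilizer \<alpha>) = 12"
    by (rule A4_set_card_stabilizer[OF \<alpha>])
  have "finite (moebius_stabilizer \<alpha>)"
    by (rule card_ge_0_finite) (simp only: card_\<alpha>)
  then have "finite J"
    by (simp add: J_def)
  have "inj_on \<phi> {id, a, b, a \<circ> b, t, t \<circ> a, t \<circ> b}"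
    using \<phi>_inj by (rule inj_on_subset) (use abt A4_comp in auto)
  then have "card (\<phi> ` {id, a, b, a \<circ> b, t, t \<circ> a, t \<circ> b}) = 7"
    by (simp only: card_image card7)
  then have card_J: "card J \<ge> 7"
    using card_mono[OF \<open>finite J\<close> sub] by (simp only:)
  have subgroup_J: "subgroup J (BijGroup riemann_sphere)"
    unfolding J_def
    by (intro group.subgroups_Inter_pair group_BijGroup moebius_stabilizer_subgroup \<alpha>_sphere W_sphere)
  obtain j where j: "j \<in> moebius_transformations"
    and jk: "\<forall>x\<in>riemann_sphere. j (k x) = x" and kj: "\<forall>x\<in>riemann_sphere. k (j x) = x"
    using moebius_inverse[OF k] by blast
  have card_W: "card (moebius_stabilizer W) = 12"
    using bij_betw_same_card[OF bij_betw_moebius_stabilizer_conjugate[OF k j jk kj standard.V_sphere]]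
      A4_set_card_stabilizer[OF standard.A4_set_V] unfolding W_def by (simp only:)
  have "J = moebius_stabilizer \<alpha>"
    by (rule subgroup_order_12_eq[OF group_BijGroup moebius_stabilizer_subgroup[OF \<alpha>_sphere] subgroup_J _ card_\<alpha> card_J])
      (simp add: J_def)
  moreover have "J = moebius_stabilizer W"
    by (rule subgroup_order_12_eq[OF group_BijGroup moebius_stabilizer_subgroup[OF W_sphere] subgroup_J _ card_W card_J])
      (simp add: J_def)
  ultimately have eq: "moebius_stabilizer \<alpha> = moebius_stabilizer W"
    by (rule trans[OF sym])
  have jW: "j ` W = standard.V"
  proof -
    have "j ` W = (\<lambda>x. x) ` standard.V"
      unfolding W_def image_image using jk standard.V_sphere by (intro image_cong) auto
    then show ?thesis
      by simp
  qed
  have "moebius_stabilizer (j ` \<alpha>) = moebius_stabilizer (j ` W)"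
    using bij_betw_imp_surj_on[OF bij_betw_moebius_stabilizer_conjugate[OF j k kj jk \<alpha>_sphere]]
      bij_betw_imp_surj_on[OF bij_betw_moebius_stabilizer_conjugate[OF j k kj jk W_sphere]]
    unfolding eq by (rule trans[OF sym])
  then show ?thesis
    using that[OF j] unfolding jW by blast
qed

section \<open>Component indices and cardinalities\<close>

context tetrahedron
begin

text \<open>Without generic orbits the case \<open>\<nu> \<noteq> 1\<close> means that \<open>V\<close> and the
  face points occur together or not at all, which makes the symmetry group too large.\<close>

lemma component_index_order_12:
  assumes \<alpha>: "finite_union_of_orbits V \<alpha>" and card: "card (moebius_stabilizer \<alpha>) = 12"
    and index: "component_index V \<alpha> = (\<nu>, \<epsilon>, k)"
  shows "card \<alpha> = 4 * \<nu> + 6 * \<epsilon> + 12 * k" "\<nu> \<le> 2" "\<epsilon> \<le> 1" "k = 0 \<Longrightarrow> \<nu> = 1"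
proof -
  obtain \<O> where \<O>: "finite \<O>" "\<O> \<subseteq> orbits" "\<alpha> = \<Union>\<O>"
    using \<alpha> by (auto simp: finite_union_of_orbits_iff)
  have idx: "card (\<O> \<inter> {V, F}) = \<nu>" "card (\<O> \<inter> {E}) = \<epsilon>" "card (\<O> \<inter> generic_orbits V) = k"
    using index unfolding \<O>(3) component_index_Union[OF \<O>(2)] by simp_all
  show "card \<alpha> = 4 * \<nu> + 6 * \<epsilon> + 12 * k"
    using card_Union_orbits[OF \<O>(2,1)] unfolding idx \<O>(3) .
  have VF: "card {V, F} = 2"
    using orbit_types_distinct by simp
  show "\<nu> \<le> 2"
    using card_mono[of "{V, F}" "\<O> \<inter> {V, F}"] VF idx(1) by simp
  show "\<epsilon> \<le> 1"
    using card_mono[of "{E}" "\<O> \<inter> {E}"] idx(2) by simp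
  assume "k = 0"
  show "\<nu> = 1"
  proof (rule ccontr)
    assume "\<nu> \<noteq> 1"
    have "\<O> \<inter> generic_orbits V = {}"
      using idx(3) \<open>k = 0\<close> \<O>(1) by simp
    then have sub: "\<O> \<subseteq> {V, F, E}"
      using \<O>(2) orbits_eq by blast
    have "V \<in> \<O> \<longleftrightarrow> F \<in> \<O>"
    proof (rule ccontr)
      assume "\<not> ?thesis"
      then have "\<O> \<inter> {V, F} = {V} \<or> \<O> \<inter> {V, F} = {F}"
        by blast
      then show False
        using idx(1) \<open>\<nu> \<noteq> 1\<close> by auto
    qed
    then show False
      using octahedral_not_order_12[OF sub] card \<O>(3) by blast
  qed
qed

lemma A4_set_of_index_imp:
  assumes "A4_set_of_index V (\<nu>, \<epsilon>, k) \<alpha>"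
  shows "card \<alpha> = 4 * \<nu> + 6 * \<epsilon> + 12 * k" "k = 0 \<Longrightarrow> \<nu> = 1"
  using assms component_index_order_12[of \<alpha> \<nu> \<epsilon> k] A4_set_card_stabilizer[of \<alpha>]
  by (simp_all add: A4_set_of_index_def)

lemma exists_A4_set_of_index:
  assumes "\<nu> \<in> {0, 1, 2}" "\<epsilon> \<in> {0, 1}" "k \<ge> 1 \<or> \<nu> = 1"
  shows "\<exists>\<alpha>. A4_set_of_index V (\<nu>, \<epsilon>, k) \<alpha>"
proof -
  define \<T> where "\<T> = (if \<nu> = 0 then {} else if \<nu> = 1 then {V} else {V, F})
    \<union> (if \<epsilon> = 0 then {} else {E})"
  have \<T>: "\<T> \<subseteq> {V, F, E}"
    by (auto simp: \<T>_def)
  have cards: "card (\<T> \<inter> {V, F}) = \<nu>" "card (\<T> \<inter> {E}) = \<epsilon>"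
    using assms(1,2) orbit_types_distinct by (auto simp: \<T>_def)
  show ?thesis
  proof (cases "k \<ge> 1")
    case True
    then show ?thesis
      using exists_A4_set_with_generic_orbits[OF \<T>] unfolding cards by blast
  next
    case False
    then have k: "k = 0" "\<nu> = 1"
      using assms(3) by auto
    have orb: "\<T> \<subseteq> orbits" "finite \<T>" and "\<T> \<inter> generic_orbits V = {}"
      using \<T> V_orbit face_points_orbit edge_points_orbit orbit_types_distinct by (auto simp: \<T>_def)
    then have "component_index V (\<Union>\<T>) = (\<nu>, \<epsilon>, k)"
      unfolding component_index_Union[OF orb(1)] cards by (simp add: k)
    moreover have "finite_union_of_orbits V (\<Union>\<T>)"
      unfolding finite_union_of_orbits_iff using orb by blast
    moreover have "A4_set (\<Union>\<T>)"
      using A4_set_V A4_set_V_edge_points k(2) by (simp add: \<T>_def)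
    ultimately show ?thesis
      unfolding A4_set_of_index_def by blast
  qed
qed

end

text \<open>Conjugation preserves cardinalities, so one may assume that the stabilizer is the standard tetrahedral
  group; the set is then a union of its orbits.\<close>

theorem card_A4_set:
  assumes "A4_set \<alpha>"
  shows "\<exists>\<nu>\<in>{0, 1, 2}. \<exists>\<epsilon>\<in>{0, 1}. \<exists>k. (k \<ge> 1 \<or> \<nu> = 1) \<and> card \<alpha> = 4 * \<nu> + 6 * \<epsilon> + 12 * k"
proof -
  obtain j where j: "j \<in> moebius_transformations"
    and eq: "moebius_stabilizer (j ` \<alpha>) = moebius_stabilizer standard.V"
    using A4_set_conjugate_to_standard[OF assms] .
  have \<alpha>: "finite \<alpha>" "\<alpha> \<subseteq> riemann_sphere"
    using assms by (simp_all add: A4_set_def)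
  define \<beta> where "\<beta> = j ` \<alpha>"
  have \<beta>: "finite \<beta>" "\<beta> \<subseteq> riemann_sphere"
    using \<alpha> moebius_in_sphere[OF j] unfolding \<beta>_def by blast+
  have "inj_on j \<alpha>"
    using moebius_bij_betw[OF j] \<alpha>(2) by (auto simp: bij_betw_def intro: inj_on_subset)
  then have card_\<beta>: "card \<beta> = card \<alpha>"
    unfolding \<beta>_def by (rule card_image)
  have "standard.invariant \<beta>"
    unfolding standard.invariant_def
  proof (intro ballI)
    fix p x assume p: "p \<in> A4" and x: "x \<in> \<beta>"
    have "restrict (standard.rot p) riemann_sphere ` \<beta> = \<beta>"
      using p eq standard.moebius_stabilizer_V unfolding \<beta>_def by blast
    then have "restrict (standard.rot p) riemann_sphere x \<in> \<beta>"
      using x by blast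
    then show "standard.act p x \<in> \<beta>"
      using x \<beta>(2) standard.rot_A4[OF p] by (auto simp: subset_iff)
  qed
  then have "finite_union_of_orbits standard.V \<beta>"
    using standard.invariant_imp_finite_union_of_orbits \<beta> by blast
  moreover have "card (moebius_stabilizer \<beta>) = 12"
    using A4_set_card_stabilizer[OF standard.A4_set_V] eq unfolding \<beta>_def by (simp only:)
  moreover obtain \<nu> \<epsilon> k where "component_index standard.V \<beta> = (\<nu>, \<epsilon>, k)"
    by (metis prod_cases3)
  ultimately have "card \<beta> = 4 * \<nu> + 6 * \<epsilon> + 12 * k" "\<nu> \<le> 2" "\<epsilon> \<le> 1" "k = 0 \<Longrightarrow> \<nu> = 1"
    using standard.component_index_order_12 by blast+
  moreover from this have "\<nu> \<in> {0, 1, 2}" "\<epsilon> \<in> {0, 1}" "k \<ge> 1 \<or> \<nu> = 1"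
    by (auto, cases "k = 0", auto)
  ultimately show ?thesis
    unfolding card_\<beta> by blast
qed

theorem theorem9:
  fixes V :: "(real ^ 3) set"
  assumes "inscribed_regular_tetrahedron V"
  shows
    "((\<exists>\<alpha>. A4_set_of_index V (1, 0, 0) \<alpha>) \<and>
      (\<forall>\<alpha>. A4_set_of_index V (1, 0, 0) \<alpha> \<longrightarrow> card \<alpha> = 4) \<and>
      (\<exists>\<alpha>. A4_set_of_index V (1, 1, 0) \<alpha>) \<and>
      (\<forall>\<alpha>. A4_set_of_index V (1, 1, 0) \<alpha> \<longrightarrow> card \<alpha> = 10) \<and>
      (\<forall>\<nu>\<in>{0, 1, 2}. \<forall>\<epsilon>\<in>{0, 1}. \<forall>k\<ge>1.
         (\<exists>\<alpha>. A4_set_of_index V (\<nu>, \<epsilon>, k) \<alpha>) \<and>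
         (\<forall>\<alpha>. A4_set_of_index V (\<nu>, \<epsilon>, k) \<alpha> \<longrightarrow> card \<alpha> = 4 * \<nu> + 6 * \<epsilon> + 12 * k))) \<and>
     (\<forall>i\<in>{(2, 0, 0), (0, 1, 0), (2, 1, 0)}. \<not> (\<exists>\<alpha>. A4_set_of_index V i \<alpha>)) \<and>
     {card \<alpha> | \<alpha>. A4_set \<alpha>} =
       {x + 12 * k | x k. x \<in> {0, 4, 6, 8, 10, 14} \<and> k \<ge> 1} \<union> {4, 10}"
proof -
  obtain v where "tetrahedron v" and V: "V = tetrahedron.V v"
    using inscribed_regular_tetrahedron_vertices[OF assms] .
  interpret T: tetrahedron v
    by fact
  have ex: "\<exists>\<alpha>. A4_set_of_index V (\<nu>, \<epsilon>, k) \<alpha>"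
    if "\<nu> \<in> {0, 1, 2}" "\<epsilon> \<in> {0, 1}" "k \<ge> 1 \<or> \<nu> = 1" for \<nu> \<epsilon> k
    unfolding V using that by (rule T.exists_A4_set_of_index)
  have imp: "card \<alpha> = 4 * \<nu> + 6 * \<epsilon> + 12 * k" "k = 0 \<Longrightarrow> \<nu> = 1"
    if "A4_set_of_index V (\<nu>, \<epsilon>, k) \<alpha>" for \<nu> \<epsilon> k \<alpha>
    using that T.A4_set_of_index_imp unfolding V by blast+
  have cards: "{card \<alpha> | \<alpha>. A4_set \<alpha>}
      = {4 * \<nu> + 6 * \<epsilon> + 12 * k | \<nu> \<epsilon> k. \<nu> \<in> {0, 1, 2} \<and> \<epsilon> \<in> {0, 1} \<and> (k \<ge> 1 \<or> \<nu> = 1)}" (is "?L = ?M")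
  proof
    show "?L \<subseteq> ?M"
    proof
      fix n assume "n \<in> ?L"
      then obtain \<alpha> where "A4_set \<alpha>" "n = card \<alpha>"
        by blast
      then show "n \<in> ?M"
        using card_A4_set[of \<alpha>] by blast
    qed
    show "?M \<subseteq> ?L"
    proof
      fix n assume "n \<in> ?M"
      then obtain \<nu> \<epsilon> k where *: "n = 4 * \<nu> + 6 * \<epsilon> + 12 * k" "\<nu> \<in> {0, 1, 2}" "\<epsilon> \<in> {0, 1}" "k \<ge> 1 \<or> \<nu> = 1"
        by blast
      then obtain \<alpha> where \<alpha>: "A4_set_of_index V (\<nu>, \<epsilon>, k) \<alpha>"
        using ex by blast
      then have "A4_set \<alpha>" "n = card \<alpha>"
        using imp(1)[OF \<alpha>] *(1) by (simp_all add: A4_set_of_index_def)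
      then show "n \<in> ?L"
        by blast
    qed
  qed
  also have "?M = {x + 12 * k | x k. x \<in> {0, 4, 6, 8, 10, 14} \<and> k \<ge> 1} \<union> {4, 10}" (is "_ = ?R")
  proof
    show "?M \<subseteq> ?R"
    proof
      fix n assume "n \<in> ?M"
      then obtain \<nu> \<epsilon> k where *: "n = 4 * \<nu> + 6 * \<epsilon> + 12 * k" "\<nu> \<in> {0, 1, 2}" "\<epsilon> \<in> {0, 1}" "k \<ge> 1 \<or> \<nu> = 1"
        by blast
      show "n \<in> ?R"
      proof (cases "k \<ge> 1")
        case True
        moreover have "4 * \<nu> + 6 * \<epsilon> \<in> {0, 4, 6, 8, 10, 14}"
          using *(2,3) by auto
        ultimately show ?thesis
          using *(1) by blast
      next
        case False
        then show ?thesis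
          using * by auto
      qed
    qed
    show "?R \<subseteq> ?M"
    proof
      fix n assume n: "n \<in> ?R"
      have M: "4 * \<nu> + 6 * \<epsilon> + 12 * k \<in> ?M" if "\<nu> \<in> {0, 1, 2}" "\<epsilon> \<in> {0, 1}" "k \<ge> 1 \<or> \<nu> = 1" for \<nu> \<epsilon> k
        using that by blast
      show "n \<in> ?M"
        using n
      proof
        assume "n \<in> {x + 12 * k | x k. x \<in> {0, 4, 6, 8, 10, 14} \<and> k \<ge> 1}"
        then obtain x k where xk: "n = x + 12 * k" "x \<in> {0, 4, 6, 8, 10, 14}" "k \<ge> 1"
          by blast
        have "\<exists>\<nu>\<in>{0, 1, 2}. \<exists>\<epsilon>\<in>{0, 1}. x = 4 * \<nu> + 6 * \<epsilon>"
          using xk(2) by auto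
        then obtain \<nu> \<epsilon> where "\<nu> \<in> {0, 1, 2}" "\<epsilon> \<in> {0, 1}" "x = 4 * \<nu> + 6 * \<epsilon>"
          by blast
        then show ?thesis
          using xk(1,3) M[of \<nu> \<epsilon> k] by blast
      next
        assume "n \<in> {4, 10}"
        then consider "n = 4 * 1 + 6 * 0 + 12 * 0" | "n = 4 * 1 + 6 * 1 + 12 * 0"
          by auto
        then show ?thesis
        proof cases
          case 1
          show ?thesis
            unfolding 1 by (rule M) simp_all
        next
          case 2
          show ?thesis
            unfolding 2 by (rule M) simp_all
        qed
      qed
    qed
  qed
  finally have "{card \<alpha> | \<alpha>. A4_set \<alpha>} = ?R" .
  moreover have "\<forall>i\<in>{(2, 0, 0), (0, 1, 0), (2, 1, 0)}. \<not> (\<exists>\<alpha>. A4_set_of_index V i \<alpha>)"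
    using imp(2)[of 2 0 0] imp(2)[of 0 1 0] imp(2)[of 2 1 0] by auto
  moreover have "\<forall>\<alpha>. A4_set_of_index V (1, 0, 0) \<alpha> \<longrightarrow> card \<alpha> = 4"
    "\<forall>\<alpha>. A4_set_of_index V (1, 1, 0) \<alpha> \<longrightarrow> card \<alpha> = 10"
    using imp(1)[of 1 0 0] imp(1)[of 1 1 0] by auto
  moreover have "\<exists>\<alpha>. A4_set_of_index V (1, 0, 0) \<alpha>" "\<exists>\<alpha>. A4_set_of_index V (1, 1, 0) \<alpha>"
    by (rule ex; simp)+
  moreover have "\<forall>\<nu>\<in>{0, 1, 2}. \<forall>\<epsilon>\<in>{0, 1}. \<forall>k\<ge>1.
         (\<exists>\<alpha>. A4_set_of_index V (\<nu>, \<epsilon>, k) \<alpha>) \<and>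
         (\<forall>\<alpha>. A4_set_of_index V (\<nu>, \<epsilon>, k) \<alpha> \<longrightarrow> card \<alpha> = 4 * \<nu> + 6 * \<epsilon> + 12 * k)"
    using ex imp(1) by blast
  ultimately show ?thesis
    by (intro conjI)
qed

end
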